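(* Let $(\mathcal{C}; \leq)$ be either the class $(\mathcal{C}_0; \leq_s)$ or a class $(\mathcal{C}_F; \leq_d)$ of finite $2$-sparse graphs, where in the latter case we assume that $(\mathcal{C}_F; \leq_d)$ is a free amalgamation class, that all vertices are $d$-closed in all structures in $\mathcal{C}_F$ (that is, $\{a\} \leq_d A$ whenever $a \in A \in \mathcal{C}_F$), and that $\mathcal{C}_F$ contains a graph with an edge. Let $M$ be the Fra\"{\i}ss\'e limit of $(\mathcal{C}; \leq)$, let $G = \mathrm{Aut}(M)$, and let $X(\mathcal{D})$ be the $G$-flow of all $2$-orientations of $M$. If $Y$ is a minimal $G$-subflow of $X(\mathcal{D})$, then all $G$-orbits on $Y$ are meagre in $Y$.
   Context: Graphs are undirected, without loops or multiple edges; subgraphs are induced. A graph is $2$-sparse if every finite set $B$ of vertices spans at most $2|B|$ edges. A $2$-orientation of a graph is a choice of exactly one direction for each edge such that every vertex has out-valency at most $2$. $\mathcal{C}_0$ is the class of all finite $2$-sparse graphs. For $A \subseteq B \in \mathcal{C}_0$, $A \leq_s B$ means that $B$ has a $2$-orientation in which no directed edge goes from a vertex of $A$ to a vertex outside $A$. Let $\delta(A) = 2|A| - e(A)$, with $e(A)$ the number of edges of $A$. For $A \subseteq B \in \mathcal{C}_0$, $A \leq_d B$ means $\delta(A) < \delta(C)$ whenever $A \subsetneq C \subseteq B$. Let $F : \mathbb{R}^{\geq 0} \to \mathbb{R}^{\geq 0}$ be a continuous, increasing function with $F(0)=0$ and $F(x) \to \infty$ as $x \to \infty$; then $\mathcal{C}_F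 = \{B \in \mathcal{C}_0 : \delta(A) \geq F(|A|) \text{ for all } A \subseteq B\}$. $(\mathcal{C}; \leq)$ is a free amalgamation class if, whenever $A \leq B_1, B_2$ are in $\mathcal{C}$, the free amalgam $E$ of $B_1$ and $B_2$ over $A$ (vertex set the disjoint union of $B_1, B_2$ over $A$, edge set the union of the edge sets) is in $\mathcal{C}$ and $B_1, B_2 \leq E$. An embedding $f : A \to B$ between members of $\mathcal{C}$ is strong if $f(A) \leq B$. The Fra\"{\i}ss\'e limit of $(\mathcal{C};\leq)$ is the (unique up to isomorphism) countable graph $M$ which is the union of a chain $A_0 \leq A_1 \leq \cdots$ of members of $\mathcal{C}$ such that every $A \in \mathcal{C}$ has a strong embedding into some $A_i$, and for every strong $f : A_i \to B \in \mathcal{C}$ there are $j \geq i$ and a strong $g : B \to A_j$ with $g(f(a)) = a$ for all $a \in A_i$. $\mathrm{Aut}(M)$ has the topology of pointwise convergence. $X(\mathcal{D})$ is the set of all $2$-orientations $S \subseteq M^2$ of $M$, viewed as a closed subspace of $\{0,1\}^{M^2}$ with the product topology and the natural action of $G$. A minimal subflow is a non-empty closed $G$-invariant subset in which every $G$-orbit is dense. *)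

theory Defs
  imports "HOL-Analysis.Analysis" "HOL-Library.Infinite_Typeclass"
begin

section \<open>Graphs, sparsity and orientations\<close>

text \<open>Edges are two-element sets of vertices. The classes of finite graphs below consist of all
  finite graphs with vertices in a type \<open>'a\<close>; when \<open>'a\<close> is infinite, this is every finite graph
  up to isomorphism.\<close>

datatype 'a graph = Graph (verts: "'a set") (edges: "'a set set")

definition is_graph :: "'a graph \<Rightarrow> bool" where
  "is_graph G \<longleftrightarrow> (\<forall>e\<in>edges G. e \<subseteq> verts G \<and> card e = 2)"

definition induced :: "'a graph \<Rightarrow> 'a set \<Rightarrow> 'a graph" where
  "induced G W = Graph W {e \<in> edges G. e \<subseteq> W}"

definition subgraph :: "'a graph \<Rightarrow> 'a graph \<Rightarrow> bool" where
  "subgraph A B \<longleftrightarrow> verts A \<subseteq> verts B \<and> A = induced B (verts A)"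

definition two_sparse :: "'a graph \<Rightarrow> bool" where
  "two_sparse G \<longleftrightarrow>
     (\<forall>W. finite W \<and> W \<subseteq> verts G \<longrightarrow> card (edges (induced G W)) \<le> 2 * card W)"

definition two_orientation :: "'a graph \<Rightarrow> ('a \<times> 'a) set \<Rightarrow> bool" where
  "two_orientation G S \<longleftrightarrow>
     S \<subseteq> verts G \<times> verts G \<and>
     (\<forall>(x, y)\<in>S. {x, y} \<in> edges G) \<and>
     (\<forall>x y. {x, y} \<in> edges G \<longrightarrow> ((x, y) \<in> S) \<noteq> ((y, x) \<in> S)) \<and>
     (\<forall>x\<in>verts G. finite {y. (x, y) \<in> S} \<and> card {y. (x, y) \<in> S} \<le> 2)"

section \<open>The two kinds of classes of finite graphs\<close>

definition class_C0 :: "'a graph set" where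
  "class_C0 = {G. is_graph G \<and> finite (verts G) \<and> two_sparse G}"

definition leq_s :: "'a graph \<Rightarrow> 'a graph \<Rightarrow> bool" where
  "leq_s A B \<longleftrightarrow> subgraph A B \<and>
     (\<exists>S. two_orientation B S \<and> \<not> (\<exists>(x, y)\<in>S. x \<in> verts A \<and> y \<notin> verts A))"

definition predim :: "'a graph \<Rightarrow> int" where
  "predim A = 2 * int (card (verts A)) - int (card (edges A))"

definition leq_d :: "'a graph \<Rightarrow> 'a graph \<Rightarrow> bool" where
  "leq_d A B \<longleftrightarrow> subgraph A B \<and>
     (\<forall>W. verts A \<subset> W \<and> W \<subseteq> verts B \<longrightarrow> predim A < predim (induced B W))"

text \<open>Only the values of the control function on the non-negative reals matter; it is not
  required to be strictly increasing.\<close>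

definition control_function :: "(real \<Rightarrow> real) \<Rightarrow> bool" where
  "control_function F \<longleftrightarrow>
     F \<in> {0..} \<rightarrow> {0..} \<and> continuous_on {0..} F \<and> mono_on {0..} F \<and>
     F 0 = 0 \<and> filterlim F at_top at_top"

definition class_CF :: "(real \<Rightarrow> real) \<Rightarrow> 'a graph set" where
  "class_CF F = {B \<in> class_C0.
     \<forall>W\<subseteq>verts B. real_of_int (predim (induced B W)) \<ge> F (real (card W))}"

section \<open>Free amalgamation and \<open>Fraisse\<close> limits\<close>

definition free_amalgam :: "'a graph \<Rightarrow> 'a graph \<Rightarrow> 'a graph" where
  "free_amalgam B1 B2 = Graph (verts B1 \<union> verts B2) (edges B1 \<union> edges B2)"

text \<open>The disjoint union over \<open>A\<close> is expressed by \<open>verts B1 \<inter> verts B2 = verts A\<close>. For the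
  isomorphism-closed classes considered here, this is no restriction.\<close>

definition free_amalgamation_class ::
    "'a graph set \<Rightarrow> ('a graph \<Rightarrow> 'a graph \<Rightarrow> bool) \<Rightarrow> bool" where
  "free_amalgamation_class C leq \<longleftrightarrow>
     (\<forall>A\<in>C. \<forall>B1\<in>C. \<forall>B2\<in>C.
        leq A B1 \<and> leq A B2 \<and> verts B1 \<inter> verts B2 = verts A \<longrightarrow>
        free_amalgam B1 B2 \<in> C \<and>
        leq B1 (free_amalgam B1 B2) \<and> leq B2 (free_amalgam B1 B2))"

definition graph_embedding :: "('a \<Rightarrow> 'a) \<Rightarrow> 'a graph \<Rightarrow> 'a graph \<Rightarrow> bool" where
  "graph_embedding f A B \<longleftrightarrow>
     inj_on f (verts A) \<and> f ` verts A \<subseteq> verts B \<and>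
     (\<forall>x\<in>verts A. \<forall>y\<in>verts A. {x, y} \<in> edges A \<longleftrightarrow> {f x, f y} \<in> edges B)"

definition strong_embedding ::
    "('a graph \<Rightarrow> 'a graph \<Rightarrow> bool) \<Rightarrow> ('a \<Rightarrow> 'a) \<Rightarrow> 'a graph \<Rightarrow> 'a graph \<Rightarrow> bool" where
  "strong_embedding leq f A B \<longleftrightarrow>
     graph_embedding f A B \<and> leq (induced B (f ` verts A)) B"

definition fraisse_limit ::
    "'a graph set \<Rightarrow> ('a graph \<Rightarrow> 'a graph \<Rightarrow> bool) \<Rightarrow> 'a graph \<Rightarrow> bool" where
  "fraisse_limit C leq M \<longleftrightarrow>
     is_graph M \<and> countable (verts M) \<and>
     (\<exists>A :: nat \<Rightarrow> 'a graph.
        (\<forall>i. A i \<in> C \<and> leq (A i) (A (Suc i))) \<and>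
        verts M = (\<Union>i. verts (A i)) \<and> edges M = (\<Union>i. edges (A i)) \<and>
        (\<forall>B\<in>C. \<exists>i f. strong_embedding leq f B (A i)) \<and>
        (\<forall>i. \<forall>B\<in>C. \<forall>f. strong_embedding leq f (A i) B \<longrightarrow>
           (\<exists>j\<ge>i. \<exists>g. strong_embedding leq g B (A j) \<and> (\<forall>a\<in>verts (A i). g (f a) = a))))"

section \<open>The flow of orientations\<close>

text \<open>Automorphisms are taken extensional (undefined outside the vertex set), so that each
  automorphism is represented by exactly one function.\<close>

definition automorphisms :: "'a graph \<Rightarrow> ('a \<Rightarrow> 'a) set" where
  "automorphisms M = {g \<in> extensional (verts M).
     bij_betw g (verts M) (verts M) \<and>
     (\<forall>x\<in>verts M. \<forall>y\<in>verts M. {x, y} \<in> edges M \<longleftrightarrow> {g x, g y} \<in> edges M)}"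

definition act :: "('a \<Rightarrow> 'a) \<Rightarrow> ('a \<times> 'a) set \<Rightarrow> ('a \<times> 'a) set" where
  "act g S = map_prod g g ` S"

definition orbit_of :: "'a graph \<Rightarrow> ('a \<times> 'a) set \<Rightarrow> ('a \<times> 'a) set set" where
  "orbit_of M S = (\<lambda>g. act g S) ` automorphisms M"

text \<open>The power set of \<open>W\<close> with the product topology of \<open>{0,1}\<^sup>W\<close>, where \<open>{0,1}\<close> is discrete,
  transported along the bijection sending a subset to its characteristic function on \<open>W\<close>.\<close>

definition powerset_topology :: "'b set \<Rightarrow> 'b set topology" where
  "powerset_topology W =
     pullback_topology (Pow W) (\<lambda>S. \<lambda>p\<in>W. p \<in> S)
       (product_topology (\<lambda>_. discrete_topology (UNIV :: bool set)) W)"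

definition orientation_space :: "'a graph \<Rightarrow> ('a \<times> 'a) set topology" where
  "orientation_space M =
     subtopology (powerset_topology (verts M \<times> verts M)) {S. two_orientation M S}"

definition minimal_subflow :: "'a graph \<Rightarrow> ('a \<times> 'a) set set \<Rightarrow> bool" where
  "minimal_subflow M Y \<longleftrightarrow>
     Y \<noteq> {} \<and> closedin (orientation_space M) Y \<and>
     (\<forall>g\<in>automorphisms M. \<forall>S\<in>Y. act g S \<in> Y) \<and>
     (\<forall>S\<in>Y. subtopology (orientation_space M) Y closure_of orbit_of M S = Y)"

definition nowhere_dense_in :: "'b topology \<Rightarrow> 'b set \<Rightarrow> bool" where
  "nowhere_dense_in X N \<longleftrightarrow> N \<subseteq> topspace X \<and> X interior_of (X closure_of N) = {}"

definition meagre_in :: "'b topology \<Rightarrow> 'b set \<Rightarrow> bool" where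
  "meagre_in X S \<longleftrightarrow> (\<exists>\<N>. countable \<N> \<and> (\<forall>N\<in>\<N>. nowhere_dense_in X N) \<and> S = \<Union>\<N>)"

end

theory Submission
  imports Defs
begin

text \<open>
  Suppose that the orbit of \<open>S \<in> Y\<close> is not meagre. A Baire category argument together with
  minimality and compactness shows that the sequence of sizes of the out-balls of \<open>S\<close> around a vertex
  \<open>a\<close> recurs: for some finite set \<open>D\<close> of vertices, every translate of \<open>D\<close> contains a vertex of the
  orbit of \<open>a\<close> with the same sequence of sizes.

  On the other hand, every finite set lies in a strong set \<open>D\<close> with finitely many slots, of which
  there are copies in \<open>M\<close> whose out-edges, two at each vertex, either stay in the copy or lead from
  the slots to the roots of disjoint full binary out-trees of arbitrarily large depth, each of which
  is eventually not full. Letting this depth grow along a sequence of copies, two copies oriented in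
  the same way have different sequences of sizes at each vertex, whereas by pigeonhole the recurring
  sequence would have to occur twice at the same vertex.

  The slots come from counting. For 2-sparse graphs, \<open>D\<close> with an orientation is completed by leaves,
  whose edges can be forced to point away from the copy by identifying the leaves with vertices of
  the base. For the predimension classes, one out-edge may be lost in each copy, and a pair of copies
  is joined so as to lose only one in total.
\<close>

text \<open>The orientation \<open>S\<close> cannot be chosen; all that can be chosen is where
  finite strong sets sit in \<open>M\<close>. Copies are therefore controlled by counting. The
  number of edges inside a copy of \<open>D\<close> is fixed, and an edge between the copy and a
  base \<open>T\<close> must leave the copy once the copy avoids the out-neighbours of
  \<open>T\<close>. If these edges number \<open>2 * card D\<close>, out-degree at most 2 leaves
  room for no other out-edge. Sizes of out-balls serve as the invariant because automorphisms
  preserve them and because agreement on a finite set of arcs bounds them from below. The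
  orientation inside a copy stays unknown, but it is one of finitely many; the trees at the slots
  are full and disjoint, so they contribute the largest possible amount, which a copy whose trees
  have already failed to be full cannot match. For the predimension, strength is a strict
  inequality: leaves attached to \<open>D\<close> form a strong set by themselves only if every
  non-empty part of \<open>D\<close> keeps value at least 1. This is where the one lost out-edge
  comes from.\<close>

section \<open>Automorphisms and their action on sets of arcs\<close>

lemma aut_bij: "g \<in> automorphisms M \<Longrightarrow> bij_betw g (verts M) (verts M)"
  by (simp add: automorphisms_def)

lemma aut_in: "g \<in> automorphisms M \<Longrightarrow> x \<in> verts M \<Longrightarrow> g x \<in> verts M"
  using aut_bij bij_betwE by blast

lemma aut_inj: "g \<in> automorphisms M \<Longrightarrow> W \<subseteq> verts M \<Longrightarrow> inj_on g W"
  using aut_bij bij_betw_imp_inj_on inj_on_subset by blast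

lemma aut_edge:
  "g \<in> automorphisms M \<Longrightarrow> x \<in> verts M \<Longrightarrow> y \<in> verts M \<Longrightarrow>
    {g x, g y} \<in> edges M \<longleftrightarrow> {x, y} \<in> edges M"
  by (simp add: automorphisms_def)

lemma aut_id: "restrict id (verts M) \<in> automorphisms M"
  by (auto simp: automorphisms_def bij_betw_def inj_on_def)

lemma aut_comp:
  assumes "g \<in> automorphisms M" "h \<in> automorphisms M"
  shows "restrict (g \<circ> h) (verts M) \<in> automorphisms M"
proof -
  have "bij_betw (g \<circ> h) (verts M) (verts M)"
    using assms aut_bij bij_betw_trans by blast
  then have "bij_betw (restrict (g \<circ> h) (verts M)) (verts M) (verts M)"
    by (simp add: bij_betw_cong[where f = "restrict (g \<circ> h) (verts M)" and g = "g \<circ> h"])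
  moreover have "{x, y} \<in> edges M \<longleftrightarrow> {g (h x), g (h y)} \<in> edges M"
    if "x \<in> verts M" "y \<in> verts M" for x y
    using aut_edge[OF assms(2) that] aut_edge[OF assms(1) aut_in aut_in, OF assms(2) that(1) assms(2) that(2)]
    by simp
  ultimately show ?thesis
    by (simp add: automorphisms_def)
qed

lemma aut_inv:
  assumes "g \<in> automorphisms M"
  shows "\<exists>g'\<in>automorphisms M. (\<forall>x\<in>verts M. g' (g x) = x) \<and> (\<forall>x\<in>verts M. g (g' x) = x)"
proof -
  let ?V = "verts M"
  let ?g' = "restrict (inv_into ?V g) ?V"
  have b: "bij_betw g ?V ?V" using assms by (rule aut_bij)
  have l: "?g' (g x) = x" if "x \<in> ?V" for x
    using that b by (simp add: bij_betw_inv_into_left aut_in[OF assms])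
  have r: "g (?g' x) = x" if "x \<in> ?V" for x
    using that b by (simp add: bij_betw_inv_into_right)
  have "bij_betw (inv_into ?V g) ?V ?V" using b by (rule bij_betw_inv_into)
  then have bi: "bij_betw ?g' ?V ?V"
    by (simp add: bij_betw_cong[where f = ?g' and g = "inv_into ?V g"])
  have "{x, y} \<in> edges M \<longleftrightarrow> {?g' x, ?g' y} \<in> edges M" if "x \<in> ?V" "y \<in> ?V" for x y
  proof -
    have "?g' x \<in> ?V" "?g' y \<in> ?V" using bi that bij_betwE by blast+
    then show ?thesis using aut_edge[OF assms, of "?g' x" "?g' y"] r that by simp
  qed
  then have "?g' \<in> automorphisms M" using bi by (simp add: automorphisms_def)
  then show ?thesis using l r by blast
qed

lemma act_comp:
  assumes "S \<subseteq> verts M \<times> verts M"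
  shows "act (restrict (g \<circ> h) (verts M)) S = act g (act h S)"
  unfolding act_def image_image using assms by (intro image_cong refl) auto

lemma act_sub: "g \<in> automorphisms M \<Longrightarrow> S \<subseteq> verts M \<times> verts M \<Longrightarrow> act g S \<subseteq> verts M \<times> verts M"
  using aut_in unfolding act_def by fastforce

lemma act_mem:
  assumes "g \<in> automorphisms M" "S \<subseteq> verts M \<times> verts M" "x \<in> verts M" "y \<in> verts M"
  shows "(g x, g y) \<in> act g S \<longleftrightarrow> (x, y) \<in> S"
proof
  assume "(g x, g y) \<in> act g S"
  then obtain u v where "(u, v) \<in> S" "g x = g u" "g y = g v" unfolding act_def by auto
  moreover have "u \<in> verts M" "v \<in> verts M" using assms(2) \<open>(u, v) \<in> S\<close> by auto
  ultimately have "x = u" "y = v"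
    using aut_inj[OF assms(1) subset_refl] assms(3,4) by (auto dest: inj_onD)
  then show "(x, y) \<in> S" using \<open>(u, v) \<in> S\<close> by simp
next
  assume "(x, y) \<in> S"
  then show "(g x, g y) \<in> act g S" unfolding act_def by force
qed

lemma act_inv:
  assumes "S \<subseteq> verts M \<times> verts M" "\<And>x. x \<in> verts M \<Longrightarrow> g' (g x) = x"
  shows "act g' (act g S) = S"
proof -
  have "map_prod g' g' (map_prod g g p) = p" if "p \<in> S" for p
    using assms that by (cases p) auto
  then show ?thesis unfolding act_def image_image by (simp cong: image_cong)
qed

lemma act_id: "S \<subseteq> verts M \<times> verts M \<Longrightarrow> act (restrict id (verts M)) S = S"
proof -
  assume "S \<subseteq> verts M \<times> verts M"
  then have "map_prod (restrict id (verts M)) (restrict id (verts M)) p = p" if "p \<in> S" for p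
    using that by (cases p) auto
  then show ?thesis unfolding act_def by (simp cong: image_cong)
qed

section \<open>Out-balls and full binary out-trees\<close>

definition out_ball :: "('a \<times> 'a) set \<Rightarrow> nat \<Rightarrow> 'a \<Rightarrow> 'a set" where
  "out_ball S n x = {y. \<exists>k\<le>n. (x, y) \<in> S ^^ k}"

text \<open>With out-degrees at most 2, \<open>2 ^ (n + 1) - 1\<close> is the largest possible size: the ball is a
  binary tree.\<close>

definition full :: "('a \<times> 'a) set \<Rightarrow> nat \<Rightarrow> 'a \<Rightarrow> bool" where
  "full S n x \<longleftrightarrow> card (out_ball S n x) = 2 ^ Suc n - 1"

text \<open>Quantified over the whole type: vertices outside the graph have no out-arcs, so
  estimates for balls need no membership conditions.\<close>

definition out2 :: "('a \<times> 'a) set \<Rightarrow> bool" where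
  "out2 S \<longleftrightarrow> (\<forall>x. finite (S `` {x}) \<and> card (S `` {x}) \<le> 2)"

lemma two_orientation_out2:
  assumes "two_orientation G S"
  shows "out2 S"
  unfolding out2_def
proof
  fix x
  have e: "S `` {x} = {y. (x, y) \<in> S}" by auto
  show "finite (S `` {x}) \<and> card (S `` {x}) \<le> 2"
  proof (cases "x \<in> verts G")
    case True
    then show ?thesis using assms unfolding two_orientation_def e by blast
  next
    case False
    then have "S `` {x} = {}" using assms unfolding two_orientation_def by blast
    then show ?thesis by simp
  qed
qed

lemma two_orientation_sub: "two_orientation G S \<Longrightarrow> S \<subseteq> verts G \<times> verts G"
  by (simp add: two_orientation_def)

lemma two_orientation_edge: "two_orientation G S \<Longrightarrow> (x, y) \<in> S \<Longrightarrow> {x, y} \<in> edges G"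
  by (auto simp: two_orientation_def)

lemma two_orientation_dir:
  "two_orientation G S \<Longrightarrow> {x, y} \<in> edges G \<Longrightarrow> (x, y) \<in> S \<longleftrightarrow> (y, x) \<notin> S"
  by (simp add: two_orientation_def)

lemma out_ball_self [simp]: "x \<in> out_ball S n x"
  unfolding out_ball_def by (auto intro: exI[of _ 0])

lemma out_ball_0 [simp]: "out_ball S 0 x = {x}"
  unfolding out_ball_def by auto

lemma out_ball_mono: "m \<le> n \<Longrightarrow> out_ball S m x \<subseteq> out_ball S n x"
  unfolding out_ball_def by (auto dest: order_trans)

lemma out_ball_Suc: "out_ball S (Suc n) x = insert x (\<Union>y\<in>S `` {x}. out_ball S n y)"
proof -
  have "(\<exists>k\<le>Suc n. (x, z) \<in> S ^^ k) \<longleftrightarrow> z = x \<or> (\<exists>y. (x, y) \<in> S \<and> (\<exists>k\<le>n. (y, z) \<in> S ^^ k))" for z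
  proof
    assume "\<exists>k\<le>Suc n. (x, z) \<in> S ^^ k"
    then obtain k where k: "k \<le> Suc n" "(x, z) \<in> S ^^ k" by blast
    then show "z = x \<or> (\<exists>y. (x, y) \<in> S \<and> (\<exists>k\<le>n. (y, z) \<in> S ^^ k))"
      by (cases k) (use relpow_Suc_D2 in fastforce)+
  next
    assume "z = x \<or> (\<exists>y. (x, y) \<in> S \<and> (\<exists>k\<le>n. (y, z) \<in> S ^^ k))"
    then show "\<exists>k\<le>Suc n. (x, z) \<in> S ^^ k"
    proof
      assume "z = x"
      then show ?thesis by (auto intro: exI[of _ 0])
    next
      assume "\<exists>y. (x, y) \<in> S \<and> (\<exists>k\<le>n. (y, z) \<in> S ^^ k)"
      then obtain y k where "(x, y) \<in> S" "k \<le> n" "(y, z) \<in> S ^^ k" by blast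
      then show ?thesis by (intro exI[of _ "Suc k"]) (simp add: relpow_Suc_I2 del: relpow.simps)
    qed
  qed
  then show ?thesis unfolding out_ball_def by blast
qed

text \<open>The ball grown at its rim, with the centre fixed. This form serves the persistence of
  non-fullness and the comparison of two orientations; \<open>out_ball_Suc\<close>, which splits at
  the centre, serves inductions over trees.\<close>

lemma out_ball_Suc': "out_ball S (Suc n) x = insert x (S `` out_ball S n x)"
proof -
  have "(\<exists>k\<le>Suc n. (x, z) \<in> S ^^ k) \<longleftrightarrow> z = x \<or> (\<exists>k\<le>n. (x, z) \<in> S ^^ Suc k)" for z
    by (metis le_SucE relpow_0_E relpow_0_I Suc_le_mono le0 not0_implies_Suc)
  then show ?thesis unfolding out_ball_def by (auto simp: relcomp_unfold)
qed

lemma finite_out_ball: "out2 S \<Longrightarrow> finite (out_ball S n x)"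
  by (induction n arbitrary: x) (auto simp: out_ball_Suc out2_def)

lemma card_Union2:
  assumes "finite X" "card X \<le> 2" "\<And>y. y \<in> X \<Longrightarrow> card (B y) \<le> N"
  shows "card (\<Union>y\<in>X. B y) \<le> 2 * N"
proof -
  have "card (\<Union>y\<in>X. B y) \<le> (\<Sum>y\<in>X. card (B y))" using assms(1) by (rule card_UN_le)
  also have "\<dots> \<le> card X * N" using assms(3) by (metis sum_bounded_above of_nat_id)
  also have "\<dots> \<le> 2 * N" using assms(2) by simp
  finally show ?thesis .
qed

text \<open>A full binary tree is a root with two full subtrees.\<close>

lemma double_full: "Suc (2 * (2 ^ Suc n - 1)) = 2 ^ Suc (Suc n) - (1::nat)"
proof -
  have "(2::nat) ^ n \<ge> 1" by simp
  then show ?thesis unfolding power_Suc by linarith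
qed

lemma card_insert_le_Suc: "card (insert x A) \<le> Suc (card A)"
  by (cases "finite A") (auto simp: card_insert_if)

lemma card_out_ball:
  assumes "out2 S"
  shows "card (out_ball S n x) \<le> 2 ^ Suc n - 1"
proof (induction n arbitrary: x)
  case 0
  then show ?case by simp
next
  case (Suc n)
  have "card (\<Union>y\<in>S `` {x}. out_ball S n y) \<le> 2 * (2 ^ Suc n - 1)"
    using assms Suc by (intro card_Union2) (auto simp: out2_def)
  then have "card (out_ball S (Suc n) x) \<le> Suc (2 * (2 ^ Suc n - 1))"
    unfolding out_ball_Suc by (intro order_trans[OF card_insert_le_Suc]) simp
  then show ?case unfolding double_full .
qed

lemma not_full_iff:
  assumes "out2 S"
  shows "\<not> full S n x \<longleftrightarrow> card (out_ball S n x) < 2 ^ Suc n - 1"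
  using card_out_ball[OF assms, of n x] unfolding full_def by linarith

text \<open>Every vertex of the larger ball except the centre is an out-neighbour of the smaller
  ball, so the size at most doubles and grows by one. A deficit is never made up.\<close>

lemma not_full_step:
  assumes "out2 S" "\<not> full S n x"
  shows "\<not> full S (Suc n) x"
proof -
  have "card (S `` out_ball S n x) \<le> 2 * card (out_ball S n x)"
  proof -
    have "card (\<Union>y\<in>out_ball S n x. S `` {y}) \<le> (\<Sum>y\<in>out_ball S n x. card (S `` {y}))"
      using finite_out_ball[OF assms(1)] by (rule card_UN_le)
    also have "\<dots> \<le> card (out_ball S n x) * 2"
      using assms(1) sum_bounded_above[of "out_ball S n x" "\<lambda>y. card (S `` {y})" 2]
      by (auto simp: out2_def)
    finally show ?thesis by (simp add: mult.commute Image_eq_UN[symmetric])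
  qed
  then have "card (out_ball S (Suc n) x) \<le> Suc (2 * card (out_ball S n x))"
    unfolding out_ball_Suc' by (intro order_trans[OF card_insert_le_Suc]) simp
  also have "\<dots> < Suc (2 * (2 ^ Suc n - 1))"
    using iffD1[OF not_full_iff[OF assms(1)] assms(2)] by simp
  also have "\<dots> = 2 ^ Suc (Suc n) - 1" by (rule double_full)
  finally show ?thesis using not_full_iff[OF assms(1)] by (rule iffD2[rotated])
qed

lemma not_full_mono:
  assumes "out2 S" "\<not> full S m x" "m \<le> n"
  shows "\<not> full S n x"
  using assms(3) by (induction n rule: dec_induct) (simp_all add: assms(2) not_full_step[OF assms(1)])

lemma full_0 [simp]: "full S 0 x"
  by (simp add: full_def)

lemma full_SucI:
  assumes "out2 S" "S `` {x} = {u, v}" "u \<noteq> v" "x \<notin> out_ball S n u" "x \<notin> out_ball S n v"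
    "out_ball S n u \<inter> out_ball S n v = {}" "full S n u" "full S n v"
  shows "full S (Suc n) x"
proof -
  have "card (out_ball S n u \<union> out_ball S n v) = card (out_ball S n u) + card (out_ball S n v)"
    using assms finite_out_ball by (intro card_Un_disjoint) auto
  then have "card (out_ball S (Suc n) x) = Suc (2 * (2 ^ Suc n - 1))"
    using assms by (simp add: out_ball_Suc finite_out_ball full_def)
  then show ?thesis unfolding full_def double_full .
qed

text \<open>A deficit below one of at most two successors is not compensated by the other, whose
  ball is bounded by the full size.\<close>

lemma not_full_pred:
  assumes "out2 S" "(x, y) \<in> S" "\<not> full S n y"
  shows "\<not> full S (Suc n) x"
proof -
  let ?X = "S `` {x}"
  have f: "finite ?X" "card ?X \<le> 2" using assms(1) by (auto simp: out2_def)
  have c: "card (out_ball S n y) < 2 ^ Suc n - 1"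
    using iffD1[OF not_full_iff[OF assms(1)] assms(3)] .
  have "card (\<Union>z\<in>?X. out_ball S n z) \<le> (\<Sum>z\<in>?X. card (out_ball S n z))"
    using f(1) by (rule card_UN_le)
  also have "\<dots> < (\<Sum>z\<in>?X. 2 ^ Suc n - 1)"
    using f(1) c assms(2) card_out_ball[OF assms(1)] by (intro sum_strict_mono_ex1) auto
  also have "\<dots> \<le> 2 * (2 ^ Suc n - 1)" using f(2) by simp
  finally have "card (\<Union>z\<in>?X. out_ball S n z) < 2 * (2 ^ Suc n - 1)" .
  then have "card (out_ball S (Suc n) x) < Suc (2 * (2 ^ Suc n - 1))"
    unfolding out_ball_Suc by (intro le_less_trans[OF card_insert_le_Suc]) simp
  then have "card (out_ball S (Suc n) x) < 2 ^ Suc (Suc n) - 1" unfolding double_full .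
  then show ?thesis using not_full_iff[OF assms(1)] by (rule iffD2[rotated])
qed

text \<open>The centre is already counted in the balls around its successors, so the extra 1 for the
  root of the tree is missing.\<close>

lemma not_full_cycle:
  assumes "out2 S" "(y, y) \<in> S ^^ Suc k"
  shows "\<not> full S (Suc k) y"
proof -
  let ?X = "S `` {y}"
  obtain z where z: "(y, z) \<in> S" "(z, y) \<in> S ^^ k" using assms(2) relpow_Suc_D2 by metis
  then have "y \<in> (\<Union>z\<in>?X. out_ball S k z)" unfolding out_ball_def by auto
  then have "out_ball S (Suc k) y = (\<Union>z\<in>?X. out_ball S k z)"
    unfolding out_ball_Suc by blast
  moreover have "card (\<Union>z\<in>?X. out_ball S k z) \<le> 2 * (2 ^ Suc k - 1)"
    using assms(1) card_out_ball[OF assms(1)] by (intro card_Union2) (auto simp: out2_def)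
  moreover have "2 * (2 ^ Suc k - 1) < (2 ^ Suc (Suc k) - 1 :: nat)"
    unfolding double_full[symmetric] by (rule lessI)
  ultimately show ?thesis using not_full_iff[OF assms(1)] by simp
qed

lemma relpow_act:
  assumes "g \<in> automorphisms M" "S \<subseteq> verts M \<times> verts M" "x \<in> verts M"
  shows "(g x, z) \<in> act g S ^^ k \<longleftrightarrow> (\<exists>y\<in>verts M. z = g y \<and> (x, y) \<in> S ^^ k)"
proof (induction k arbitrary: z)
  case 0
  then show ?case using assms(3) by auto
next
  case (Suc k)
  have "(g x, z) \<in> act g S ^^ Suc k \<longleftrightarrow> (\<exists>y\<in>verts M. (x, y) \<in> S ^^ k \<and> (g y, z) \<in> act g S)"
    by (auto simp: relcomp_unfold Suc)
  also have "\<dots> \<longleftrightarrow> (\<exists>y\<in>verts M. \<exists>w\<in>verts M. (x, y) \<in> S ^^ k \<and> (y, w) \<in> S \<and> z = g w)"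
  proof -
    have "(g y, z) \<in> act g S \<longleftrightarrow> (\<exists>w\<in>verts M. (y, w) \<in> S \<and> z = g w)" if y: "y \<in> verts M" for y
    proof
      assume a: "(g y, z) \<in> act g S"
      then obtain u w where w: "(u, w) \<in> S" "z = g w" unfolding act_def by auto
      then have "w \<in> verts M" using assms(2) by auto
      then show "\<exists>w\<in>verts M. (y, w) \<in> S \<and> z = g w"
        using w(2) a act_mem[OF assms(1,2) y] by auto
    qed (use act_mem[OF assms(1,2) y] in auto)
    then show ?thesis by auto
  qed
  also have "\<dots> \<longleftrightarrow> (\<exists>w\<in>verts M. z = g w \<and> (x, w) \<in> S ^^ Suc k)"
    using assms(2) by (fastforce simp: relcomp_unfold)
  finally show ?case .
qed

lemma out_ball_act:
  assumes "g \<in> automorphisms M" "S \<subseteq> verts M \<times> verts M" "x \<in> verts M"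
  shows "out_ball (act g S) n (g x) = g ` out_ball S n x"
proof -
  have "z \<in> verts M" if "(x, z) \<in> S ^^ k" for k z
    using that assms(2,3) by (cases k) auto
  then show ?thesis unfolding out_ball_def relpow_act[OF assms] by auto
qed

lemma out_ball_sub: "S \<subseteq> V \<times> V \<Longrightarrow> x \<in> V \<Longrightarrow> out_ball S n x \<subseteq> V"
  by (induction n arbitrary: x) (auto simp: out_ball_Suc)

lemma card_out_ball_act:
  assumes "g \<in> automorphisms M" "S \<subseteq> verts M \<times> verts M" "x \<in> verts M"
  shows "card (out_ball (act g S) n (g x)) = card (out_ball S n x)"
  unfolding out_ball_act[OF assms]
  using aut_inj[OF assms(1) out_ball_sub[OF assms(2,3)]] by (rule card_image)

text \<open>Only an inclusion: \<open>S'\<close> may have further arcs that leave \<open>B\<close>.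
  So agreement on a ball bounds sizes from one side, and equality of sizes later takes two
  comparisons.\<close>

lemma out_ball_agree:
  assumes "S \<inter> (B \<times> B) \<subseteq> S'" "out_ball S n x \<subseteq> B"
  shows "out_ball S n x \<subseteq> out_ball S' n x"
  using assms(2)
proof (induction n)
  case 0
  then show ?case by simp
next
  case (Suc n)
  have "out_ball S n x \<subseteq> B" using Suc.prems out_ball_mono[of n "Suc n" S x] by simp
  then have IH: "out_ball S n x \<subseteq> out_ball S' n x" by (rule Suc.IH)
  have "S `` out_ball S n x \<subseteq> S' `` out_ball S' n x"
    using IH Suc.prems \<open>out_ball S n x \<subseteq> B\<close> assms(1) unfolding out_ball_Suc' by blast
  then show ?case unfolding out_ball_Suc' by blast
qed

section \<open>A non-meagre orbit in a minimal flow\<close>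

lemma topspace_powerset_topology [simp]: "topspace (powerset_topology W) = Pow W"
  unfolding powerset_topology_def topspace_pullback_topology by auto

lemma openin_powerset_member:
  assumes "p \<in> W"
  shows "openin (powerset_topology W) {S. S \<subseteq> W \<and> (p \<in> S \<longleftrightarrow> b)}"
proof -
  let ?P = "product_topology (\<lambda>_. discrete_topology (UNIV :: bool set)) W"
  have "continuous_map ?P (discrete_topology UNIV) (\<lambda>F. F p)"
    using assms by (rule continuous_map_product_projection)
  then have "openin ?P {F \<in> topspace ?P. F p \<in> {b}}"
    by (rule openin_continuous_map_preimage) simp
  moreover have "{S. S \<subseteq> W \<and> (p \<in> S \<longleftrightarrow> b)} =
      (\<lambda>S. \<lambda>p\<in>W. p \<in> S) -` {F \<in> topspace ?P. F p \<in> {b}} \<inter> Pow W"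
    using assms by auto
  ultimately show ?thesis
    unfolding powerset_topology_def openin_pullback_topology by blast
qed

lemma openin_cylinder:
  assumes "finite P" "P \<subseteq> W"
  shows "openin (powerset_topology W) {S. S \<subseteq> W \<and> S \<inter> P = S0 \<inter> P}"
  using assms
proof (induction P rule: finite_induct)
  case empty
  have "{S. S \<subseteq> W \<and> S \<inter> {} = S0 \<inter> {}} = topspace (powerset_topology W)" by auto
  then show ?case using openin_topspace by metis
next
  case (insert p P)
  have "{S. S \<subseteq> W \<and> S \<inter> insert p P = S0 \<inter> insert p P} =
      {S. S \<subseteq> W \<and> (p \<in> S \<longleftrightarrow> p \<in> S0)} \<inter> {S. S \<subseteq> W \<and> S \<inter> P = S0 \<inter> P}"
    by blast
  then show ?case
    using insert openin_powerset_member[of p W] by (simp add: openin_Int)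
qed

lemma openin_powerset_topologyD:
  assumes "openin (powerset_topology W) U" "S \<in> U"
  shows "\<exists>P. finite P \<and> P \<subseteq> W \<and> (\<forall>S'. S' \<subseteq> W \<and> S' \<inter> P = S \<inter> P \<longrightarrow> S' \<in> U)"
proof -
  let ?c = "\<lambda>S. \<lambda>p\<in>W. p \<in> S"
  let ?T = "\<lambda>_. discrete_topology (UNIV :: bool set)"
  obtain O' where O': "openin (product_topology ?T W) O'" "U = ?c -` O' \<inter> Pow W"
    using assms(1) unfolding powerset_topology_def openin_pullback_topology by blast
  then have "?c S \<in> O'" using assms(2) by blast
  then obtain N where N: "finite {i \<in> W. N i \<noteq> topspace (?T i)}" "?c S \<in> Pi\<^sub>E W N" "Pi\<^sub>E W N \<subseteq> O'"
    using O'(1) unfolding openin_product_topology_alt by blast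
  let ?P = "{i \<in> W. N i \<noteq> topspace (?T i)}"
  have "S' \<in> U" if S': "S' \<subseteq> W" "S' \<inter> ?P = S \<inter> ?P" for S'
  proof -
    have "?c S' \<in> Pi\<^sub>E W N"
    proof (rule PiE_I)
      fix p assume p: "p \<in> W"
      show "?c S' p \<in> N p"
      proof (cases "p \<in> ?P")
        case True
        then have "p \<in> S' \<longleftrightarrow> p \<in> S" using S'(2) by blast
        moreover have "?c S p \<in> N p" using N(2) p by (rule PiE_mem)
        ultimately show ?thesis using p by simp
      qed (use p in auto)
    qed auto
    then show "S' \<in> U" using N(3) O'(2) S'(1) by blast
  qed
  then show ?thesis using N(1) by (intro exI[of _ ?P]) auto
qed

text \<open>The power set is the image of the compact product under \<open>?k\<close>, which is
  continuous because composing it with the characteristic function map gives the identity on the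
  product.\<close>

lemma compact_powerset_topology: "compact_space (powerset_topology W)"
proof -
  let ?P = "product_topology (\<lambda>_. discrete_topology (UNIV :: bool set)) W"
  let ?k = "\<lambda>F. {p \<in> W. F p}"
  have c: "compact_space ?P"
    by (simp add: compact_space_product_topology compact_space_discrete_topology)
  have "continuous_map ?P (powerset_topology W) ?k"
    unfolding powerset_topology_def
  proof (rule continuous_map_pullback')
    have "continuous_map ?P ?P id" by simp
    then show "continuous_map ?P ?P ((\<lambda>S. \<lambda>p\<in>W. p \<in> S) \<circ> ?k)"
      by (rule continuous_map_eq) (auto simp: PiE_def extensional_def restrict_def)
  qed auto
  then have "compactin (powerset_topology W) (?k ` topspace ?P)"
    using c by (intro image_compactin) (auto simp: compact_space_def)
  moreover have "?k ` topspace ?P = Pow W"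
  proof
    show "Pow W \<subseteq> ?k ` topspace ?P"
    proof
      fix S assume "S \<in> Pow W"
      then have "S = ?k (\<lambda>p\<in>W. p \<in> S)" by auto
      then show "S \<in> ?k ` topspace ?P"
        by (intro image_eqI[where x = "\<lambda>p\<in>W. p \<in> S"]) auto
    qed
  qed auto
  ultimately show ?thesis by (simp add: compact_space_def)
qed

text \<open>Failure to be a 2-orientation shows on finitely many pairs: an arc that is no edge, an
  edge with no direction or with both, or three out-neighbours of one vertex. Each such witness
  gives a cylinder in the complement.\<close>

lemma closedin_orientations:
  "closedin (powerset_topology (verts M \<times> verts M)) {S. two_orientation M S}"
proof -
  let ?W = "verts M \<times> verts M"
  let ?X = "powerset_topology ?W"
  have "\<exists>P. finite P \<and> P \<subseteq> ?W \<and> (\<forall>S'. S' \<subseteq> ?W \<and> S' \<inter> P = S \<inter> P \<longrightarrow> \<not> two_orientation M S')"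
    if S: "S \<subseteq> ?W" "\<not> two_orientation M S" for S
  proof -
    consider x y where "(x, y) \<in> S" "{x, y} \<notin> edges M"
      | x y where "{x, y} \<in> edges M" "((x, y) \<in> S) = ((y, x) \<in> S)"
      | x where "x \<in> verts M" "\<not> (finite {y. (x, y) \<in> S} \<and> card {y. (x, y) \<in> S} \<le> 2)"
      using S unfolding two_orientation_def by blast
    then show ?thesis
    proof cases
      case 1
      then show ?thesis using S(1)
        by (intro exI[of _ "{(x, y)}"]) (auto dest: two_orientation_edge)
    next
      case 2
      let ?P = "{(x, y), (y, x)} \<inter> ?W"
      have "\<not> two_orientation M S'" if S': "S' \<subseteq> ?W" "S' \<inter> ?P = S \<inter> ?P" for S'
      proof -
        have "(x, y) \<in> S' \<longleftrightarrow> (x, y) \<in> S" "(y, x) \<in> S' \<longleftrightarrow> (y, x) \<in> S" using S S' by blast+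
        then show ?thesis using 2 unfolding two_orientation_def by blast
      qed
      then show ?thesis by (intro exI[of _ ?P]) auto
    next
      case 3
      \<comment> \<open>Three out-neighbours witness both ways of violating the degree condition, an
        infinite out-set and a finite one that is too large.\<close>
      have "\<exists>Z\<subseteq>{y. (x, y) \<in> S}. finite Z \<and> card Z = 3"
      proof (cases "finite {y. (x, y) \<in> S}")
        case True
        then have "3 \<le> card {y. (x, y) \<in> S}" using 3 by simp
        then show ?thesis by (meson obtain_subset_with_card_n)
      next
        case False
        then show ?thesis by (meson infinite_arbitrarily_large)
      qed
      then obtain Z where Z: "Z \<subseteq> {y. (x, y) \<in> S}" "finite Z" "card Z = 3" by blast
      have "\<not> two_orientation M S'" if S': "S' \<inter> ({x} \<times> Z) = S \<inter> ({x} \<times> Z)" for S'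
      proof
        assume "two_orientation M S'"
        then have "finite {y. (x, y) \<in> S'}" "card {y. (x, y) \<in> S'} \<le> 2"
          using 3(1) unfolding two_orientation_def by blast+
        moreover have "Z \<subseteq> {y. (x, y) \<in> S'}" using S' Z(1) by blast
        ultimately show False using Z(3) card_mono[of "{y. (x, y) \<in> S'}" Z] by simp
      qed
      moreover have "{x} \<times> Z \<subseteq> ?W" using Z(1) S(1) by blast
      ultimately show ?thesis using Z(2) by (intro exI[of _ "{x} \<times> Z"]) auto
    qed
  qed
  note witness = this
  have "openin ?X (topspace ?X - {S. two_orientation M S})"
  proof (subst openin_subopen, intro ballI)
    fix S assume "S \<in> topspace ?X - {S. two_orientation M S}"
    then have S: "S \<subseteq> ?W" "\<not> two_orientation M S" by auto
    obtain P where P: "finite P" "P \<subseteq> ?W"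
      "\<forall>S'. S' \<subseteq> ?W \<and> S' \<inter> P = S \<inter> P \<longrightarrow> \<not> two_orientation M S'"
      using witness[OF S] by blast
    show "\<exists>T. openin ?X T \<and> S \<in> T \<and> T \<subseteq> topspace ?X - {S. two_orientation M S}"
      using openin_cylinder[OF P(1,2), of S] P(3) S(1) by (intro exI conjI) auto
  qed
  moreover have "{S. two_orientation M S} \<subseteq> topspace ?X"
    using two_orientation_sub by auto
  ultimately show ?thesis by (simp add: closedin_def)
qed

section \<open>Minimal flows: approximation by orbits, recurrence of ball sizes\<close>

text \<open>For finite \<open>B\<close> these conditions define a neighbourhood base at
  \<open>S\<close>. Vertex sets are used instead of sets of pairs because automorphisms move them
  directly.\<close>

definition agree :: "'a set \<Rightarrow> ('a \<times> 'a) set \<Rightarrow> ('a \<times> 'a) set \<Rightarrow> bool" where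
  "agree B S S' \<longleftrightarrow> S \<inter> (B \<times> B) = S' \<inter> (B \<times> B)"

lemma agree_act:
  assumes "h \<in> automorphisms M" "S \<subseteq> verts M \<times> verts M" "S' \<subseteq> verts M \<times> verts M"
    "B \<subseteq> verts M" "agree B S S'"
  shows "agree (h ` B) (act h S) (act h S')"
proof -
  have "(h u, h v) \<in> act h S \<longleftrightarrow> (h u, h v) \<in> act h S'" if "u \<in> B" "v \<in> B" for u v
    using act_mem[OF assms(1,2), of u v] act_mem[OF assms(1,3), of u v] that assms(4,5)
    unfolding agree_def by blast
  then show ?thesis unfolding agree_def by blast
qed

lemma act_two_orientation_closed:
  assumes "minimal_subflow M Y" "g \<in> automorphisms M" "S \<in> Y"
  shows "act g S \<in> Y" "two_orientation M S" "act g S \<subseteq> verts M \<times> verts M"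
proof -
  show "act g S \<in> Y" using assms unfolding minimal_subflow_def by blast
  have "Y \<subseteq> topspace (orientation_space M)"
    using assms(1) closedin_subset unfolding minimal_subflow_def by blast
  then have "two_orientation M S" if "S \<in> Y" for S
    using that by (auto simp: orientation_space_def)
  then show "two_orientation M S" "act g S \<subseteq> verts M \<times> verts M"
    using assms(3) \<open>act g S \<in> Y\<close> two_orientation_sub by blast+
qed

locale minimal_flow =
  fixes M :: "'a graph" and Y :: "('a \<times> 'a) set set"
  assumes minimal: "minimal_subflow M Y"
begin

abbreviation "V \<equiv> verts M"

lemma Y_orientation: "S \<in> Y \<Longrightarrow> two_orientation M S"
  using act_two_orientation_closed(2)[OF minimal aut_id] .

lemma Y_sub: "S \<in> Y \<Longrightarrow> S \<subseteq> V \<times> V"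
  using Y_orientation two_orientation_sub by blast

lemma Y_act: "g \<in> automorphisms M \<Longrightarrow> S \<in> Y \<Longrightarrow> act g S \<in> Y"
  using act_two_orientation_closed(1)[OF minimal] .

lemma Y_topology: "subtopology (orientation_space M) Y = subtopology (powerset_topology (V \<times> V)) Y"
  unfolding orientation_space_def subtopology_subtopology
  by (rule arg_cong[where f = "subtopology _"]) (use Y_orientation in blast)

lemma topspace_Y [simp]: "topspace (subtopology (powerset_topology (V \<times> V)) Y) = Y"
  using Y_sub by auto

lemma openin_agree:
  assumes "finite B" "B \<subseteq> V"
  shows "openin (subtopology (powerset_topology (V \<times> V)) Y) {S' \<in> Y. agree B S0 S'}"
proof -
  have "openin (powerset_topology (V \<times> V)) {S. S \<subseteq> V \<times> V \<and> S \<inter> (B \<times> B) = S0 \<inter> (B \<times> B)}"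
    using assms by (intro openin_cylinder) auto
  moreover have "{S' \<in> Y. agree B S0 S'} = {S. S \<subseteq> V \<times> V \<and> S \<inter> (B \<times> B) = S0 \<inter> (B \<times> B)} \<inter> Y"
    using Y_sub unfolding agree_def by blast
  ultimately show ?thesis unfolding openin_subtopology by blast
qed

lemma openin_agreeD:
  assumes "openin (subtopology (powerset_topology (V \<times> V)) Y) U" "S0 \<in> U"
  shows "\<exists>B. finite B \<and> B \<subseteq> V \<and> (\<forall>S'\<in>Y. agree B S0 S' \<longrightarrow> S' \<in> U)"
proof -
  obtain O' where O': "openin (powerset_topology (V \<times> V)) O'" "U = O' \<inter> Y"
    using assms(1) unfolding openin_subtopology by blast
  have "S0 \<in> O'" using assms(2) O'(2) by blast
  obtain P where P: "finite P" "P \<subseteq> V \<times> V"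
    "\<forall>S'. S' \<subseteq> V \<times> V \<and> S' \<inter> P = S0 \<inter> P \<longrightarrow> S' \<in> O'"
    using openin_powerset_topologyD[OF O'(1) \<open>S0 \<in> O'\<close>] by blast
  let ?B = "fst ` P \<union> snd ` P"
  have "S' \<in> U" if S': "S' \<in> Y" "agree ?B S0 S'" for S'
  proof -
    have "P \<subseteq> ?B \<times> ?B" by force
    then have "S' \<inter> P = S0 \<inter> P" using S'(2) unfolding agree_def by blast
    then show "S' \<in> U" using P(3) Y_sub[OF S'(1)] S'(1) O'(2) by blast
  qed
  then show ?thesis using P(1,2) by (intro exI[of _ ?B]) auto
qed

lemma compact_Y: "compactin (powerset_topology (V \<times> V)) Y"
proof -
  have "closedin (orientation_space M) Y" using minimal unfolding minimal_subflow_def by blast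
  then have "closedin (powerset_topology (V \<times> V)) Y"
    unfolding orientation_space_def
    using closedin_closed_subtopology closedin_orientations by blast
  then show ?thesis using compact_powerset_topology closedin_compact_space by blast
qed

lemma closure_agree:
  assumes "T \<in> subtopology (powerset_topology (V \<times> V)) Y closure_of A" "finite B" "B \<subseteq> V"
  shows "\<exists>T'\<in>A. T' \<in> Y \<and> agree B T T'"
proof -
  have "T \<in> {S' \<in> Y. agree B T S'}"
    using assms(1) unfolding in_closure_of topspace_Y by (simp add: agree_def)
  then have "\<exists>T'. T' \<in> A \<and> T' \<in> {S' \<in> Y. agree B T S'}"
    using assms(1) openin_agree[OF assms(2,3), of T] unfolding in_closure_of by metis
  then show ?thesis by blast
qed

lemma orbit_approximates:
  assumes "S \<in> Y" "S' \<in> Y" "finite B" "B \<subseteq> V"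
  obtains g where "g \<in> automorphisms M" "agree B S (act g S')"
proof -
  have "S \<in> subtopology (orientation_space M) Y closure_of orbit_of M S'"
    using assms minimal unfolding minimal_subflow_def by blast
  then obtain T where "T \<in> orbit_of M S'" "agree B S T"
    unfolding Y_topology using closure_agree[OF _ assms(3,4)] by blast
  then show ?thesis using that unfolding orbit_of_def by blast
qed

text \<open>Some piece of the countable partition of the orbit is somewhere dense; all the pieces
  are translates of each other.\<close>

lemma orbit_piece_locally_dense:
  assumes S: "S \<in> Y" and nm: "\<not> meagre_in (subtopology (orientation_space M) Y) (orbit_of M S)"
    and cV: "countable V" and y: "y \<in> V" and g: "g \<in> automorphisms M"
  shows "\<exists>B. finite B \<and> B \<subseteq> V \<and>
    (\<forall>S' C. S' \<in> Y \<and> agree B (act g S) S' \<and> finite C \<and> C \<subseteq> V \<longrightarrow>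
      (\<exists>k\<in>automorphisms M. k y = g y \<and> agree C S' (act k S)))"
proof -
  let ?X = "subtopology (powerset_topology (V \<times> V)) Y"
  \<comment> \<open>Pieces indexed by the image of \<open>y\<close>. There are countably many, so a
    non-meagre orbit has one that is not nowhere dense.\<close>
  let ?T = "\<lambda>z. {act k S | k. k \<in> automorphisms M \<and> k y = z}"
  have "orbit_of M S = \<Union>(?T ` V)" unfolding orbit_of_def using aut_in y by fast
  then obtain z where z: "z \<in> V" "\<not> nowhere_dense_in ?X (?T z)"
    using nm cV unfolding meagre_in_def Y_topology by (metis (no_types, lifting) countable_image imageE)
  have "?T z \<subseteq> Y" using Y_act[OF _ S] by blast
  then obtain S1 where S1: "S1 \<in> ?X interior_of (?X closure_of ?T z)"
    using z(2) unfolding nowhere_dense_in_def topspace_Y by blast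
  let ?U = "?X interior_of (?X closure_of ?T z)"
  have "S1 \<in> ?X closure_of ?T z" using S1 interior_of_subset by fast
  \<comment> \<open>An open set that meets the closure of the piece meets the piece, so the centre
    of the neighbourhood can be taken in the orbit.\<close>
  then obtain S0 where S0: "S0 \<in> ?T z" "S0 \<in> ?U"
    using S1 openin_interior_of unfolding in_closure_of by blast
  then obtain g0 where g0: "g0 \<in> automorphisms M" "g0 y = z" "S0 = act g0 S" by blast
  obtain B where B: "finite B" "B \<subseteq> V" "\<forall>S'\<in>Y. agree B S0 S' \<longrightarrow> S' \<in> ?U"
    using openin_agreeD[OF openin_interior_of S0(2)] by blast
  have dense: "\<exists>k\<in>automorphisms M. k y = z \<and> agree C S' (act k S)"
    if asm: "S' \<in> Y" "agree B S0 S'" "finite C" "C \<subseteq> V" for S' C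
  proof -
    have "S' \<in> ?X closure_of ?T z" using B(3) asm(1,2) interior_of_subset by fast
    then obtain T where "T \<in> ?T z" "agree C S' T" using closure_agree[OF _ asm(3,4)] by blast
    then show ?thesis by blast
  qed
  obtain i where i: "i \<in> automorphisms M"
    "\<And>x. x \<in> V \<Longrightarrow> i (g0 x) = x" "\<And>x. x \<in> V \<Longrightarrow> g0 (i x) = x"
    using aut_inv[OF g0(1)] by blast
  \<comment> \<open>Being \<open>g\<close> after the inverse of \<open>g0\<close>, this
    \<open>h\<close> carries \<open>S0\<close> to the translate of \<open>S\<close> by
    \<open>g\<close>, and the piece of \<open>z\<close> to the piece of \<open>g y\<close>.\<close>
  define h where "h = restrict (g \<circ> i) V"
  have h: "h \<in> automorphisms M" unfolding h_def using aut_comp[OF g i(1)] .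
  obtain h' where h': "h' \<in> automorphisms M"
    "\<And>x. x \<in> V \<Longrightarrow> h' (h x) = x" "\<And>x. x \<in> V \<Longrightarrow> h (h' x) = x"
    using aut_inv[OF h] by blast
  have SV: "S \<subseteq> V \<times> V" using Y_sub[OF S] .
  have "act h S0 = act g (act i S0)"
    unfolding h_def using Y_sub \<open>?T z \<subseteq> Y\<close> S0(1) by (intro act_comp) blast
  also have "act i S0 = S" unfolding g0(3) using SV i(2) by (rule act_inv)
  finally have hS0: "act h S0 = act g S" .
  have S0V: "S0 \<subseteq> V \<times> V" using act_sub[OF g0(1) SV] g0(3) by simp
  have "\<exists>k\<in>automorphisms M. k y = g y \<and> agree C S' (act k S)"
    if S': "S' \<in> Y" "agree (h ` B) (act g S) S'" and C: "finite C" "C \<subseteq> V" for S' C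
  proof -
    have hB: "h ` B \<subseteq> V" "h' ` h ` B = B" "h' ` C \<subseteq> V" "h ` h' ` C = C"
      using B(2) C(2) aut_in[OF h] aut_in[OF h'(1)] h'(2,3) by (force simp: image_iff)+
    have S'V: "S' \<subseteq> V \<times> V" using Y_sub[OF S'(1)] .
    have "agree (h' ` h ` B) (act h' (act h S0)) (act h' S')"
      unfolding hS0 using agree_act[OF h'(1) act_sub[OF g SV] S'V hB(1) S'(2)] .
    then have "agree B S0 (act h' S')" using act_inv[OF S0V, of h' h] h'(2) hB(2) by simp
    then obtain k where k: "k \<in> automorphisms M" "k y = z" "agree (h' ` C) (act h' S') (act k S)"
      using dense[OF Y_act[OF h'(1) S'(1)] _ finite_imageI[OF C(1)] hB(3)] by blast
    have "agree (h ` h' ` C) (act h (act h' S')) (act h (act k S))"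
      using agree_act[OF h act_sub[OF h'(1) S'V] act_sub[OF k(1) SV] hB(3) k(3)] .
    then have "agree C S' (act (restrict (h \<circ> k) V) S)"
      using hB(4) act_inv[OF S'V, of h h'] h'(3) act_comp[OF SV] by simp
    moreover have "restrict (h \<circ> k) V y = g y"
      using y k(2) z(1) g0(2) i(2)[OF y] by (simp add: h_def)
    ultimately show "\<exists>k\<in>automorphisms M. k y = g y \<and> agree C S' (act k S)"
      using aut_comp[OF h k(1)] by blast
  qed
  then show ?thesis using B(1,2) aut_in[OF h] by (intro exI[of _ "h ` B"]) auto
qed

lemma out2_Y: "S \<in> Y \<Longrightarrow> out2 S"
  by (rule two_orientation_out2[OF Y_orientation])

lemma agree_out_ball:
  assumes "S \<in> Y" "S' \<in> Y" "agree (out_ball S n x) S S'"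
  shows "card (out_ball S n x) \<le> card (out_ball S' n x)"
proof (rule card_mono)
  show "finite (out_ball S' n x)" by (rule finite_out_ball[OF out2_Y[OF assms(2)]])
  show "out_ball S n x \<subseteq> out_ball S' n x"
    by (rule out_ball_agree[where B = "out_ball S n x"]) (use assms(3) in \<open>auto simp: agree_def\<close>)
qed

text \<open>Density is used twice. Near \<open>S\<close>, the translates by automorphisms fixing
  \<open>a\<close> are dense and have the sizes of \<open>S\<close> at \<open>a\<close>, which
  bounds the sizes of \<open>act g S\<close> from above. Near \<open>act g S\<close>, the translates
  by automorphisms sending \<open>i a\<close> to \<open>a\<close> are dense and have the sizes of
  \<open>act g S\<close> at \<open>a\<close>, which gives the reverse bound. The set
  \<open>B\<close> does not depend on the radius, so finitely many arcs determine the whole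
  sequence.\<close>

lemma out_ball_sizes_locally_constant:
  assumes S: "S \<in> Y" and nm: "\<not> meagre_in (subtopology (orientation_space M) Y) (orbit_of M S)"
    and cV: "countable V" and a: "a \<in> V"
  shows "\<exists>B. finite B \<and> B \<subseteq> V \<and> (\<forall>k\<in>automorphisms M. agree B S (act k S) \<longrightarrow>
      (\<forall>n. card (out_ball (act k S) n a) = card (out_ball S n a)))"
proof -
  have SV: "S \<subseteq> V \<times> V" using Y_sub[OF S] .
  obtain B0 where B0: "finite B0" "B0 \<subseteq> V"
    "\<forall>S' C. S' \<in> Y \<and> agree B0 S S' \<and> finite C \<and> C \<subseteq> V \<longrightarrow>
      (\<exists>k\<in>automorphisms M. k a = a \<and> agree C S' (act k S))"
    using orbit_piece_locally_dense[OF S nm cV a aut_id, unfolded act_id[OF SV] restrict_apply'[OF a] id_apply]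
    by blast
  have "card (out_ball (act g S) n a) = card (out_ball S n a)"
    if g: "g \<in> automorphisms M" "agree B0 S (act g S)" for g n
  proof -
    have gY: "act g S \<in> Y" using Y_act[OF g(1) S] .
    obtain i where i: "i \<in> automorphisms M"
      "\<And>x. x \<in> V \<Longrightarrow> i (g x) = x" "\<And>x. x \<in> V \<Longrightarrow> g (i x) = x"
      using aut_inv[OF g(1)] by blast
    have x: "i a \<in> V" "g (i a) = a" using aut_in[OF i(1) a] i(3)[OF a] .
    have sz: "card (out_ball (act k S) n a) = card (out_ball S n z)"
      if "k \<in> automorphisms M" "z \<in> V" "k z = a" for k z
      using card_out_ball_act[OF that(1) SV that(2), of n] that(3) by simp
    let ?C = "out_ball (act g S) n a"
    obtain B1 where B1: "finite B1" "B1 \<subseteq> V"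
      "\<forall>S' C. S' \<in> Y \<and> agree B1 (act g S) S' \<and> finite C \<and> C \<subseteq> V \<longrightarrow>
        (\<exists>k\<in>automorphisms M. k (i a) = g (i a) \<and> agree C S' (act k S))"
      using orbit_piece_locally_dense[OF S nm cV x(1) g(1)] by blast
    have fin: "finite (?C \<union> B1)" "?C \<union> B1 \<subseteq> V"
      using finite_out_ball[OF out2_Y[OF gY]] B1(1,2) out_ball_sub[OF Y_sub[OF gY] a] by auto
    \<comment> \<open>Agreement on \<open>B1\<close> as well keeps \<open>act k S\<close> in the
      region around \<open>act g S\<close> in which the second density applies.\<close>
    obtain k where k: "k \<in> automorphisms M" "k a = a" "agree (?C \<union> B1) (act g S) (act k S)"
      using B0(3) gY g(2) fin by blast
    have kY: "act k S \<in> Y" using Y_act[OF k(1) S] .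
    have k': "agree ?C (act g S) (act k S)" "agree B1 (act g S) (act k S)"
      using k(3) unfolding agree_def by blast+
    have le: "card ?C \<le> card (out_ball S n a)"
      using agree_out_ball[OF gY kY k'(1)] sz[OF k(1) a k(2)] by simp
    let ?C' = "out_ball (act k S) n a"
    have "finite ?C'" "?C' \<subseteq> V"
      using finite_out_ball[OF out2_Y[OF kY]] out_ball_sub[OF Y_sub[OF kY] a] by auto
    then obtain l where l: "l \<in> automorphisms M" "l (i a) = a" "agree ?C' (act k S) (act l S)"
      using B1(3)[unfolded x(2)] kY k'(2) by blast
    have "card ?C' \<le> card (out_ball (act l S) n a)"
      using agree_out_ball[OF kY Y_act[OF l(1) S] l(3)] .
    then have "card (out_ball S n a) \<le> card (out_ball S n (i a))"
      using sz[OF k(1) a k(2)] sz[OF l(1) x(1) l(2)] by simp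
    also have "\<dots> = card ?C" using sz[OF g(1) x] by simp
    finally show "card ?C = card (out_ball S n a)" using le by simp
  qed
  then show ?thesis using B0(1,2) by (intro exI[of _ B0] conjI) auto
qed

text \<open>By minimality every member of \<open>Y\<close> has a translate agreeing with
  \<open>S\<close> on \<open>B\<close>; by compactness finitely many \<open>g\<close> suffice for
  all members. Applied to the translate of \<open>S\<close> by the inverse of \<open>h\<close>, this
  gives a \<open>g\<close> for which \<open>g\<close> after that inverse preserves the sizes at
  \<open>a\<close>, and pulling \<open>a\<close> back yields the vertex
  \<open>h (i g a)\<close>.\<close>

lemma out_ball_sizes_syndetic:
  assumes S: "S \<in> Y" and nm: "\<not> meagre_in (subtopology (orientation_space M) Y) (orbit_of M S)"
    and cV: "countable V" and a: "a \<in> V"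
  shows "\<exists>D. finite D \<and> D \<subseteq> V \<and>
    (\<forall>h\<in>automorphisms M. \<exists>d\<in>D. (\<exists>g\<in>automorphisms M. h d = g a) \<and>
      (\<forall>n. card (out_ball S n (h d)) = card (out_ball S n a)))"
proof -
  let ?X = "subtopology (powerset_topology (V \<times> V)) Y"
  obtain B where B: "finite B" "B \<subseteq> V"
    "\<forall>k\<in>automorphisms M. agree B S (act k S) \<longrightarrow>
      (\<forall>n. card (out_ball (act k S) n a) = card (out_ball S n a))"
    using out_ball_sizes_locally_constant[OF S nm cV a] by blast
  define U where "U g = {S' \<in> Y. agree B S (act g S')}" for g
  have "openin ?X (U g)" if g: "g \<in> automorphisms M" for g
  proof -
    obtain i where i: "i \<in> automorphisms M"
      "\<And>x. x \<in> V \<Longrightarrow> i (g x) = x" "\<And>x. x \<in> V \<Longrightarrow> g (i x) = x"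
      using aut_inv[OF g] by blast
    have iB: "i ` B \<subseteq> V" "g ` i ` B = B" using B(2) aut_in[OF i(1)] i(3) by (force simp: image_iff)+
    have SV: "S \<subseteq> V \<times> V" using Y_sub[OF S] .
    have "agree B S (act g S') \<longleftrightarrow> agree (i ` B) (act i S) S'" if S': "S' \<in> Y" for S'
    proof
      assume "agree B S (act g S')"
      then show "agree (i ` B) (act i S) S'"
        using agree_act[OF i(1) SV act_sub[OF g Y_sub[OF S']] B(2)] act_inv[OF Y_sub[OF S'], of i g] i(2)
        by simp
    next
      assume "agree (i ` B) (act i S) S'"
      then show "agree B S (act g S')"
        using agree_act[OF g act_sub[OF i(1) SV] Y_sub[OF S'] iB(1)] act_inv[OF SV, of g i] i(3) iB(2)
        by simp
    qed
    then have "U g = {S' \<in> Y. agree (i ` B) (act i S) S'}" unfolding U_def by blast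
    then show ?thesis using openin_agree[OF finite_imageI[OF B(1)] iB(1)] by simp
  qed
  moreover have "Y \<subseteq> \<Union>(U ` automorphisms M)"
  proof
    fix S' assume S': "S' \<in> Y"
    obtain g where "g \<in> automorphisms M" "agree B S (act g S')"
      using orbit_approximates[OF S S' B(1,2)] .
    then show "S' \<in> \<Union>(U ` automorphisms M)" using S' unfolding U_def by blast
  qed
  moreover have "compact_space ?X" using compact_Y by (simp add: compact_space_subtopology)
  ultimately have "\<exists>\<F>. finite \<F> \<and> \<F> \<subseteq> U ` automorphisms M \<and> Y \<subseteq> \<Union>\<F>"
    unfolding compact_space_alt topspace_Y by (elim allE[of _ "U ` automorphisms M"]) auto
  then obtain \<F> where \<F>: "finite \<F>" "\<F> \<subseteq> U ` automorphisms M" "Y \<subseteq> \<Union>\<F>" by blast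
  then obtain G where G: "finite G" "G \<subseteq> automorphisms M" "\<F> = U ` G"
    by (meson finite_subset_image)
  have "\<forall>g\<in>automorphisms M. \<exists>i. i \<in> automorphisms M \<and> (\<forall>x\<in>V. i (g x) = x) \<and> (\<forall>x\<in>V. g (i x) = x)"
    using aut_inv by blast
  then obtain i where "\<forall>g\<in>automorphisms M.
      i g \<in> automorphisms M \<and> (\<forall>x\<in>V. i g (g x) = x) \<and> (\<forall>x\<in>V. g (i g x) = x)"
    by (drule_tac bchoice) blast
  then have i: "i g \<in> automorphisms M \<and> (\<forall>x\<in>V. i g (g x) = x) \<and> (\<forall>x\<in>V. g (i g x) = x)"
    if "g \<in> automorphisms M" for g
    using that by blast
  show ?thesis
  proof (intro exI[of _ "(\<lambda>g. i g a) ` G"] conjI ballI)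
    show "finite ((\<lambda>g. i g a) ` G)" using G(1) by simp
    have iA: "i g \<in> automorphisms M" if "g \<in> G" for g using i[of g] G(2) that by blast
    show "(\<lambda>g. i g a) ` G \<subseteq> V" by (intro image_subsetI aut_in[OF iA a])
    fix h assume h: "h \<in> automorphisms M"
    have ih: "i h \<in> automorphisms M" using i[OF h] by blast
    have SV: "S \<subseteq> V \<times> V" using Y_sub[OF S] .
    have "act (i h) S \<in> Y" using Y_act[OF ih S] .
    then obtain g where g: "g \<in> G" "act (i h) S \<in> U g" using \<F>(3) G(3) by blast
    have gA: "g \<in> automorphisms M" using g(1) G(2) by blast
    let ?k = "restrict (g \<circ> i h) V"
    have k: "?k \<in> automorphisms M" using aut_comp[OF gA ih] .
    have "agree B S (act ?k S)" using g(2) act_comp[OF SV] unfolding U_def by simp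
    then have sz: "card (out_ball (act ?k S) n a) = card (out_ball S n a)" for n
      using B(3) k by blast
    let ?d = "i g a"
    have d: "?d \<in> V" using aut_in[OF iA[OF g(1)] a] .
    have hd: "h ?d \<in> V" using aut_in[OF h d] .
    have "?k (h ?d) = a" using d hd i[OF h] i[OF gA] a by simp
    then have "card (out_ball S n (h ?d)) = card (out_ball S n a)" for n
      using card_out_ball_act[OF k SV hd, of n] sz by simp
    moreover have "\<exists>g\<in>automorphisms M. h ?d = g a"
      using aut_comp[OF h, of "i g"] i[OF gA] a by (intro bexI[of _ "restrict (h \<circ> i g) V"]) auto
    ultimately show "\<exists>d\<in>(\<lambda>g. i g a) ` G. (\<exists>g\<in>automorphisms M. h d = g a) \<and>
      (\<forall>n. card (out_ball S n (h d)) = card (out_ball S n a))"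
      using g(1) by blast
  qed
qed

end

section \<open>Strong subsets of the limit\<close>

definition gmap :: "('a \<Rightarrow> 'a) \<Rightarrow> 'a graph \<Rightarrow> 'a graph" where
  "gmap f G = Graph (f ` verts G) ((`) f ` edges G)"

lemma verts_gmap [simp]: "verts (gmap f G) = f ` verts G"
  and edges_gmap [simp]: "edges (gmap f G) = (`) f ` edges G"
  by (simp_all add: gmap_def)

lemma verts_induced [simp]: "verts (induced G W) = W"
  and edges_induced [simp]: "edges (induced G W) = {e \<in> edges G. e \<subseteq> W}"
  by (simp_all add: induced_def)

lemma graph_eqI: "verts G = verts H \<Longrightarrow> edges G = edges H \<Longrightarrow> G = H"
  by (cases G; cases H) simp

lemma gmap_cong: "is_graph G \<Longrightarrow> (\<And>x. x \<in> verts G \<Longrightarrow> f x = g x) \<Longrightarrow> gmap f G = gmap g G"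
  unfolding gmap_def is_graph_def by (auto intro!: image_cong)

lemma gmap_gmap: "gmap g (gmap f G) = gmap (g \<circ> f) G"
  by (auto simp: gmap_def image_comp)

lemma gmap_id: "is_graph G \<Longrightarrow> (\<And>x. x \<in> verts G \<Longrightarrow> f x = x) \<Longrightarrow> gmap f G = G"
  using gmap_cong[of G f id] by (simp add: gmap_def)

lemma induced_induced: "Y \<subseteq> X \<Longrightarrow> induced (induced G X) Y = induced G Y"
  by (auto simp: induced_def)

lemma induced_verts: "is_graph G \<Longrightarrow> induced G (verts G) = G"
  by (intro graph_eqI) (auto simp: is_graph_def)

lemma is_graph_induced: "is_graph G \<Longrightarrow> is_graph (induced G W)"
  by (auto simp: is_graph_def)

lemma induced_gmap:
  assumes "is_graph G" "inj_on f (verts G)" "W \<subseteq> verts G"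
  shows "induced (gmap f G) (f ` W) = gmap f (induced G W)"
proof (intro graph_eqI)
  show "edges (induced (gmap f G) (f ` W)) = edges (gmap f (induced G W))"
  proof -
    have "f ` e \<subseteq> f ` W \<longleftrightarrow> e \<subseteq> W" if "e \<in> edges G" for e
      using that assms inj_on_image_subset_iff[OF assms(2), of e W] by (auto simp: is_graph_def)
    then show ?thesis by auto
  qed
qed simp

lemma pair_edge: "is_graph G \<Longrightarrow> e \<in> edges G \<Longrightarrow> \<exists>x\<in>verts G. \<exists>y\<in>verts G. x \<noteq> y \<and> e = {x, y}"
  by (fastforce simp: is_graph_def card_2_iff)

lemma embedding_gmap:
  assumes "is_graph E" "is_graph B" "inj_on g (verts E)" "g ` verts E \<subseteq> verts B"
    "\<And>x y. x \<in> verts E \<Longrightarrow> y \<in> verts E \<Longrightarrow> {x, y} \<in> edges E \<longleftrightarrow> {g x, g y} \<in> edges B"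
  shows "gmap g E = induced B (g ` verts E)"
proof (intro graph_eqI)
  show "edges (gmap g E) = edges (induced B (g ` verts E))"
  proof
    show "edges (gmap g E) \<subseteq> edges (induced B (g ` verts E))"
      using pair_edge[OF assms(1)] assms(5) by fastforce
    show "edges (induced B (g ` verts E)) \<subseteq> edges (gmap g E)"
    proof
      fix e assume "e \<in> edges (induced B (g ` verts E))"
      then have e: "e \<in> edges B" "e \<subseteq> g ` verts E" by auto
      then obtain u v where "e = {u, v}" using pair_edge[OF assms(2)] by blast
      then obtain x y where "x \<in> verts E" "y \<in> verts E" "e = {g x, g y}" using e(2) by blast
      then have "{x, y} \<in> edges E" "e = g ` {x, y}" using assms(5) e(1) by auto
      then show "e \<in> edges (gmap g E)" unfolding edges_gmap by (rule image_eqI[rotated])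
    qed
  qed
qed simp

lemma gmap_edge_iff:
  assumes "is_graph G" "inj_on f (verts G)" "gmap f G = induced H (f ` verts G)"
    "x \<in> verts G" "y \<in> verts G"
  shows "{x, y} \<in> edges G \<longleftrightarrow> {f x, f y} \<in> edges H"
proof
  assume "{x, y} \<in> edges G"
  then have "f ` {x, y} \<in> edges (gmap f G)" unfolding edges_gmap by (rule imageI)
  then show "{f x, f y} \<in> edges H" unfolding assms(3) by simp
next
  assume "{f x, f y} \<in> edges H"
  then have "{f x, f y} \<in> edges (gmap f G)" unfolding assms(3) using assms(4,5) by simp
  then obtain e where e: "e \<in> edges G" "f ` e = f ` {x, y}" by auto
  then have "e = {x, y}"
    using inj_on_image_eq_iff[OF assms(2), of e "{x, y}"] assms(1,4,5) by (auto simp: is_graph_def)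
  then show "{x, y} \<in> edges G" using e(1) by simp
qed

text \<open>The amalgamation property is stated for graphs that already meet exactly in the base.
  Renaming inside the infinite vertex type brings any two graphs into this position.\<close>

lemma fresh_injection:
  fixes X W Z :: "'a::infinite set"
  assumes "finite X" "W \<subseteq> X" "finite Z" "inj_on \<phi> W" "\<phi> ` W \<subseteq> Z"
  shows "\<exists>f :: 'a \<Rightarrow> 'a. inj_on f X \<and> (\<forall>x\<in>W. f x = \<phi> x) \<and> f ` (X - W) \<inter> Z = {}"
proof -
  have "infinite (UNIV - Z)" using assms(3) infinite_UNIV by (simp add: Diff_infinite_finite)
  then obtain N where N: "N \<subseteq> UNIV - Z" "finite N" "card N = card (X - W)"
    using infinite_arbitrarily_large by blast
  then obtain k where k: "bij_betw k (X - W) N"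
    using finite_same_card_bij[of "X - W" N] assms(1) by auto
  let ?f = "\<lambda>x. if x \<in> W then \<phi> x else k x"
  have im: "k x \<in> N" if "x \<in> X - W" for x using k that bij_betwE by blast
  have disj: "\<phi> x \<noteq> k y" if "x \<in> W" "y \<in> X - W" for x y
  proof -
    have "k y \<notin> Z" using im[OF that(2)] N(1) by auto
    moreover have "\<phi> x \<in> Z" using assms(5) that(1) by auto
    ultimately show ?thesis by metis
  qed
  have "inj_on ?f X"
  proof (rule inj_onI)
    fix x y assume "x \<in> X" "y \<in> X" "?f x = ?f y"
    then show "x = y"
      using disj[of x y] disj[of y x] inj_onD[OF assms(4), of x y]
        inj_onD[OF bij_betw_imp_inj_on[OF k], of x y]
      by (auto split: if_splits)
  qed
  moreover have "?f ` (X - W) \<inter> Z = {}" using im N(1) by auto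
  ultimately show ?thesis by (intro exI[of _ ?f]) auto
qed

section \<open>Free amalgamation and strong sets in the limit\<close>

text \<open>The common ground of the two kinds of classes, enough for homogeneity and for free
  extensions. In the case of \<open>leq_s\<close>, the premise \<open>leq A B\<close> of
  \<open>leq_empty\<close> hands over a 2-orientation of \<open>B\<close>.\<close>

locale amalgamation_class =
  fixes C :: "'a::infinite graph set" and leq :: "'a graph \<Rightarrow> 'a graph \<Rightarrow> bool"
  assumes C_graph: "B \<in> C \<Longrightarrow> is_graph B"
    and C_finite: "B \<in> C \<Longrightarrow> finite (verts B)"
    and C_iso: "B \<in> C \<Longrightarrow> inj_on f (verts B) \<Longrightarrow> gmap f B \<in> C"
    and leq_iso: "leq A B \<Longrightarrow> B \<in> C \<Longrightarrow> inj_on f (verts B) \<Longrightarrow> leq (gmap f A) (gmap f B)"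
    and C_induced: "B \<in> C \<Longrightarrow> W \<subseteq> verts B \<Longrightarrow> induced B W \<in> C"
    and leq_subgraph: "leq A B \<Longrightarrow> subgraph A B"
    and leq_trans: "leq A B \<Longrightarrow> leq B D \<Longrightarrow> D \<in> C \<Longrightarrow> leq A D"
    and leq_restrict: "leq A B \<Longrightarrow> B \<in> C \<Longrightarrow> W \<subseteq> verts B \<Longrightarrow>
      leq (induced A (verts A \<inter> W)) (induced B W)"
    and leq_empty: "leq A B \<Longrightarrow> B \<in> C \<Longrightarrow> leq (induced B {}) B"
    and free_amalgamation: "free_amalgamation_class C leq"

locale limit_graph = amalgamation_class C leq for C and leq :: "'a::infinite graph \<Rightarrow> 'a graph \<Rightarrow> bool" +
  fixes M :: "'a graph" and A :: "nat \<Rightarrow> 'a graph"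
  assumes M_graph: "is_graph M" and M_countable: "countable (verts M)"
    and A_C: "A i \<in> C" and A_step: "leq (A i) (A (Suc i))"
    and verts_M: "verts M = (\<Union>i. verts (A i))" and edges_M: "edges M = (\<Union>i. edges (A i))"
    and A_universal: "B \<in> C \<Longrightarrow> \<exists>i f. strong_embedding leq f B (A i)"
    and A_extension: "B \<in> C \<Longrightarrow> strong_embedding leq f (A i) B \<Longrightarrow>
      \<exists>j\<ge>i. \<exists>g. strong_embedding leq g B (A j) \<and> (\<forall>a\<in>verts (A i). g (f a) = a)"
begin

abbreviation "V \<equiv> verts M"
abbreviation "ind \<equiv> induced M"

text \<open>Strength is asked in one member of the chain; by \<open>str_leq\<close> it then holds in
  every finite superset, whichever member was used.\<close>

definition str :: "'a set \<Rightarrow> bool" where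
  "str W \<longleftrightarrow> (\<exists>i. W \<subseteq> verts (A i) \<and> leq (ind W) (A i))"

definition free :: "'a set \<Rightarrow> 'a set \<Rightarrow> bool" where
  "free X Y \<longleftrightarrow> (\<forall>e\<in>edges M. e \<subseteq> X \<union> Y \<longrightarrow> e \<subseteq> X \<or> e \<subseteq> Y)"

lemma free_sym: "free X Y \<longleftrightarrow> free Y X"
  unfolding free_def by (simp add: Un_commute disj_commute)

lemma free_subset:
  assumes "free X Y" "Y' \<subseteq> Y" "X \<inter> Y \<subseteq> Y'"
  shows "free X Y'"
  unfolding free_def
proof (intro ballI impI)
  fix e assume e: "e \<in> edges M" "e \<subseteq> X \<union> Y'"
  then have "e \<subseteq> X \<or> e \<subseteq> Y" using assms(1,2) unfolding free_def by auto
  then show "e \<subseteq> X \<or> e \<subseteq> Y'" using e(2) assms(3) by auto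
qed

lemma free_enlarge: "free X Y \<Longrightarrow> Z \<subseteq> Y \<Longrightarrow> free (X \<union> Z) Y"
  unfolding free_def by (metis Un_assoc Un_absorb1 le_supI1)

text \<open>Reflexivity on the chain comes from restricting \<open>A_step\<close> to the vertices of
  the smaller member.\<close>

lemma leq_refl_A: "leq (A i) (A i)"
proof -
  have s: "subgraph (A i) (A (Suc i))" using leq_subgraph[OF A_step] .
  then have v: "verts (A i) \<subseteq> verts (A (Suc i))" "A i = induced (A (Suc i)) (verts (A i))"
    unfolding subgraph_def by auto
  then show ?thesis
    using leq_restrict[OF A_step A_C v(1)] induced_verts[OF C_graph[OF A_C, of i]] by simp
qed

lemma A_mono: "i \<le> j \<Longrightarrow> leq (A i) (A j)"
proof (induction j rule: dec_induct)
  case base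
  show ?case by (rule leq_refl_A)
next
  case (step j)
  show ?case using leq_trans[OF step.IH A_step A_C] .
qed

lemma A_sub: "i \<le> j \<Longrightarrow> verts (A i) \<subseteq> verts (A j)"
  and A_ind_A: "i \<le> j \<Longrightarrow> A i = induced (A j) (verts (A i))"
  using leq_subgraph[OF A_mono] unfolding subgraph_def by blast+

lemma A_V: "verts (A i) \<subseteq> V"
  using verts_M by blast

lemma A_ind: "A i = ind (verts (A i))"
proof (intro graph_eqI)
  show "edges (A i) = edges (ind (verts (A i)))"
  proof
    show "edges (A i) \<subseteq> edges (ind (verts (A i)))"
      using edges_M C_graph[OF A_C[of i]] by (auto simp: is_graph_def)
    show "edges (ind (verts (A i))) \<subseteq> edges (A i)"
    proof
      fix e assume "e \<in> edges (ind (verts (A i)))"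
      then have e: "e \<in> edges M" "e \<subseteq> verts (A i)" by auto
      then obtain j where j: "e \<in> edges (A j)" using edges_M by blast
      let ?m = "max i j"
      have "e \<in> edges (A ?m)" using j A_ind_A[of j ?m] by (metis (no_types, lifting) edges_induced max.cobounded2 mem_Collect_eq)
      then have "e \<in> edges (induced (A ?m) (verts (A i)))" using e(2) by simp
      then show "e \<in> edges (A i)" using A_ind_A[of i ?m] by (metis max.cobounded1)
    qed
  qed
qed simp

lemma ind_A_mono: "W \<subseteq> verts (A i) \<Longrightarrow> ind W = induced (A i) W"
  using induced_induced[of W "verts (A i)" M] A_ind[of i, symmetric] by simp

lemma ind_C: "W \<subseteq> verts (A i) \<Longrightarrow> ind W \<in> C"
  using C_induced[OF A_C, of W i] ind_A_mono[of W i] by simp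

lemma finite_A: "finite (verts (A i))"
  using C_finite[OF A_C] .

lemma cover_A:
  assumes "finite W" "W \<subseteq> V"
  shows "\<exists>i. \<forall>j\<ge>i. W \<subseteq> verts (A j)"
  using assms
proof (induction W rule: finite_induct)
  case empty
  then show ?case by simp
next
  case (insert x W)
  then obtain i where i: "\<forall>j\<ge>i. W \<subseteq> verts (A j)" by auto
  obtain k where k: "x \<in> verts (A k)" using insert.prems verts_M by auto
  then have "insert x W \<subseteq> verts (A j)" if "j \<ge> max i k" for j
    using that i A_sub[of k j] by auto
  then show ?case by blast
qed

lemma ind_finite_C:
  assumes "finite W" "W \<subseteq> V"
  shows "ind W \<in> C"
proof -
  obtain i where "W \<subseteq> verts (A i)" using cover_A[OF assms] by auto
  then show ?thesis by (rule ind_C)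
qed

lemma str_A: "str (verts (A i))"
  unfolding str_def using leq_refl_A[of i] A_ind[of i, symmetric] by (intro exI[of _ i]) simp

lemma str_finite: "str W \<Longrightarrow> finite W"
  unfolding str_def by (auto intro: finite_subset[OF _ finite_A])

lemma str_V: "str W \<Longrightarrow> W \<subseteq> V"
  unfolding str_def using A_V by blast

lemma str_cover:
  assumes "finite W" "W \<subseteq> V"
  shows "\<exists>W'. W \<subseteq> W' \<and> str W'"
proof -
  obtain i where "W \<subseteq> verts (A i)" using cover_A[OF assms] by auto
  then show ?thesis using str_A by auto
qed

lemma str_leq:
  assumes "str W" "W \<subseteq> X" "finite X" "X \<subseteq> V"
  shows "leq (ind W) (ind X)"
proof -
  obtain i where i: "W \<subseteq> verts (A i)" "leq (ind W) (A i)" using assms(1) unfolding str_def by blast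
  obtain k where k: "\<forall>j\<ge>k. X \<subseteq> verts (A j)" using cover_A[OF assms(3,4)] by blast
  let ?m = "max i k"
  have X: "X \<subseteq> verts (A ?m)" using k by simp
  have "leq (ind W) (A ?m)" using leq_trans[OF i(2) A_mono A_C] by simp
  then have "leq (induced (ind W) (verts (ind W) \<inter> X)) (induced (A ?m) X)"
    by (rule leq_restrict[OF _ A_C X])
  moreover have "verts (ind W) \<inter> X = W" using assms(2) by auto
  ultimately show ?thesis using ind_A_mono[OF X] induced_induced[of W W M] by simp
qed

lemma str_trans:
  assumes "str X" "leq (ind W) (ind X)"
  shows "str W"
proof -
  obtain i where i: "X \<subseteq> verts (A i)" "leq (ind X) (A i)" using assms(1) unfolding str_def by blast
  have "W \<subseteq> X" using leq_subgraph[OF assms(2)] unfolding subgraph_def by simp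
  then show ?thesis unfolding str_def using i leq_trans[OF assms(2) i(2) A_C] by blast
qed

lemma str_empty: "str {}"
  unfolding str_def using leq_empty[OF leq_refl_A A_C] ind_A_mono[of "{}"] by (intro exI[of _ 0]) simp

lemma free_leq:
  assumes X: "finite X" "X \<subseteq> V" "finite Y" "Y \<subseteq> V" and f: "free X Y"
    and l: "leq (ind (X \<inter> Y)) (ind X)" "leq (ind (X \<inter> Y)) (ind Y)"
  shows "leq (ind X) (ind (X \<union> Y))"
proof -
  have "free_amalgam (ind X) (ind Y) = ind (X \<union> Y)"
    using f unfolding free_def free_amalgam_def by (intro graph_eqI) auto
  moreover have "ind X \<in> C" "ind Y \<in> C" "ind (X \<inter> Y) \<in> C"
    using X by (auto intro!: ind_finite_C)
  ultimately show ?thesis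
    using free_amalgamation l unfolding free_amalgamation_class_def by fastforce
qed

text \<open>The sets \<open>W1' \<union> W2'\<close>, \<open>W1 \<union> W2'\<close> and
  \<open>W1 \<union> W2\<close> form a chain in which each step is again a free amalgam, over
  \<open>W1'\<close> and over \<open>W2'\<close> respectively. It allows both sides of a strong free
  amalgam to be shrunk.\<close>

lemma str_free_union:
  assumes s: "str (W1 \<union> W2)" "str (W1 \<inter> W2)" and f: "free W1 W2"
    and W1': "str W1'" "W1' \<subseteq> W1" "W1 \<inter> W2 \<subseteq> W1'"
    and W2': "str W2'" "W2' \<subseteq> W2" "W1 \<inter> W2 \<subseteq> W2'"
  shows "str (W1' \<union> W2')"
proof -
  have fin: "finite W1" "finite W2" "W1 \<subseteq> V" "W2 \<subseteq> V"
    using str_finite[OF s(1)] str_V[OF s(1)] by auto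
  have fin': "finite W1'" "finite W2'" "W1' \<subseteq> V" "W2' \<subseteq> V"
    using fin W1'(2) W2'(2) finite_subset by auto
  have eq: "W1' \<inter> W2' = W1 \<inter> W2" "W2' \<inter> W1 = W1 \<inter> W2"
    "W1 \<inter> (W1' \<union> W2') = W1'" "(W1' \<union> W2') \<inter> W1 = W1'" "W2 \<inter> (W1 \<union> W2') = W2'" "(W1 \<union> W2') \<inter> W2 = W2'"
    using W1' W2' by blast+
  have fr: "free W1' W2'" "free W2' W1" "free (W1' \<union> W2') W1" "free (W1 \<union> W2') W2"
  proof -
    have a: "free W1 W2'" using free_subset[OF f W2'(2,3)] .
    then show b: "free W2' W1" using free_sym by simp
    show "free W1' W2'"
      using free_subset[OF b W1'(2)] eq(2) W1'(3) free_sym by simp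
    show "free (W1' \<union> W2') W1" using free_enlarge[OF b W1'(2)] by (simp add: Un_commute)
    show "free (W1 \<union> W2') W2" using free_enlarge[OF f W2'(2)] .
  qed
  have base: "leq (ind (W1 \<inter> W2)) (ind X)" if "X \<in> {W1', W2', W1}" for X
    using that s(2) W1'(3) W2'(3) fin fin' by (intro str_leq) auto
  have 1: "leq (ind W1') (ind (W1' \<union> W2'))"
    using free_leq[OF fin'(1,3,2,4) fr(1)] base eq by simp
  have 2: "leq (ind W2') (ind (W2' \<union> W1))"
    using free_leq[OF fin'(2,4) fin(1,3) fr(2)] base eq by simp
  have 3: "leq (ind (W1' \<union> W2')) (ind (W1' \<union> W2' \<union> W1))"
    using free_leq[OF _ _ fin(1,3) fr(3)] fin' 1 str_leq[OF W1'(1,2) fin(1,3)] eq by simp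
  have 4: "leq (ind (W1 \<union> W2')) (ind (W1 \<union> W2' \<union> W2))"
    using free_leq[OF _ _ fin(2,4) fr(4)] fin fin' 2 str_leq[OF W2'(1,2) fin(2,4)] eq
    by (simp add: Un_commute)
  have u: "W1' \<union> W2' \<union> W1 = W1 \<union> W2'" "W1 \<union> W2' \<union> W2 = W1 \<union> W2" using W1'(2) W2'(2) by blast+
  have "leq (ind (W1' \<union> W2')) (ind (W1 \<union> W2))"
    using leq_trans[OF 3[unfolded u(1)] 4[unfolded u(2)]] ind_finite_C fin by auto
  then show ?thesis by (rule str_trans[OF s(1)])
qed

text \<open>\<open>B\<close> is renamed off the chain member containing \<open>W\<close>,
  amalgamated freely with it, and the amalgam is pulled back into the chain by
  \<open>A_extension\<close>, which fixes the member and hence \<open>W\<close>.\<close>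

lemma embed:
  assumes B: "B \<in> C" "W \<subseteq> verts B" and W: "str W" "induced B W = ind W" and l: "leq (ind W) B"
  shows "\<exists>g. inj_on g (verts B) \<and> (\<forall>x\<in>W. g x = x) \<and> gmap g B = ind (g ` verts B) \<and> str (g ` verts B)"
proof -
  obtain i where i: "W \<subseteq> verts (A i)" "leq (ind W) (A i)" using W(1) unfolding str_def by blast
  obtain f :: "'a \<Rightarrow> 'a" where f: "inj_on f (verts B)" "\<forall>x\<in>W. f x = id x"
    "f ` (verts B - W) \<inter> verts (A i) = {}"
    using fresh_injection[OF C_finite[OF B(1)] B(2) finite_A[of i] inj_on_id] i(1) by auto
  let ?B = "gmap f B"
  have BC: "?B \<in> C" using C_iso[OF B(1) f(1)] .
  have Wg: "is_graph (ind W)" using is_graph_induced[OF M_graph] .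
  have "gmap f (ind W) = ind W" using gmap_id[OF Wg] f(2) by simp
  then have lB: "leq (ind W) ?B" using leq_iso[OF l B(1) f(1)] by simp
  have fW: "f ` W = W" using f(2) by force
  have "f ` verts B = W \<union> f ` (verts B - W)" using B(2) fW by blast
  then have int: "verts (A i) \<inter> verts ?B = verts (ind W)" using f(3) i(1) by auto
  let ?E = "free_amalgam (A i) ?B"
  have E: "?E \<in> C" "leq (A i) ?E" "leq ?B ?E"
    using free_amalgamation A_C[of i] BC ind_C[OF i(1)] i(2) lB int
    unfolding free_amalgamation_class_def by blast+
  have sub: "A i = induced ?E (verts (A i))"
    using leq_subgraph[OF E(2)] unfolding subgraph_def by simp
  have edge: "{x, y} \<in> edges (A i) \<longleftrightarrow> {x, y} \<in> edges ?E" if "x \<in> verts (A i)" "y \<in> verts (A i)" for x y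
    using that arg_cong[OF sub, of edges] by auto
  have vE: "verts (A i) \<subseteq> verts ?E" by (simp add: free_amalgam_def)
  have "strong_embedding leq id (A i) ?E"
    unfolding strong_embedding_def graph_embedding_def
    using sub E(2) edge vE by (auto simp: id_def)
  then obtain j g where g: "strong_embedding leq g ?E (A j)" "\<forall>a\<in>verts (A i). g (id a) = a"
    using A_extension[OF E(1)] by blast
  have gi: "inj_on g (verts ?E)" "g ` verts ?E \<subseteq> verts (A j)"
    "\<And>x y. x \<in> verts ?E \<Longrightarrow> y \<in> verts ?E \<Longrightarrow> {x, y} \<in> edges ?E \<longleftrightarrow> {g x, g y} \<in> edges (A j)"
    "leq (induced (A j) (g ` verts ?E)) (A j)"
    using g(1) unfolding strong_embedding_def graph_embedding_def by blast+
  have gE: "gmap g ?E = induced (A j) (g ` verts ?E)"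
    using embedding_gmap[OF C_graph[OF E(1)] C_graph[OF A_C] gi(1-3)] .
  have vB: "verts ?B \<subseteq> verts ?E" by (simp add: free_amalgam_def)
  have subB: "?B = induced ?E (verts ?B)"
    using leq_subgraph[OF E(3)] unfolding subgraph_def by simp
  let ?h = "g \<circ> f"
  have hB: "?h ` verts B \<subseteq> verts (A j)" using vB gi(2) by auto
  have "gmap ?h B = gmap g ?B" by (simp add: gmap_gmap)
  also have "\<dots> = gmap g (induced ?E (verts ?B))" using subB by simp
  also have "\<dots> = induced (gmap g ?E) (g ` verts ?B)"
    using induced_gmap[OF C_graph[OF E(1)] gi(1) vB] by simp
  also have "\<dots> = induced (A j) (?h ` verts B)"
    unfolding gE using induced_induced[OF image_mono[OF vB], of "A j" g]
    by (simp add: image_comp)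
  also have "\<dots> = ind (?h ` verts B)" using ind_A_mono[OF hB] by simp
  finally have hind: "gmap ?h B = ind (?h ` verts B)" .
  have "leq (gmap g ?B) (gmap g ?E)" using leq_iso[OF E(3,1) gi(1)] .
  then have "leq (gmap g ?B) (A j)" using leq_trans[OF _ gi(4) A_C] gE by simp
  then have "str (?h ` verts B)"
    unfolding str_def using hB hind by (auto simp: gmap_gmap)
  moreover have "inj_on ?h (verts B)"
    using f(1) inj_on_subset[OF gi(1) vB] by (intro comp_inj_on) auto
  moreover have "\<forall>x\<in>W. ?h x = x" using f(2) g(2) i(1) by auto
  ultimately show ?thesis using hind by blast
qed

section \<open>Homogeneity of the limit by back and forth\<close>

definition piso :: "'a set \<Rightarrow> ('a \<Rightarrow> 'a) \<Rightarrow> bool" where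
  "piso W \<phi> \<longleftrightarrow> str W \<and> inj_on \<phi> W \<and> str (\<phi> ` W) \<and> gmap \<phi> (ind W) = ind (\<phi> ` W)"

lemma is_graph_ind: "is_graph (ind W)"
  using is_graph_induced[OF M_graph] .

lemma pisoI:
  assumes "str W" "inj_on \<phi> W" "str (\<phi> ` W)"
    "\<And>x y. x \<in> W \<Longrightarrow> y \<in> W \<Longrightarrow> {x, y} \<in> edges M \<longleftrightarrow> {\<phi> x, \<phi> y} \<in> edges M"
  shows "piso W \<phi>"
  using embedding_gmap[OF is_graph_ind[of W] is_graph_ind[of "\<phi> ` W"], of \<phi>] assms
    induced_induced[of "\<phi> ` W" "\<phi> ` W" M]
  unfolding piso_def by simp

lemma piso_edge:
  assumes "piso W \<phi>" "x \<in> W" "y \<in> W"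
  shows "{x, y} \<in> edges M \<longleftrightarrow> {\<phi> x, \<phi> y} \<in> edges M"
proof -
  have "inj_on \<phi> (verts (ind W))" "gmap \<phi> (ind W) = induced M (\<phi> ` verts (ind W))"
    using assms(1) unfolding piso_def by auto
  from gmap_edge_iff[OF is_graph_ind this, of x y] assms(2,3) show ?thesis by simp
qed

lemma piso_inverse:
  assumes "piso W \<phi>"
  shows "piso (\<phi> ` W) (inv_into W \<phi>)"
proof -
  have p: "str W" "inj_on \<phi> W" "str (\<phi> ` W)" "gmap \<phi> (ind W) = ind (\<phi> ` W)"
    using assms unfolding piso_def by auto
  have im: "inv_into W \<phi> ` \<phi> ` W = W" using p(2) by (simp add: image_comp)
  have "gmap (inv_into W \<phi>) (ind (\<phi> ` W)) = gmap (inv_into W \<phi> \<circ> \<phi>) (ind W)"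
    unfolding p(4)[symmetric] by (rule gmap_gmap)
  also have "\<dots> = ind W" using p(2) by (intro gmap_id is_graph_ind) simp
  finally show ?thesis unfolding piso_def using p im inj_on_inv_into[of "\<phi> ` W" \<phi> W] by simp
qed

lemma piso_forth:
  assumes p: "piso W \<phi>" and v: "v \<in> V"
  shows "\<exists>W' \<phi>'. piso W' \<phi>' \<and> W \<subseteq> W' \<and> v \<in> W' \<and> (\<forall>x\<in>W. \<phi>' x = \<phi> x)"
proof -
  have sW: "str W" "inj_on \<phi> W" "str (\<phi> ` W)" "gmap \<phi> (ind W) = ind (\<phi> ` W)"
    using p unfolding piso_def by auto
  obtain i where i: "insert v W \<subseteq> verts (A i)"
    using cover_A[of "insert v W"] str_finite[OF sW(1)] str_V[OF sW(1)] v by auto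
  have Wi: "W \<subseteq> verts (A i)" using i by simp
  obtain f where f: "inj_on f (verts (A i))" "\<forall>x\<in>W. f x = \<phi> x"
    "f ` (verts (A i) - W) \<inter> \<phi> ` W = {}"
    using fresh_injection[OF finite_A Wi str_finite[OF sW(3)] sW(2)] by auto
  let ?B = "gmap f (A i)"
  have B: "?B \<in> C" using C_iso[OF A_C f(1)] .
  have fW: "f ` W = \<phi> ` W" using f(2) by simp
  have gW: "gmap f (ind W) = ind (\<phi> ` W)"
    using gmap_cong[OF is_graph_ind[of W], of f \<phi>] f(2) sW(4) by simp
  have lW: "leq (ind W) (A i)" using str_leq[OF sW(1) Wi finite_A A_V] A_ind[of i] by simp
  have "leq (ind (\<phi> ` W)) ?B" using leq_iso[OF lW A_C f(1)] gW by simp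
  moreover have "induced ?B (\<phi> ` W) = ind (\<phi> ` W)"
    using induced_gmap[OF C_graph[OF A_C] f(1) Wi] ind_A_mono[OF Wi] gW fW by simp
  moreover have "\<phi> ` W \<subseteq> verts ?B" using image_mono[OF Wi, of f] fW by simp
  ultimately have "\<exists>g. inj_on g (verts ?B) \<and> (\<forall>x\<in>\<phi> ` W. g x = x) \<and>
      gmap g ?B = ind (g ` verts ?B) \<and> str (g ` verts ?B)"
    by (intro embed[OF B _ sW(3)])
  then obtain g where g: "inj_on g (verts ?B)" "\<forall>x\<in>\<phi> ` W. g x = x"
    "gmap g ?B = ind (g ` verts ?B)" "str (g ` verts ?B)"
    by blast
  have "piso (verts (A i)) (g \<circ> f)"
    unfolding piso_def
  proof (intro conjI)
    show "str (verts (A i))" by (rule str_A)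
    show "inj_on (g \<circ> f) (verts (A i))" using f(1) g(1) by (intro comp_inj_on) auto
    show "str ((g \<circ> f) ` verts (A i))" using g(4) by (simp add: image_comp)
    show "gmap (g \<circ> f) (ind (verts (A i))) = ind ((g \<circ> f) ` verts (A i))"
      using g(3) A_ind[of i] by (simp add: gmap_gmap image_comp)
  qed
  moreover have "\<forall>x\<in>W. (g \<circ> f) x = \<phi> x" using f(2) g(2) by auto
  ultimately show ?thesis using i by (intro exI[of _ "verts (A i)"] exI[of _ "g \<circ> f"]) auto
qed

lemma piso_back:
  assumes p: "piso W \<phi>" and v: "v \<in> V"
  shows "\<exists>W' \<phi>'. piso W' \<phi>' \<and> W \<subseteq> W' \<and> v \<in> \<phi>' ` W' \<and> (\<forall>x\<in>W. \<phi>' x = \<phi> x)"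
proof -
  obtain U \<psi> where U: "piso U \<psi>" "\<phi> ` W \<subseteq> U" "v \<in> U" "\<forall>x\<in>\<phi> ` W. \<psi> x = inv_into W \<phi> x"
    using piso_forth[OF piso_inverse[OF p] v] by blast
  have inj: "inj_on \<phi> W" "inj_on \<psi> U" using p U(1) unfolding piso_def by auto
  have \<psi>: "\<psi> (\<phi> x) = x" if "x \<in> W" for x using U(4) inj(1) that by simp
  show ?thesis
  proof (intro exI conjI)
    show "piso (\<psi> ` U) (inv_into U \<psi>)" using piso_inverse[OF U(1)] .
    show "W \<subseteq> \<psi> ` U" using \<psi> U(2) by force
    show "v \<in> inv_into U \<psi> ` \<psi> ` U" using U(3) inj(2) by (simp add: image_comp)
    show "\<forall>x\<in>W. inv_into U \<psi> x = \<phi> x"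
    proof
      fix x assume "x \<in> W"
      then show "inv_into U \<psi> x = \<phi> x"
        using inv_into_f_f[OF inj(2), of "\<phi> x"] \<psi> U(2) by auto
    qed
  qed
qed

lemma piso_back_and_forth:
  assumes "piso W \<phi>" "v \<in> V"
  shows "\<exists>W' \<phi>'. piso W' \<phi>' \<and> W \<subseteq> W' \<and> v \<in> W' \<and> v \<in> \<phi>' ` W' \<and> (\<forall>x\<in>W. \<phi>' x = \<phi> x)"
proof -
  obtain W1 \<phi>1 where 1: "piso W1 \<phi>1" "W \<subseteq> W1" "v \<in> W1" "\<forall>x\<in>W. \<phi>1 x = \<phi> x"
    using piso_forth[OF assms] by blast
  obtain W2 \<phi>2 where 2: "piso W2 \<phi>2" "W1 \<subseteq> W2" "v \<in> \<phi>2 ` W2" "\<forall>x\<in>W1. \<phi>2 x = \<phi>1 x"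
    using piso_back[OF 1(1) assms(2)] by blast
  show ?thesis using 1 2 by (intro exI[of _ W2] exI[of _ \<phi>2]) auto
qed

lemma homogeneous:
  assumes p: "piso W \<phi>"
  shows "\<exists>h\<in>automorphisms M. \<forall>x\<in>W. h x = \<phi> x"
proof (cases "V = {}")
  case True
  then have "W = {}" using p str_V[of W] unfolding piso_def by simp
  then show ?thesis using aut_id[of M] by blast
next
  case False
  \<comment> \<open>The enumeration may repeat values, so a finite \<open>V\<close> is covered too.
    Stage \<open>n\<close> puts \<open>e n\<close> into both the domain and the range.\<close>
  define e where "e = from_nat_into V"
  have eV: "e n \<in> V" for n unfolding e_def using False by (rule from_nat_into)
  have e_surj: "\<exists>n. e n = v" if "v \<in> V" for v
    unfolding e_def using from_nat_into_surj[OF M_countable that] .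
  have "\<exists>s. \<forall>n. (piso (fst (s n)) (snd (s n)) \<and> W \<subseteq> fst (s n) \<and> (\<forall>x\<in>W. snd (s n) x = \<phi> x)) \<and>
    (fst (s n) \<subseteq> fst (s (Suc n)) \<and> e n \<in> fst (s (Suc n)) \<and> e n \<in> snd (s (Suc n)) ` fst (s (Suc n)) \<and>
      (\<forall>x\<in>fst (s n). snd (s (Suc n)) x = snd (s n) x))"
  proof (rule dependent_nat_choice)
    show "\<exists>x. piso (fst x) (snd x) \<and> W \<subseteq> fst x \<and> (\<forall>y\<in>W. snd x y = \<phi> y)"
      using p by (intro exI[of _ "(W, \<phi>)"]) simp
    fix x n assume x: "piso (fst x) (snd x) \<and> W \<subseteq> fst x \<and> (\<forall>y\<in>W. snd x y = \<phi> y)"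
    obtain W' \<phi>' where "piso W' \<phi>'" "fst x \<subseteq> W'" "e n \<in> W'" "e n \<in> \<phi>' ` W'"
      "\<forall>y\<in>fst x. \<phi>' y = snd x y"
      using piso_back_and_forth[OF conjunct1[OF x] eV[of n]] by blast
    then show "\<exists>y. (piso (fst y) (snd y) \<and> W \<subseteq> fst y \<and> (\<forall>z\<in>W. snd y z = \<phi> z)) \<and>
        fst x \<subseteq> fst y \<and> e n \<in> fst y \<and> e n \<in> snd y ` fst y \<and> (\<forall>z\<in>fst x. snd y z = snd x z)"
      using x by (intro exI[of _ "(W', \<phi>')"]) auto
  qed
  then obtain s where s: "\<forall>n. (piso (fst (s n)) (snd (s n)) \<and> W \<subseteq> fst (s n) \<and> (\<forall>x\<in>W. snd (s n) x = \<phi> x)) \<and>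
    (fst (s n) \<subseteq> fst (s (Suc n)) \<and> e n \<in> fst (s (Suc n)) \<and> e n \<in> snd (s (Suc n)) ` fst (s (Suc n)) \<and>
      (\<forall>x\<in>fst (s n). snd (s (Suc n)) x = snd (s n) x))"
    by blast
  define D where "D n = fst (s n)" for n
  define \<theta> where "\<theta> n = snd (s n)" for n
  have P: "piso (D n) (\<theta> n)" "W \<subseteq> D n" "\<And>x. x \<in> W \<Longrightarrow> \<theta> n x = \<phi> x"
    "D n \<subseteq> D (Suc n)" "e n \<in> D (Suc n)" "e n \<in> \<theta> (Suc n) ` D (Suc n)"
    "\<And>x. x \<in> D n \<Longrightarrow> \<theta> (Suc n) x = \<theta> n x" for n
    using s unfolding D_def \<theta>_def by blast+
  have mono: "D m \<subseteq> D n" if "m \<le> n" for m n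
    using that P(4) by (rule lift_Suc_mono_le[rotated])
  have agr: "\<theta> n x = \<theta> m x" if "m \<le> n" "x \<in> D m" for m n x
    using that(1)
  proof (induction n rule: dec_induct)
    case (step n)
    then show ?case using P(7)[of x n] mono[of m n] that(2) by auto
  qed simp
  \<comment> \<open>All stages whose domain contains \<open>x\<close> give the same value. The
    restriction makes the map extensional, as membership in \<open>automorphisms\<close>
    demands.\<close>
  define h where "h = restrict (\<lambda>x. \<theta> (LEAST n. x \<in> D n) x) V"
  have DV: "D n \<subseteq> V" for n using str_V[of "D n"] P(1)[of n] unfolding piso_def by simp
  have cov: "\<exists>n. v \<in> D n" if "v \<in> V" for v using e_surj[OF that] P(5) by metis
  have h: "h x = \<theta> n x" if "x \<in> D n" for x n
  proof -
    have "x \<in> D (LEAST n. x \<in> D n)" using that by (rule LeastI)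
    moreover have "(LEAST n. x \<in> D n) \<le> n" using that by (rule Least_le)
    moreover have "x \<in> V" using DV[of n] that by blast
    ultimately show ?thesis unfolding h_def using agr by simp
  qed
  have both: "\<exists>n. x \<in> D n \<and> y \<in> D n" if xy: "x \<in> V" "y \<in> V" for x y
  proof -
    obtain m n where "x \<in> D m" "y \<in> D n" using cov[OF xy(1)] cov[OF xy(2)] by blast
    then show ?thesis using mono[of m "max m n"] mono[of n "max m n"] by (intro exI[of _ "max m n"]) auto
  qed
  have inj: "inj_on h V"
  proof (rule inj_onI)
    fix x y assume "x \<in> V" "y \<in> V" "h x = h y"
    then obtain n where n: "x \<in> D n" "y \<in> D n" using both by blast
    moreover have "inj_on (\<theta> n) (D n)" using P(1) unfolding piso_def by blast
    ultimately show "x = y" using h \<open>h x = h y\<close> by (metis inj_onD)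
  qed
  have "h ` V = V"
  proof
    show "h ` V \<subseteq> V"
    proof
      fix z assume "z \<in> h ` V"
      then obtain x n where "x \<in> D n" "z = h x" using cov by blast
      then have "z \<in> \<theta> n ` D n" using h by auto
      then show "z \<in> V" using P(1)[of n] str_V[of "\<theta> n ` D n"] unfolding piso_def by auto
    qed
    show "V \<subseteq> h ` V"
    proof
      fix z assume "z \<in> V"
      then obtain n where "z = e n" using e_surj by blast
      then obtain x where "x \<in> D (Suc n)" "z = \<theta> (Suc n) x" using P(6) by blast
      then show "z \<in> h ` V" using h DV[of "Suc n"] by (metis image_eqI subsetD)
    qed
  qed
  then have "bij_betw h V V" using inj by (simp add: bij_betw_def)
  moreover have "{x, y} \<in> edges M \<longleftrightarrow> {h x, h y} \<in> edges M" if xy: "x \<in> V" "y \<in> V" for x y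
  proof -
    obtain n where "x \<in> D n" "y \<in> D n" using both[OF xy] by blast
    then show ?thesis using piso_edge[OF P(1)[of n]] h by simp
  qed
  moreover have "h \<in> extensional V" unfolding h_def by simp
  ultimately have "h \<in> automorphisms M" by (simp add: automorphisms_def)
  moreover have "\<forall>x\<in>W. h x = \<phi> x" using P(2)[of 0] P(3)[of _ 0] h by auto
  ultimately show ?thesis by blast
qed

lemma extend:
  assumes p: "piso X \<phi>" and W: "str W" "X \<subseteq> W" and W0: "str W0" "\<phi> ` X \<subseteq> W0"
  shows "\<exists>h\<in>automorphisms M. (\<forall>x\<in>X. h x = \<phi> x) \<and> h ` W \<inter> W0 = \<phi> ` X \<and> free (h ` W) W0 \<and> str (h ` W \<union> W0)"
proof -
  have pX: "str X" "inj_on \<phi> X" "str (\<phi> ` X)" "gmap \<phi> (ind X) = ind (\<phi> ` X)"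
    using p unfolding piso_def by auto
  obtain f where f: "inj_on f W" "\<forall>x\<in>X. f x = \<phi> x" "f ` (W - X) \<inter> W0 = {}"
    using fresh_injection[OF str_finite[OF W(1)] W(2) str_finite[OF W0(1)] pX(2) W0(2)] by auto
  let ?B = "gmap f (ind W)"
  have CW: "ind W \<in> C" "ind W0 \<in> C" "ind (\<phi> ` X) \<in> C"
    using W(1) W0(1) pX(3) str_finite str_V by (auto intro!: ind_finite_C)
  have fi: "inj_on f (verts (ind W))" using f(1) by simp
  have B: "?B \<in> C" using C_iso[OF CW(1) fi] .
  have fX: "gmap f (ind X) = ind (\<phi> ` X)"
    using gmap_cong[OF is_graph_ind[of X], of f \<phi>] f(2) pX(4) by simp
  have "leq (ind X) (ind W)" using str_leq[OF pX(1) W(2) str_finite[OF W(1)] str_V[OF W(1)]] .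
  then have lB: "leq (ind (\<phi> ` X)) ?B" using leq_iso[OF _ CW(1) fi] fX by metis
  have l0: "leq (ind (\<phi> ` X)) (ind W0)"
    using str_leq[OF pX(3) W0(2) str_finite[OF W0(1)] str_V[OF W0(1)]] .
  have "f ` W = \<phi> ` X \<union> f ` (W - X)"
  proof -
    have "f ` X = \<phi> ` X" using f(2) by simp
    moreover have "W = X \<union> (W - X)" using W(2) by blast
    ultimately show ?thesis by (metis image_Un)
  qed
  then have int: "W0 \<inter> f ` W = \<phi> ` X" using f(3) W0(2) by blast
  let ?E = "free_amalgam (ind W0) ?B"
  have E: "?E \<in> C" "leq (ind W0) ?E" "leq ?B ?E"
    using free_amalgamation CW B l0 lB int unfolding free_amalgamation_class_def by auto
  have vE: "verts ?E = W0 \<union> f ` W" "edges ?E = edges (ind W0) \<union> edges ?B"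
    by (simp_all add: free_amalgam_def)
  have sub0: "induced ?E W0 = ind W0" using leq_subgraph[OF E(2)] unfolding subgraph_def by simp
  have subB: "?B = induced ?E (f ` W)" using leq_subgraph[OF E(3)] unfolding subgraph_def by simp
  obtain g where g: "inj_on g (verts ?E)" "\<forall>x\<in>W0. g x = x" "gmap g ?E = ind (g ` verts ?E)"
    "str (g ` verts ?E)"
    using embed[OF E(1) _ W0(1) sub0 E(2), unfolded vE(1), OF Un_upper1] unfolding vE(1) by blast
  have gW0: "g ` W0 = W0" using g(2) by simp
  have gEv: "g ` verts ?E = (g \<circ> f) ` W \<union> W0" using gW0 vE(1) by (auto simp: image_Un image_comp)
  have fWE: "f ` W \<subseteq> verts ?E" using vE(1) by simp
  have gfB: "gmap (g \<circ> f) (ind W) = ind ((g \<circ> f) ` W)"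
  proof -
    have "gmap (g \<circ> f) (ind W) = gmap g (induced ?E (f ` W))"
      using subB by (simp add: gmap_gmap[symmetric])
    also have "\<dots> = induced (gmap g ?E) (g ` f ` W)"
      using induced_gmap[OF C_graph[OF E(1)] g(1) fWE] by simp
    also have "\<dots> = ind (g ` f ` W)"
      unfolding g(3) by (intro induced_induced image_mono fWE)
    finally show ?thesis by (simp add: image_comp)
  qed
  have "leq (gmap g ?B) (gmap g ?E)" using leq_iso[OF E(3,1) g(1)] .
  then have "leq (ind ((g \<circ> f) ` W)) (ind (g ` verts ?E))"
    using gfB g(3) by (simp add: gmap_gmap)
  then have "str ((g \<circ> f) ` W)" by (rule str_trans[OF g(4)])
  moreover have "inj_on (g \<circ> f) W" using f(1) inj_on_subset[OF g(1) fWE] by (intro comp_inj_on) auto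
  ultimately have "piso W (g \<circ> f)" using W(1) gfB unfolding piso_def by simp
  then obtain h where h: "h \<in> automorphisms M" "\<forall>x\<in>W. h x = (g \<circ> f) x" using homogeneous by blast
  have hW: "h ` W = (g \<circ> f) ` W" using h(2) by simp
  have "\<forall>x\<in>X. h x = \<phi> x" using h(2) W(2) f(2) g(2) W0(2) by force
  moreover have "h ` W \<inter> W0 = \<phi> ` X"
  proof -
    have "g ` f ` W \<inter> g ` W0 = g ` (f ` W \<inter> W0)"
      using inj_on_image_Int[OF g(1), of "f ` W" W0] vE(1) by simp
    also have "\<dots> = g ` \<phi> ` X" using int by (simp add: Int_commute)
    also have "\<dots> = id ` \<phi> ` X" using g(2) W0(2) by (intro image_cong refl) auto
    finally show ?thesis using hW gW0 by (simp add: image_image)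
  qed
  moreover have "free (h ` W) W0"
    unfolding free_def
  proof (intro ballI impI)
    fix d assume d: "d \<in> edges M" "d \<subseteq> h ` W \<union> W0"
    then have "d \<in> edges (gmap g ?E)" using g(3) gEv hW by simp
    then obtain d' where d': "d' \<in> edges ?E" "d = g ` d'" by auto
    then have "d' \<subseteq> W0 \<or> d' \<subseteq> f ` W"
      using vE(2) C_graph[OF B] by (auto simp: is_graph_def)
    then have "d \<subseteq> g ` W0 \<or> d \<subseteq> g ` f ` W" using d'(2) by blast
    then show "d \<subseteq> h ` W \<or> d \<subseteq> W0" using gW0 hW by (simp add: image_image disj_commute)
  qed
  moreover have "str (h ` W \<union> W0)" using g(4) gEv hW by simp
  ultimately show ?thesis using h(1) by blast
qed

lemma aut_gmap:
  assumes "h \<in> automorphisms M" "X \<subseteq> V"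
  shows "gmap h (ind X) = ind (h ` X)"
proof -
  have "gmap h (ind X) = induced (ind (h ` X)) (h ` verts (ind X))"
  proof (rule embedding_gmap[OF is_graph_ind is_graph_ind])
    show "inj_on h (verts (ind X))" using aut_inj[OF assms] by simp
  next
    fix x y assume "x \<in> verts (ind X)" "y \<in> verts (ind X)"
    then show "{x, y} \<in> edges (ind X) \<longleftrightarrow> {h x, h y} \<in> edges (ind (h ` X))"
      using aut_edge[OF assms(1), of x y] assms(2) by auto
  qed simp
  then show ?thesis using induced_induced[of "h ` X" "h ` X" M] by simp
qed

lemma str_aut:
  assumes "str W" "h \<in> automorphisms M"
  shows "str (h ` W)"
proof -
  obtain k where k: "k \<in> automorphisms M" "\<forall>x\<in>V. k (h x) = x" "\<forall>x\<in>V. h (k x) = x"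
    using aut_inv[OF assms(2)] by blast
  have W: "finite W" "W \<subseteq> V" using str_finite[OF assms(1)] str_V[OF assms(1)] .
  have "h ` W \<subseteq> V" using aut_in[OF assms(2)] W(2) by blast
  then obtain j where j: "h ` W \<subseteq> verts (A j)" using cover_A[of "h ` W"] W(1) by blast
  let ?X = "k ` verts (A j)"
  have X: "finite ?X" "?X \<subseteq> V" using finite_A[of j] A_V[of j] aut_in[OF k(1)] by auto
  have WX: "W \<subseteq> ?X"
  proof
    fix x assume "x \<in> W"
    then have "h x \<in> verts (A j)" "k (h x) = x" using j W(2) k(2) by blast+
    then show "x \<in> ?X" by (metis image_eqI)
  qed
  have hX: "h ` ?X = verts (A j)" using k(3) A_V[of j] by (force simp: image_comp)
  have i: "inj_on h (verts (ind ?X))" using aut_inj[OF assms(2) X(2)] by simp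
  have "leq (gmap h (ind W)) (gmap h (ind ?X))"
    using leq_iso[OF str_leq[OF assms(1) WX X] ind_finite_C[OF X] i] .
  then have "leq (ind (h ` W)) (A j)"
    using aut_gmap[OF assms(2) W(2)] aut_gmap[OF assms(2) X(2)] hX A_ind[of j] by simp
  then show ?thesis unfolding str_def using j by blast
qed

end

section \<open>Growing full out-balls\<close>

lemma card_orientation_edges:
  assumes "two_orientation M S" "is_graph M"
  shows "card (S \<inter> (R \<times> R)) = card {e \<in> edges M. e \<subseteq> R}"
proof -
  let ?f = "\<lambda>(x, y). {x, y}"
  have "inj_on ?f (S \<inter> (R \<times> R))"
  proof (rule inj_onI)
    fix p q assume p: "p \<in> S \<inter> (R \<times> R)" and q: "q \<in> S \<inter> (R \<times> R)" and eq: "?f p = ?f q"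
    obtain x y u v where [simp]: "p = (x, y)" "q = (u, v)" by (cases p; cases q) auto
    have "(y, x) \<notin> S" using two_orientation_dir[OF assms(1) two_orientation_edge[OF assms(1)]] p by auto
    then show "p = q" using eq p q by (auto simp: doubleton_eq_iff)
  qed
  moreover have "?f ` (S \<inter> (R \<times> R)) = {e \<in> edges M. e \<subseteq> R}"
  proof
    show "?f ` (S \<inter> (R \<times> R)) \<subseteq> {e \<in> edges M. e \<subseteq> R}"
      using two_orientation_edge[OF assms(1)] by auto
    show "{e \<in> edges M. e \<subseteq> R} \<subseteq> ?f ` (S \<inter> (R \<times> R))"
    proof
      fix e assume e: "e \<in> {e \<in> edges M. e \<subseteq> R}"
      then obtain x y where xy: "e = {x, y}" using pair_edge[OF assms(2), of e] by blast
      then have "(x, y) \<in> S \<or> (y, x) \<in> S"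
        using two_orientation_dir[OF assms(1), of x y] e by auto
      then show "e \<in> ?f ` (S \<inter> (R \<times> R))" using e xy by (auto simp: insert_commute)
    qed
  qed
  ultimately show ?thesis using card_image[of ?f "S \<inter> (R \<times> R)"] by simp
qed

lemma finite_successor_cycle:
  assumes "finite Z" "Z \<noteq> {}" "\<And>z. z \<in> Z \<Longrightarrow> \<exists>w\<in>Z. (z, w) \<in> S"
  shows "\<exists>z\<in>Z. \<exists>k. (z, z) \<in> S ^^ Suc k"
proof -
  obtain f where f: "\<forall>z\<in>Z. f z \<in> Z \<and> (z, f z) \<in> S" using assms(3) by metis
  obtain z0 where z0: "z0 \<in> Z" using assms(2) by blast
  have in_Z: "(f ^^ n) z0 \<in> Z" for n by (induction n) (use z0 f in auto)
  have walk: "((f ^^ m) z0, (f ^^ (k + m)) z0) \<in> S ^^ k" for m k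
  proof (induction k)
    case (Suc k)
    then show ?case using f in_Z[of "k + m"] by auto
  qed simp
  have "\<not> inj (\<lambda>n. (f ^^ n) z0)"
  proof
    assume "inj (\<lambda>n. (f ^^ n) z0)"
    moreover have "finite (range (\<lambda>n. (f ^^ n) z0))"
      using in_Z by (intro finite_subset[OF _ assms(1)]) auto
    ultimately show False using finite_imageD infinite_UNIV_nat by fastforce
  qed
  then obtain m n where mn: "m \<noteq> n" "(f ^^ m) z0 = (f ^^ n) z0" unfolding inj_def by auto
  have "\<exists>z\<in>Z. \<exists>k. (z, z) \<in> S ^^ Suc k" if mn: "m < n" "(f ^^ m) z0 = (f ^^ n) z0" for m n
  proof -
    have "n = Suc (n - Suc m) + m" using mn(1) by simp
    then have "((f ^^ m) z0, (f ^^ m) z0) \<in> S ^^ Suc (n - Suc m)"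
      using walk[of m "Suc (n - Suc m)"] mn(2) by simp
    then show ?thesis using in_Z[of m] by blast
  qed
  then show ?thesis using mn by (metis linorder_neqE_nat)
qed

text \<open>By \<open>not_full_mono\<close> a fading vertex has full balls only up to some finite
  radius.\<close>

definition fades :: "('a \<times> 'a) set \<Rightarrow> 'a \<Rightarrow> bool" where
  "fades S x \<longleftrightarrow> (\<exists>n. \<not> full S n x)"

definition spread :: "('a \<times> 'a) set \<Rightarrow> nat \<Rightarrow> 'a set \<Rightarrow> bool" where
  "spread S r T \<longleftrightarrow> finite T \<and> (\<forall>t\<in>T. full S r t) \<and>
    (\<forall>t\<in>T. \<forall>u\<in>T. t \<noteq> u \<longrightarrow> out_ball S r t \<inter> out_ball S r u = {})"

lemma spread_subset: "spread S r T \<Longrightarrow> T' \<subseteq> T \<Longrightarrow> spread S r T'"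
  unfolding spread_def by (simp add: finite_subset subset_iff)

section \<open>Supplies of roots and copies using them\<close>

context limit_graph
begin

definition indep :: "'a set \<Rightarrow> bool" where
  "indep T \<longleftrightarrow> (\<forall>x\<in>T. \<forall>y\<in>T. {x, y} \<notin> edges M)"

text \<open>The property \<open>\<Psi>\<close> is a parameter because the first round asks nothing
  of its roots, while all later rounds ask that they fade.\<close>

definition good :: "('a \<times> 'a) set \<Rightarrow> nat \<Rightarrow> ('a \<Rightarrow> bool) \<Rightarrow> 'a set \<Rightarrow> bool" where
  "good S r \<Psi> T \<longleftrightarrow> str T \<and> indep T \<and> spread S r T \<and> (\<forall>t\<in>T. \<Psi> t)"

text \<open>A copy of \<open>D\<close> all of whose out-edges stay in \<open>D\<close> except one edge to \<open>c i\<close> for each slot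
  \<open>i \<in> I\<close>, which starts at the vertex \<open>fst i\<close>. The set \<open>X\<close> is a context to be kept free from the
  copy, and \<open>F\<close> a set to be avoided.\<close>

definition slot_copy :: "('a \<times> 'a) set \<Rightarrow> nat \<Rightarrow> 'a set \<Rightarrow> ('a \<times> nat) set \<Rightarrow>
    'a set \<Rightarrow> 'a set \<Rightarrow> 'a set \<Rightarrow> ('a \<Rightarrow> 'a) \<Rightarrow> ('a \<times> nat \<Rightarrow> 'a) \<Rightarrow> bool" where
  "slot_copy S r D I T X F h c \<longleftrightarrow>
     h \<in> automorphisms M \<and> inj_on c I \<and> h ` D \<inter> F = {} \<and>
     (\<forall>x\<in>D. card (S `` {h x}) = 2 \<and> S `` {h x} \<subseteq> h ` D \<union> c ` I) \<and>
     (\<forall>x\<in>D. \<forall>i\<in>I. (h x, c i) \<in> S \<longleftrightarrow> fst i = x) \<and>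
     spread S r (c ` I) \<and> (\<forall>i\<in>I. out_ball S r (c i) \<inter> h ` D = {}) \<and>
     (\<forall>i\<in>I. out_ball S r (c i) \<inter> F \<subseteq> (\<Union>t\<in>T. out_ball S r t)) \<and>
     ((\<forall>t\<in>T. fades S t) \<longrightarrow> (\<forall>i\<in>I. fades S (c i))) \<and>
     str (X \<union> h ` D) \<and> (\<forall>x\<in>X. \<forall>y\<in>h ` D. {x, y} \<notin> edges M) \<and> X \<inter> h ` D = {}"

lemma slot_copyD:
  assumes "slot_copy S r D I T X F h c"
  shows "h \<in> automorphisms M" "inj_on c I" "h ` D \<inter> F = {}"
    "\<forall>x\<in>D. card (S `` {h x}) = 2" "\<forall>x\<in>D. S `` {h x} \<subseteq> h ` D \<union> c ` I"
    "\<forall>x\<in>D. \<forall>i\<in>I. (h x, c i) \<in> S \<longleftrightarrow> fst i = x" "spread S r (c ` I)"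
    "\<forall>i\<in>I. out_ball S r (c i) \<inter> h ` D = {}"
    "\<forall>i\<in>I. out_ball S r (c i) \<inter> F \<subseteq> (\<Union>t\<in>T. out_ball S r t)"
    "(\<forall>t\<in>T. fades S t) \<Longrightarrow> (\<forall>i\<in>I. fades S (c i))"
    "str (X \<union> h ` D)" "\<forall>x\<in>X. \<forall>y\<in>h ` D. {x, y} \<notin> edges M" "X \<inter> h ` D = {}"
  using assms unfolding slot_copy_def by (elim conjE; simp)+

lemma no_loop: "{x, x} \<notin> edges M"
  using M_graph by (auto simp: is_graph_def)

lemma freeI:
  assumes "\<And>x y. x \<in> X \<Longrightarrow> y \<in> Y \<Longrightarrow> x \<notin> Y \<Longrightarrow> y \<notin> X \<Longrightarrow> {x, y} \<notin> edges M"
  shows "free X Y"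
  unfolding free_def
proof (intro ballI impI)
  fix e assume e: "e \<in> edges M" "e \<subseteq> X \<union> Y"
  obtain x y where xy: "e = {x, y}" using pair_edge[OF M_graph e(1)] by blast
  have n: "\<not> (x \<in> X \<and> y \<in> Y \<and> x \<notin> Y \<and> y \<notin> X)" "\<not> (y \<in> X \<and> x \<in> Y \<and> y \<notin> Y \<and> x \<notin> X)"
    using assms[of x y] assms[of y x] e(1) xy by (auto simp: insert_commute)
  then show "e \<subseteq> X \<or> e \<subseteq> Y" using e(2) xy by auto
qed

lemma piso_empty: "piso {} \<phi>"
  using str_empty by (intro pisoI) auto

lemma fades_pred: "out2 S \<Longrightarrow> (x, y) \<in> S \<Longrightarrow> fades S y \<Longrightarrow> fades S x"
  unfolding fades_def using not_full_pred[of S x y] by blast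

end

section \<open>The common argument: growing trees and separating copies\<close>

text \<open>The interface between the classes and the argument shared by them.
  \<open>slot_single\<close> deepens trees by one level, \<open>slot_cycle\<close> leaves each
  vertex an out-edge inside the copy and so creates directed cycles, \<open>slot_cover\<close>
  captures the finite set from recurrence, and \<open>str_sparse\<close> forbids finite sets closed
  under two out-edges around a strong vertex.\<close>

locale slot_graph = limit_graph C leq M A
  for C and leq :: "'a::infinite graph \<Rightarrow> 'a graph \<Rightarrow> bool" and M A +
  fixes Slot :: "'a set \<Rightarrow> ('a \<times> nat) set \<Rightarrow> bool"
  assumes indep_subset: "str T \<Longrightarrow> indep T \<Longrightarrow> T' \<subseteq> T \<Longrightarrow> str T'"
    and str_single: "\<exists>a. str {a}"
    and str_sparse: "str {a} \<Longrightarrow> finite R \<Longrightarrow> R \<subseteq> V \<Longrightarrow> a \<in> R \<Longrightarrow>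
      card {e \<in> edges M. e \<subseteq> R} < 2 * card R"
    and slot_finite: "Slot D I \<Longrightarrow> finite D \<and> D \<subseteq> V \<and> finite I \<and> fst ` I \<subseteq> D"
    and slot_cover: "finite D \<Longrightarrow> D \<subseteq> V \<Longrightarrow> \<exists>D' I. D \<subseteq> D' \<and> Slot D' I"
    and slot_single: "str {x} \<Longrightarrow> Slot {x} {(x, 0), (x, 1)}"
    and slot_cycle: "\<exists>D I. Slot D I \<and> D \<noteq> {} \<and> (\<forall>y\<in>D. str {y} \<and> card {i \<in> I. fst i = y} = 1)"
    and slot_copies: "Slot D I \<Longrightarrow> \<exists>k. \<forall>S T X F. two_orientation M S \<and> card T = k \<and> str X \<and>
      str (X \<union> T) \<and> X \<inter> T = {} \<and> indep (X \<union> T) \<and> spread S r T \<and> finite F \<and> F \<subseteq> V \<longrightarrow>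
      (\<exists>h c. slot_copy S r D I T X F h c)"
begin

lemma indep_str_sets: "\<exists>T. card T = n \<and> str T \<and> indep T"
proof (induction n)
  case 0
  show ?case using str_empty by (intro exI[of _ "{}"]) (simp add: indep_def)
next
  case (Suc n)
  then obtain T where T: "card T = n" "str T" "indep T" by blast
  obtain a where a: "str {a}" using str_single by blast
  obtain h where h: "h \<in> automorphisms M" "h ` {a} \<inter> T = {}" "free (h ` {a}) T" "str (h ` {a} \<union> T)"
    using extend[OF piso_empty a empty_subsetI T(2), of id] by auto
  let ?T = "insert (h a) T"
  have "h a \<notin> T" using h(2) by auto
  then have "card ?T = Suc n" using T(1) str_finite[OF T(2)] by simp
  moreover have "str ?T" using h(4) by simp
  moreover have "indep ?T"
  proof -
    have "{h a, t} \<notin> edges M" if "t \<in> T" for t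
      using h(3) that \<open>h a \<notin> T\<close> no_loop[of "h a"] unfolding free_def by auto
    then show ?thesis using T(3) no_loop unfolding indep_def by (auto simp: insert_commute)
  qed
  ultimately show ?case by blast
qed

lemma good_from_copies:
  assumes S: "two_orientation M S" and sl: "Slot D I"
    and H: "\<And>T X F h c. slot_copy S r D I T X F h c \<Longrightarrow> \<forall>t\<in>T. \<Psi> t \<Longrightarrow>
      \<exists>y\<in>D. str {y} \<and> full S r' (h y) \<and> \<Phi> (h y) \<and>
        out_ball S r' (h y) \<inter> F \<subseteq> (\<Union>t\<in>T. out_ball S r t)"
    and many: "\<And>n. \<exists>T. card T = n \<and> good S r \<Psi> T"
  shows "\<exists>T. card T = n \<and> good S r' \<Phi> T"
proof -
  note o2 = two_orientation_out2[OF S]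
  have SV: "S \<subseteq> V \<times> V" using two_orientation_sub[OF S] .
  obtain k where k: "\<And>T X F. card T = k \<Longrightarrow> str X \<Longrightarrow>
      str (X \<union> T) \<Longrightarrow> X \<inter> T = {} \<Longrightarrow> indep (X \<union> T) \<Longrightarrow> spread S r T \<Longrightarrow> finite F \<Longrightarrow> F \<subseteq> V \<Longrightarrow>
      \<exists>h c. slot_copy S r D I T X F h c"
    using slot_copies[OF sl, of r] S by metis
  \<comment> \<open>Invariant: \<open>X\<close> holds the new roots, \<open>T\<close> the old roots
    still to be used, and their balls do not meet.\<close>
  have step: "\<exists>X'. card X' = card X + n \<and> good S r' \<Phi> X'"
    if "card T = n * k" "str (X \<union> T)" "X \<inter> T = {}" "indep (X \<union> T)" "spread S r T" "\<forall>t\<in>T. \<Psi> t"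
      "spread S r' X" "\<forall>x\<in>X. \<Phi> x" "\<forall>x\<in>X. \<forall>t\<in>T. out_ball S r' x \<inter> out_ball S r t = {}"
    for n X T
    using that
  proof (induction n arbitrary: X T)
    case 0
    have "finite T" using 0(5) unfolding spread_def by blast
    then have "T = {}" using 0(1) by simp
    then show ?case using 0 unfolding good_def by auto
  next
    case (Suc n)
    note P = Suc.prems
    have fin: "finite T" "finite X" using P(5,7) unfolding spread_def by blast+
    have XT: "X \<union> T \<subseteq> V" using str_V[OF P(2)] .
    have "k \<le> card T" using P(1) by simp
    then obtain T1 where T1: "T1 \<subseteq> T" "card T1 = k" using obtain_subset_with_card_n by metis
    define T2 where "T2 = T - T1"
    have T2: "T2 \<subseteq> T" "T1 \<inter> T2 = {}" "T = T1 \<union> T2" "card T2 = n * k"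
      using T1 P(1) fin(1) by (auto simp: T2_def card_Diff_subset finite_subset)
    \<comment> \<open>All balls in use are avoided, so the new ball can meet them only inside the
      balls of the roots just consumed.\<close>
    let ?F = "(\<Union>x\<in>X. out_ball S r' x) \<union> (\<Union>t\<in>T. out_ball S r t)"
    have F: "finite ?F" using fin finite_out_ball[OF o2] by auto
    have FV: "?F \<subseteq> V" using out_ball_sub[OF SV] XT by (intro Un_least UN_least) auto
    have eq: "(X \<union> T2) \<union> T1 = X \<union> T" using T2(3) by blast
    have "\<exists>h c. slot_copy S r D I T1 (X \<union> T2) ?F h c"
    proof (rule k)
      show "str (X \<union> T2)" by (rule indep_subset[OF P(2,4)]) (use T2(1) in blast)
      show "spread S r T1" using spread_subset[OF P(5) T1(1)] .
      show "(X \<union> T2) \<inter> T1 = {}" using P(3) T1(1) T2(2) by blast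
    qed (use T1 P F FV eq in simp_all)
    then obtain h c where hc: "slot_copy S r D I T1 (X \<union> T2) ?F h c" by blast
    obtain y where y: "y \<in> D" "str {y}" "full S r' (h y)" "\<Phi> (h y)"
      "out_ball S r' (h y) \<inter> ?F \<subseteq> (\<Union>t\<in>T1. out_ball S r t)"
      using H[OF hc] P(6) T1(1) by blast
    note hc' = slot_copyD(1,3,11-13)[OF hc]
    let ?X = "insert (h y) X"
    have hy: "h y \<notin> X \<union> T2" using hc'(5) y(1) by blast
    have fr: "free (X \<union> T2) (h ` D)" by (rule freeI) (use hc'(4) in blast)
    have st: "str (X \<union> T2 \<union> {h y})"
    proof (rule str_free_union[OF hc'(3) _ fr])
      show "str ((X \<union> T2) \<inter> h ` D)" using hc'(5) str_empty by simp
      show "str (X \<union> T2)" by (rule indep_subset[OF P(2,4)]) (use T2(1) in blast)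
      show "str {h y}" using str_aut[OF y(2) hc'(1)] by simp
    qed (use y(1) hc'(5) in auto)
    \<comment> \<open>The overlap would lie in balls around \<open>T1\<close>, which by the
      invariant are disjoint from those around \<open>X\<close>.\<close>
    have dis: "out_ball S r' (h y) \<inter> out_ball S r' x = {}" if "x \<in> X" for x
    proof -
      have "out_ball S r' (h y) \<inter> out_ball S r' x \<subseteq> (\<Union>t\<in>T1. out_ball S r t)"
        using y(5) that by blast
      then show ?thesis using P(9) that T1(1) by blast
    qed
    have dis2: "out_ball S r' (h y) \<inter> out_ball S r t = {}" if t: "t \<in> T2" for t
    proof -
      have "out_ball S r' (h y) \<inter> out_ball S r t \<subseteq> (\<Union>t\<in>T1. out_ball S r t)"
        using y(5) t T2(1) by blast
      moreover have "out_ball S r u \<inter> out_ball S r t = {}" if u: "u \<in> T1" for u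
      proof -
        have "u \<in> T" "t \<in> T" "u \<noteq> t" using u t T1(1) T2(1,2) by auto
        then show ?thesis using P(5) by (simp add: spread_def)
      qed
      ultimately show ?thesis by blast
    qed
    have "\<exists>X'. card X' = card ?X + n \<and> good S r' \<Phi> X'"
    proof (rule Suc.IH)
      show "card T2 = n * k" by (rule T2(4))
      show "str (?X \<union> T2)" using st by (simp add: Un_commute)
      show "?X \<inter> T2 = {}" using hy P(3) T2(1) by blast
      show "indep (?X \<union> T2)"
      proof -
        have "\<forall>x\<in>X \<union> T2. \<forall>z\<in>X \<union> T2. {x, z} \<notin> edges M"
          using P(4) T2(1) unfolding indep_def by blast
        moreover have "\<forall>x\<in>X \<union> T2. {x, h y} \<notin> edges M" using hc'(4) y(1) by blast
        ultimately show ?thesis using no_loop unfolding indep_def by (auto simp: insert_commute)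
      qed
      show "spread S r T2" using spread_subset[OF P(5) T2(1)] .
      show "\<forall>t\<in>T2. \<Psi> t" using P(6) T2(1) by blast
      show "spread S r' ?X" using P(7) y(3) dis unfolding spread_def by (auto simp: Int_commute)
      show "\<forall>x\<in>?X. \<Phi> x" using P(8) y(4) by blast
      show "\<forall>x\<in>?X. \<forall>t\<in>T2. out_ball S r' x \<inter> out_ball S r t = {}"
        using P(9) dis2 subsetD[OF T2(1)] by simp
    qed
    moreover have "card ?X = Suc (card X)" using hy fin(2) by simp
    ultimately show ?case by simp
  qed
  obtain T where T: "card T = n * k" "good S r \<Psi> T" using many by blast
  have "\<exists>X'. card X' = card ({} :: 'a set) + n \<and> good S r' \<Phi> X'"
    using T by (intro step[of T n "{}"]) (auto simp: good_def spread_def)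
  then show ?thesis by simp
qed

text \<open>In a copy with one slot per vertex, out-degree 2 forces an out-edge of each vertex to
  stay inside. The finite copy then contains a directed cycle, and its vertices fade. At radius 0
  fullness and disjointness are trivial, so any independent strong set can serve as the
  base.\<close>

lemma good_fading_0:
  assumes S: "two_orientation M S"
  shows "\<exists>T. card T = n \<and> good S 0 (fades S) T"
proof -
  note o2 = two_orientation_out2[OF S]
  obtain D I where D: "Slot D I" "D \<noteq> {}" "\<forall>y\<in>D. str {y} \<and> card {i \<in> I. fst i = y} = 1"
    using slot_cycle by blast
  have finD: "finite D" "finite I" using slot_finite[OF D(1)] by auto
  show ?thesis
  proof (rule good_from_copies[OF S D(1), where r = 0 and \<Psi> = "\<lambda>_. True"])
    fix T X F h c assume hc: "slot_copy S 0 D I T X F h c"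
    note hc' = slot_copyD(3,5,6,4)[OF hc]
    have succ: "\<exists>w\<in>h ` D. (z, w) \<in> S" if z: "z \<in> h ` D" for z
    proof (rule ccontr)
      assume no: "\<not> (\<exists>w\<in>h ` D. (z, w) \<in> S)"
      obtain x where x: "x \<in> D" "z = h x" using z by blast
      have "S `` {h x} \<subseteq> c ` {i \<in> I. fst i = x}"
      proof
        fix w assume w: "w \<in> S `` {h x}"
        then have "w \<in> c ` I" using hc'(2) x no by blast
        then obtain i where "i \<in> I" "w = c i" by blast
        then show "w \<in> c ` {i \<in> I. fst i = x}" using w hc'(3) x(1) by blast
      qed
      then have "card (S `` {h x}) \<le> card (c ` {i \<in> I. fst i = x})"
        using finD(2) by (intro card_mono) auto
      also have "\<dots> \<le> card {i \<in> I. fst i = x}" using finD(2) by (intro card_image_le) auto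
      finally show False using hc'(4) D(3) x(1) by simp
    qed
    obtain z k where z: "z \<in> h ` D" "(z, z) \<in> S ^^ Suc k"
      using finite_successor_cycle[OF finite_imageI[OF finD(1)] _ succ] D(2) by blast
    then obtain y where y: "y \<in> D" "z = h y" by blast
    have "fades S (h y)" unfolding fades_def using not_full_cycle[OF o2 z(2)] y(2) by blast
    then show "\<exists>y\<in>D. str {y} \<and> full S 0 (h y) \<and> fades S (h y) \<and>
        out_ball S 0 (h y) \<inter> F \<subseteq> (\<Union>t\<in>T. out_ball S 0 t)"
      using D(3) y(1) hc'(1) by (intro bexI[of _ y]) auto
  next
    fix n
    obtain T where "card T = n" "str T" "indep T" using indep_str_sets by blast
    then show "\<exists>T. card T = n \<and> good S 0 (\<lambda>_. True) T"
      using str_finite by (intro exI[of _ T]) (auto simp: good_def spread_def)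
  qed
qed

text \<open>A single vertex with two slots: its successors are roots of disjoint full balls of
  radius \<open>r\<close>, so it is full at radius \<open>r + 1\<close>, and it fades because its
  successors do.\<close>

lemma good_fading:
  assumes S: "two_orientation M S"
  shows "\<exists>T. card T = n \<and> good S r (fades S) T"
proof (induction r arbitrary: n)
  case 0
  show ?case by (rule good_fading_0[OF S])
next
  case (Suc r)
  note o2 = two_orientation_out2[OF S]
  obtain x where x: "str {x}" using str_single by blast
  let ?i = "(x, 0::nat)" and ?j = "(x, 1::nat)"
  show ?case
  proof (rule good_from_copies[OF S slot_single[OF x], where r = r and \<Psi> = "fades S"])
    fix T X F h c assume hc: "slot_copy S r {x} {?i, ?j} T X F h c" and T: "\<forall>t\<in>T. fades S t"
    note hc' = slot_copyD(2-5,7-9)[OF hc] slot_copyD(10)[OF hc T]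
    have "h x \<notin> S `` {h x}" using two_orientation_edge[OF S, of "h x" "h x"] no_loop by blast
    then have sub: "S `` {h x} \<subseteq> {c ?i, c ?j}" using hc'(4) by auto
    have ne: "c ?i \<noteq> c ?j" using hc'(1) by (auto simp: inj_on_def)
    have im: "S `` {h x} = {c ?i, c ?j}"
      using sub hc'(3) ne by (intro card_subset_eq) simp_all
    have "full S (Suc r) (h x)"
    proof (rule full_SucI[OF o2 im ne])
      show "h x \<notin> out_ball S r (c ?i)" "h x \<notin> out_ball S r (c ?j)" using hc'(6) by auto
      show "out_ball S r (c ?i) \<inter> out_ball S r (c ?j) = {}" "full S r (c ?i)" "full S r (c ?j)"
        using hc'(5) ne unfolding spread_def by auto
    qed
    moreover have "fades S (h x)" using fades_pred[OF o2, of "h x" "c ?i"] im hc'(8) by auto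
    moreover have "out_ball S (Suc r) (h x) \<inter> F \<subseteq> (\<Union>t\<in>T. out_ball S r t)"
      unfolding out_ball_Suc im using hc'(2,7) by auto
    ultimately show "\<exists>y\<in>{x}. str {y} \<and> full S (Suc r) (h y) \<and> fades S (h y) \<and>
        out_ball S (Suc r) (h y) \<inter> F \<subseteq> (\<Union>t\<in>T. out_ball S r t)"
      using x by simp
  next
    fix n show "\<exists>T. card T = n \<and> good S r (fades S) T" by (rule Suc.IH)
  qed
qed

text \<open>The unknown orientation of a copy pulled back to \<open>D\<close>. Being a subset of
  \<open>D \<times> D\<close>, it takes finitely many values, which is what the final pigeonhole
  uses.\<close>

definition pattern :: "('a \<times> 'a) set \<Rightarrow> 'a set \<Rightarrow> ('a \<Rightarrow> 'a) \<Rightarrow> ('a \<times> 'a) set" where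
  "pattern S D h = {(x, y). x \<in> D \<and> y \<in> D \<and> (h x, h y) \<in> S}"

lemma slot_copy_out:
  assumes hc: "slot_copy S r D I T X F h c" and "x \<in> D" "D \<subseteq> V"
  shows "S `` {h x} = h ` (pattern S D h `` {x}) \<union> c ` {i \<in> I. fst i = x}"
proof -
  have hc': "S `` {h x} \<subseteq> h ` D \<union> c ` I" "\<forall>i\<in>I. (h x, c i) \<in> S \<longleftrightarrow> fst i = x"
    using slot_copyD(5,6)[OF hc] assms(2) by auto
  show ?thesis using hc' assms(2) unfolding pattern_def by auto
qed

text \<open>A walk from the copy either stays inside it or leaves through a slot after
  \<open>j\<close> inner steps. One more step reaches the root, so a radius of
  \<open>n - Suc j\<close> is left there.\<close>

lemma slot_copy_ball:
  assumes hc: "slot_copy S r D I T X F h c" and "D \<subseteq> V" "y \<in> D"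
  shows "out_ball S n (h y) = h ` out_ball (pattern S D h) n y \<union>
    (\<Union>{out_ball S m (c i) | i m. i \<in> I \<and> (\<exists>j. (y, fst i) \<in> pattern S D h ^^ j \<and> n = Suc j + m)})"
    (is "_ = _ \<union> \<Union>(?Q n y)")
  using assms(3)
proof (induction n arbitrary: y)
  case 0
  then show ?case by simp
next
  case (Suc n)
  let ?O = "pattern S D h"
  have OD: "y' \<in> D" if "(y, y') \<in> ?O" for y' using that unfolding pattern_def by simp
  \<comment> \<open>Balls entered through a slot are split by whether the first step already uses a
    slot at \<open>y\<close> or goes to an inner successor.\<close>
  have Q: "\<Union>(?Q (Suc n) y) = (\<Union>i\<in>{i \<in> I. fst i = y}. out_ball S n (c i)) \<union> (\<Union>y'\<in>?O `` {y}. \<Union>(?Q n y'))"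
  proof
    show "\<Union>(?Q (Suc n) y) \<subseteq> (\<Union>i\<in>{i \<in> I. fst i = y}. out_ball S n (c i)) \<union> (\<Union>y'\<in>?O `` {y}. \<Union>(?Q n y'))"
    proof
      fix z assume "z \<in> \<Union>(?Q (Suc n) y)"
      then obtain i m j where z: "z \<in> out_ball S m (c i)" "i \<in> I" "(y, fst i) \<in> ?O ^^ j" "Suc n = Suc j + m"
        by blast
      show "z \<in> (\<Union>i\<in>{i \<in> I. fst i = y}. out_ball S n (c i)) \<union> (\<Union>y'\<in>?O `` {y}. \<Union>(?Q n y'))"
      proof (cases j)
        case 0
        then have "i \<in> {i \<in> I. fst i = y}" "n = m" using z by auto
        then show ?thesis using z(1) by blast
      next
        case (Suc l)
        then obtain y' where y': "(y, y') \<in> ?O" "(y', fst i) \<in> ?O ^^ l"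
          using z(3) relpow_Suc_D2 by metis
        moreover have "n = Suc l + m" using Suc z(4) by simp
        ultimately have "z \<in> \<Union>(?Q n y')" using z(1,2) by blast
        then show ?thesis using y'(1) by blast
      qed
    qed
    show "(\<Union>i\<in>{i \<in> I. fst i = y}. out_ball S n (c i)) \<union> (\<Union>y'\<in>?O `` {y}. \<Union>(?Q n y')) \<subseteq> \<Union>(?Q (Suc n) y)"
    proof (intro Un_least UN_least)
      fix i assume i: "i \<in> {i \<in> I. fst i = y}"
      then have "(y, fst i) \<in> ?O ^^ 0 \<and> Suc n = Suc 0 + n" by simp
      then show "out_ball S n (c i) \<subseteq> \<Union>(?Q (Suc n) y)" using i by blast
    next
      fix y' assume y': "y' \<in> ?O `` {y}"
      show "\<Union>(?Q n y') \<subseteq> \<Union>(?Q (Suc n) y)"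
      proof
        fix z assume "z \<in> \<Union>(?Q n y')"
        then obtain i m j where z: "z \<in> out_ball S m (c i)" "i \<in> I" "(y', fst i) \<in> ?O ^^ j" "n = Suc j + m"
          by blast
        then have "(y, fst i) \<in> ?O ^^ Suc j" "Suc n = Suc (Suc j) + m"
          using y' by (auto intro: relpow_Suc_I2 simp del: relpow.simps)
        then show "z \<in> \<Union>(?Q (Suc n) y)" using z(1,2) by blast
      qed
    qed
  qed
  have "out_ball S (Suc n) (h y) = insert (h y) ((\<Union>y'\<in>?O `` {y}. out_ball S n (h y')) \<union>
      (\<Union>i\<in>{i \<in> I. fst i = y}. out_ball S n (c i)))"
    unfolding out_ball_Suc slot_copy_out[OF hc Suc.prems assms(2)] by blast
  also have "(\<Union>y'\<in>?O `` {y}. out_ball S n (h y')) =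
      (\<Union>y'\<in>?O `` {y}. h ` out_ball ?O n y' \<union> \<Union>(?Q n y'))"
    using Suc.IH OD by (intro SUP_cong refl) auto
  also have "insert (h y) ((\<Union>y'\<in>?O `` {y}. h ` out_ball ?O n y' \<union> \<Union>(?Q n y')) \<union>
      (\<Union>i\<in>{i \<in> I. fst i = y}. out_ball S n (c i))) =
      h ` out_ball ?O (Suc n) y \<union> \<Union>(?Q (Suc n) y)"
    unfolding Q out_ball_Suc by blast
  finally show ?case .
qed

text \<open>If no slot could be reached, the vertices reachable from \<open>h y\<close> would keep
  both their out-edges among themselves. Counting edges by their tails then contradicts
  \<open>str_sparse\<close>.\<close>

lemma slot_reached:
  assumes S: "two_orientation M S" and hc: "slot_copy S r D I T X F h c"
    and D: "finite D" "D \<subseteq> V" "y \<in> D" and y: "str {h y}"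
  shows "\<exists>i\<in>I. \<exists>j. (y, fst i) \<in> pattern S D h ^^ j"
proof (rule ccontr)
  assume no: "\<not> ?thesis"
  let ?O = "pattern S D h"
  define R where "R = {x. \<exists>k. (y, x) \<in> ?O ^^ k}"
  note hA = slot_copyD(1)[OF hc] and out = slot_copyD(4)[OF hc]
  have RD: "R \<subseteq> D"
  proof
    fix x assume "x \<in> R"
    then obtain k where "(y, x) \<in> ?O ^^ k" unfolding R_def by blast
    then show "x \<in> D" using D(3) by (cases k) (auto simp: pattern_def)
  qed
  have yR: "y \<in> R" unfolding R_def by (auto intro: exI[of _ 0])
  have closed: "S `` {h x} \<subseteq> h ` R" if x: "x \<in> R" for x
  proof -
    obtain k where k: "(y, x) \<in> ?O ^^ k" using x unfolding R_def by blast
    have "{i \<in> I. fst i = x} = {}" using no k by blast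
    moreover have "x' \<in> R" if "x' \<in> ?O `` {x}" for x'
      using k that unfolding R_def by (auto intro!: exI[of _ "Suc k"])
    ultimately show ?thesis using slot_copy_out[OF hc _ D(2), of x] x RD by blast
  qed
  have finR: "finite R" using RD D(1) finite_subset by blast
  let ?R = "h ` R"
  have fin: "finite ?R" using finR by simp
  have RV: "?R \<subseteq> V" using RD D(2) aut_in[OF hA] by blast
  have "S \<inter> (?R \<times> ?R) = Sigma ?R (\<lambda>z. S `` {z})" using closed by auto
  then have "card (S \<inter> (?R \<times> ?R)) = (\<Sum>z\<in>?R. card (S `` {z}))"
    using fin two_orientation_out2[OF S] by (simp add: card_SigmaI out2_def)
  also have "\<dots> = (\<Sum>z\<in>?R. 2)" using out RD by (intro sum.cong) auto
  finally have "card {e \<in> edges M. e \<subseteq> ?R} = 2 * card ?R"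
    using card_orientation_edges[OF S M_graph, of ?R] by simp
  moreover have "card {e \<in> edges M. e \<subseteq> ?R} < 2 * card ?R"
    using str_sparse[OF y fin RV] yR by blast
  ultimately show False by simp
qed

text \<open>With equal patterns the inner parts of the two balls have equal size, and each slot is
  entered with the same remaining radius. In the second copy the slot balls are full and disjoint,
  hence as large as possible; in the first, at least one of them is not full.\<close>

lemma copies_distinguished:
  assumes S: "two_orientation M S" and D: "finite D" "D \<subseteq> V" "finite I" "y \<in> D"
    and hc: "slot_copy S q D I T X F h c" and hc': "slot_copy S r D I T' X' F' h' c'"
    and same: "pattern S D h = pattern S D h'"
    and nf: "\<And>i. i \<in> I \<Longrightarrow> \<not> full S r (c i)" and y: "str {h y}"
  shows "\<exists>n. card (out_ball S n (h y)) \<noteq> card (out_ball S n (h' y))"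
proof -
  note o2 = two_orientation_out2[OF S]
  define O' where "O' = pattern S D h"
  define J where "J = {i \<in> I. \<exists>j. (y, fst i) \<in> O' ^^ j}"
  define d where "d i = (LEAST j. (y, fst i) \<in> O' ^^ j)" for i :: "'a \<times> nat"
  have J: "J \<noteq> {}" "finite J"
  proof -
    show "J \<noteq> {}" using slot_reached[OF S hc D(1,2,4) y] unfolding J_def O'_def by blast
    show "finite J" using D(3) unfolding J_def by simp
  qed
  have d: "(y, fst i) \<in> O' ^^ d i" if "i \<in> J" for i
    using that unfolding J_def d_def by (auto intro: LeastI)
  have d_le: "d i \<le> j" if "(y, fst i) \<in> O' ^^ j" for i j
    unfolding d_def using that by (rule Least_le)
  define d0 where "d0 = Min (d ` J)"
  have d0_le: "d0 \<le> d i" if "i \<in> J" for i unfolding d0_def using J(2) that by simp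
  have "d0 \<in> d ` J" unfolding d0_def using J by simp
  then obtain i0 where i0: "i0 \<in> J" "d i0 = d0" by blast
  \<comment> \<open>The radius at which exactly \<open>r\<close> steps remain at the nearest slot
    \<open>i0\<close>. Elsewhere at most \<open>r\<close> remain, so fullness at \<open>r\<close>
    settles all slots of the second copy.\<close>
  define n where "n = Suc (d0 + r)"
  define K where "K = {i \<in> J. d i < n}"
  define m where "m i = n - Suc (d i)" for i
  have K: "finite K" "K \<subseteq> I" "i0 \<in> K" "m i0 = r"
  proof -
    show "finite K" by (rule finite_subset[OF _ J(2)]) (auto simp: K_def)
    show "K \<subseteq> I" unfolding K_def J_def by blast
    show "i0 \<in> K" "m i0 = r" using i0 by (simp_all add: K_def n_def m_def)
  qed
  have m_le: "m i \<le> r" if "i \<in> K" for i using d0_le[of i] that by (simp add: K_def m_def n_def)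
  have ball: "out_ball S n (f y) = f ` out_ball O' n y \<union> (\<Union>i\<in>K. out_ball S (m i) (b i))"
    if fb: "slot_copy S s D I U Z G f b" and O': "pattern S D f = O'" for s U Z G f b
  proof -
    let ?Q = "{out_ball S m (b i) | i m. i \<in> I \<and> (\<exists>j. (y, fst i) \<in> O' ^^ j \<and> n = Suc j + m)}"
    have "\<Union>?Q = (\<Union>i\<in>K. out_ball S (m i) (b i))"
    proof
      show "\<Union>?Q \<subseteq> (\<Union>i\<in>K. out_ball S (m i) (b i))"
      proof
        fix z assume "z \<in> \<Union>?Q"
        then obtain i l j where z: "z \<in> out_ball S l (b i)" "i \<in> I" "(y, fst i) \<in> O' ^^ j" "n = Suc j + l"
          by blast
        have "i \<in> K" using z d_le[OF z(3)] unfolding K_def J_def by auto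
        moreover have "l \<le> m i" using z(4) d_le[OF z(3)] unfolding m_def by simp
        ultimately show "z \<in> (\<Union>i\<in>K. out_ball S (m i) (b i))"
          using z(1) out_ball_mono[of l "m i" S "b i"] by blast
      qed
      show "(\<Union>i\<in>K. out_ball S (m i) (b i)) \<subseteq> \<Union>?Q"
      proof (rule UN_least)
        fix i assume i: "i \<in> K"
        then have "(y, fst i) \<in> O' ^^ d i \<and> n = Suc (d i) + m i" "i \<in> I"
          using d[of i] K(2) by (auto simp: K_def m_def)
        then show "out_ball S (m i) (b i) \<subseteq> \<Union>?Q" by blast
      qed
    qed
    then show ?thesis using slot_copy_ball[OF fb D(2,4), of n] unfolding O' by simp
  qed
  let ?P = "out_ball O' n y"
  have PD: "?P \<subseteq> D" by (rule out_ball_sub) (use D(4) in \<open>auto simp: O'_def pattern_def\<close>)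
  have finP: "finite ?P" using PD D(1) finite_subset by blast
  have "card (out_ball S n (h y)) \<le> card (h ` ?P) + card (\<Union>i\<in>K. out_ball S (m i) (c i))"
    unfolding ball[OF hc O'_def[symmetric]] by (rule card_Un_le)
  also have "\<dots> \<le> card ?P + (\<Sum>i\<in>K. card (out_ball S (m i) (c i)))"
    using card_image_le[OF finP, of h] card_UN_le[OF K(1), of "\<lambda>i. out_ball S (m i) (c i)"] by linarith
  \<comment> \<open>Each term is at most the full size, and the term for \<open>i0\<close> is
    smaller because its radius is \<open>r\<close>.\<close>
  also have "(\<Sum>i\<in>K. card (out_ball S (m i) (c i))) < (\<Sum>i\<in>K. 2 ^ Suc (m i) - 1)"
  proof (rule sum_strict_mono_ex1[OF K(1)])
    show "\<forall>i\<in>K. card (out_ball S (m i) (c i)) \<le> 2 ^ Suc (m i) - 1"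
      using card_out_ball[OF o2] by blast
    have "card (out_ball S r (c i0)) < 2 ^ Suc r - 1"
      using iffD1[OF not_full_iff[OF o2] nf] K(2,3) by blast
    then show "\<exists>i\<in>K. card (out_ball S (m i) (c i)) < 2 ^ Suc (m i) - 1" using K(3,4) by metis
  qed
  finally have less: "card (out_ball S n (h y)) < card ?P + (\<Sum>i\<in>K. 2 ^ Suc (m i) - 1)" by simp
  note hA = slot_copyD(1,2,7,8)[OF hc']
  have sub: "out_ball S (m i) (c' i) \<subseteq> out_ball S r (c' i)" if "i \<in> K" for i
    using out_ball_mono[OF m_le[OF that]] .
  have "card (\<Union>i\<in>K. out_ball S (m i) (c' i)) = (\<Sum>i\<in>K. card (out_ball S (m i) (c' i)))"
  proof (rule card_UN_disjoint[OF K(1)])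
    show "\<forall>i\<in>K. finite (out_ball S (m i) (c' i))" using finite_out_ball[OF o2] by blast
    show "\<forall>i\<in>K. \<forall>j\<in>K. i \<noteq> j \<longrightarrow> out_ball S (m i) (c' i) \<inter> out_ball S (m j) (c' j) = {}"
    proof (intro ballI impI)
      fix i j assume ij: "i \<in> K" "j \<in> K" "i \<noteq> j"
      then have "c' i \<noteq> c' j" "i \<in> I" "j \<in> I" using hA(2) K(2) by (auto dest: inj_onD)
      then have "out_ball S r (c' i) \<inter> out_ball S r (c' j) = {}" using hA(3) unfolding spread_def by blast
      then show "out_ball S (m i) (c' i) \<inter> out_ball S (m j) (c' j) = {}" using sub ij(1,2) by blast
    qed
  qed
  also have "\<dots> = (\<Sum>i\<in>K. 2 ^ Suc (m i) - 1)"
  proof (intro sum.cong refl)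
    fix i assume i: "i \<in> K"
    then have "full S r (c' i)" using hA(3) K(2) unfolding spread_def by blast
    then have "full S (m i) (c' i)" using not_full_mono[OF o2 _ m_le[OF i]] by blast
    then show "card (out_ball S (m i) (c' i)) = 2 ^ Suc (m i) - 1" unfolding full_def .
  qed
  finally have slots: "card (\<Union>i\<in>K. out_ball S (m i) (c' i)) = (\<Sum>i\<in>K. 2 ^ Suc (m i) - 1)" .
  have "card (out_ball S n (h' y)) = card (h' ` ?P) + card (\<Union>i\<in>K. out_ball S (m i) (c' i))"
    unfolding ball[OF hc' same[symmetric, folded O'_def]]
  proof (rule card_Un_disjoint)
    show "finite (h' ` ?P)" using finP by simp
    show "finite (\<Union>i\<in>K. out_ball S (m i) (c' i))" using K(1) finite_out_ball[OF o2] by blast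
    have "out_ball S (m i) (c' i) \<inter> h' ` D = {}" if "i \<in> K" for i
      using sub[OF that] hA(4) K(2) that by blast
    then show "h' ` ?P \<inter> (\<Union>i\<in>K. out_ball S (m i) (c' i)) = {}" using PD by blast
  qed
  also have "card (h' ` ?P) = card ?P"
    using aut_inj[OF hA(1)] PD D(2) by (intro card_image) blast
  finally have "card (out_ball S n (h' y)) = card ?P + (\<Sum>i\<in>K. 2 ^ Suc (m i) - 1)"
    unfolding slots .
  then show ?thesis using less by (intro exI[of _ n]) simp
qed

text \<open>Recurrence also gives vertices in the orbit of \<open>a\<close>. This makes them strong,
  as \<open>slot_reached\<close> requires; in the class of 2-sparse graphs, for instance, no vertex
  of a complete graph on 5 vertices is strong.\<close>

lemma out_ball_sizes_not_syndetic:
  assumes S: "two_orientation M S"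
    and synd: "\<And>a. a \<in> V \<Longrightarrow> \<exists>D. finite D \<and> D \<subseteq> V \<and>
      (\<forall>h\<in>automorphisms M. \<exists>d\<in>D. (\<exists>g\<in>automorphisms M. h d = g a) \<and>
        (\<forall>n. card (out_ball S n (h d)) = card (out_ball S n a)))"
  shows False
proof -
  note o2 = two_orientation_out2[OF S]
  obtain a where a: "str {a}" using str_single by blast
  then have "a \<in> V" using str_V[of "{a}"] by simp
  obtain D0 where D0: "finite D0" "D0 \<subseteq> V"
    "\<forall>h\<in>automorphisms M. \<exists>d\<in>D0. (\<exists>g\<in>automorphisms M. h d = g a) \<and>
        (\<forall>n. card (out_ball S n (h d)) = card (out_ball S n a))"
    using synd[OF \<open>a \<in> V\<close>] by blast
  obtain D I where DI: "D0 \<subseteq> D" "Slot D I" using slot_cover[OF D0(1,2)] by blast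
  have D: "finite D" "D \<subseteq> V" "finite I" using slot_finite[OF DI(2)] by auto
  have copy: "\<exists>T h c. slot_copy S r D I T {} {} h c \<and> (\<forall>i\<in>I. fades S (c i))" for r
  proof -
    obtain k where k: "\<And>T X F. card T = k \<Longrightarrow> str X \<Longrightarrow>
      str (X \<union> T) \<Longrightarrow> X \<inter> T = {} \<Longrightarrow> indep (X \<union> T) \<Longrightarrow> spread S r T \<Longrightarrow> finite F \<Longrightarrow> F \<subseteq> V \<Longrightarrow>
      \<exists>h c. slot_copy S r D I T X F h c"
      using slot_copies[OF DI(2), of r] S by metis
    obtain T where T: "card T = k" "good S r (fades S) T" using good_fading[OF S] by blast
    then obtain h c where hc: "slot_copy S r D I T {} {} h c"
      using k[of T "{}" "{}"] str_empty unfolding good_def by auto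
    moreover have "\<forall>i\<in>I. fades S (c i)"
      by (rule slot_copyD(10)[OF hc]) (use T(2) in \<open>simp add: good_def\<close>)
    ultimately show ?thesis by blast
  qed
  define P where "P r hc \<longleftrightarrow> (\<exists>T. slot_copy S r D I T {} {} (fst hc) (snd hc)) \<and> (\<forall>i\<in>I. fades S (snd hc i))"
    for r hc
  have "\<forall>r. \<exists>hc. P r hc" unfolding P_def using copy by (metis fst_conv snd_conv)
  then obtain g where g: "\<And>r. P r (g r)" by metis
  have "\<exists>q>r. \<forall>i\<in>I. \<not> full S q (snd (g r) i)" for r
  proof -
    have "\<forall>i\<in>I. \<exists>n. \<not> full S n (snd (g r) i)" using g[of r] unfolding P_def fades_def by blast
    then obtain N where N: "\<forall>i\<in>I. \<not> full S (N i) (snd (g r) i)" by metis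
    \<comment> \<open>\<open>Suc r\<close> makes the sequence increase strictly; inserting 0 gives
      the maximum a meaning when there are no slots.\<close>
    let ?q = "Suc r + Max (insert 0 (N ` I))"
    have "N i \<le> ?q" if "i \<in> I" for i
      using that D(3) by (intro trans_le_add2) auto
    then have "\<forall>i\<in>I. \<not> full S ?q (snd (g r) i)" using N not_full_mono[OF o2] by blast
    then show ?thesis by (intro exI[of _ ?q]) simp
  qed
  then obtain nx where nx: "\<And>r. nx r > r" "\<And>r i. i \<in> I \<Longrightarrow> \<not> full S (nx r) (snd (g r) i)" by metis
  \<comment> \<open>Radii chosen so that the roots of copy \<open>v\<close> are no longer full at
    the radius of any later copy.\<close>
  define \<rho> where "\<rho> v = (nx ^^ v) 0" for v
  have \<rho>_mono: "\<rho> (Suc v) \<le> \<rho> w" if "v < w" for v w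
  proof -
    have "\<rho> v \<le> \<rho> (Suc v)" for v unfolding \<rho>_def using nx(1) by (simp add: less_imp_le)
    then show ?thesis by (rule lift_Suc_mono_le) (use that in simp)
  qed
  define h where "h v = fst (g (\<rho> v))" for v
  define c where "c v = snd (g (\<rho> v))" for v
  have hc: "\<exists>T. slot_copy S (\<rho> v) D I T {} {} (h v) (c v)" for v
    using g[of "\<rho> v"] unfolding P_def h_def c_def by blast
  have hA: "h v \<in> automorphisms M" for v using hc[of v] slot_copyD(1) by (elim exE)
  have nf: "\<not> full S (\<rho> w) (c v i)" if "v < w" "i \<in> I" for v w i
  proof -
    have "\<not> full S (\<rho> (Suc v)) (c v i)" using nx(2)[OF that(2), of "\<rho> v"] by (simp add: c_def \<rho>_def)
    then show ?thesis using not_full_mono[OF o2 _ \<rho>_mono[OF that(1)]] by blast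
  qed
  have "\<forall>v. \<exists>y. y \<in> D \<and> (\<exists>k\<in>automorphisms M. h v y = k a) \<and>
      (\<forall>n. card (out_ball S n (h v y)) = card (out_ball S n a))"
    using D0(3) hA DI(1) by blast
  then obtain y where y: "\<And>v. y v \<in> D" "\<And>v. \<exists>k\<in>automorphisms M. h v (y v) = k a"
    "\<And>v n. card (out_ball S n (h v (y v))) = card (out_ball S n a)"
    by metis
  \<comment> \<open>Pigeonhole on the recurring vertex and the pattern together: two copies then
    have the same sizes at the same vertex of \<open>D\<close>, against
    \<open>copies_distinguished\<close>.\<close>
  let ?\<theta> = "\<lambda>v. (y v, pattern S D (h v))"
  have "range ?\<theta> \<subseteq> D \<times> Pow (D \<times> D)" using y(1) by (auto simp: pattern_def)
  then have "finite (range ?\<theta>)" using D(1) by (meson finite_Pow_iff finite_SigmaI finite_subset)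
  then have "\<not> inj ?\<theta>" using finite_imageD by blast
  then obtain v w where vw: "v \<noteq> w" "?\<theta> v = ?\<theta> w" unfolding inj_def by blast
  have no: False if lt: "v < w" and eq: "?\<theta> v = ?\<theta> w" for v w
  proof -
    obtain T T' where TT: "slot_copy S (\<rho> v) D I T {} {} (h v) (c v)"
      "slot_copy S (\<rho> w) D I T' {} {} (h w) (c w)" using hc by blast
    obtain k where "k \<in> automorphisms M" "h v (y v) = k a" using y(2) by blast
    then have "str {h v (y v)}" using str_aut[OF a, of k] by simp
    then obtain n where "card (out_ball S n (h v (y v))) \<noteq> card (out_ball S n (h w (y v)))"
      using copies_distinguished[OF S D y(1) TT _ nf[OF lt]] eq by auto
    then show False using y(3) eq by simp
  qed
  show False using no[of v w] no[of w v] vw by (metis linorder_neqE_nat)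
qed

end

section \<open>The class of all 2-sparse graphs\<close>

lemma two_orientation_gmap:
  assumes "is_graph B" "inj_on f (verts B)" "two_orientation B S"
  shows "two_orientation (gmap f B) (map_prod f f ` S)"
proof -
  have SB: "S \<subseteq> verts B \<times> verts B" using two_orientation_sub[OF assms(3)] .
  have mem: "(f x, f y) \<in> map_prod f f ` S \<longleftrightarrow> (x, y) \<in> S" if "x \<in> verts B" "y \<in> verts B" for x y
  proof
    assume "(f x, f y) \<in> map_prod f f ` S"
    then obtain u v where uv: "(u, v) \<in> S" "f x = f u" "f y = f v" by auto
    then have "x = u" "y = v" using inj_onD[OF assms(2)] that SB by auto
    then show "(x, y) \<in> S" using uv by simp
  qed force
  have edge: "{f x, f y} \<in> edges (gmap f B) \<longleftrightarrow> {x, y} \<in> edges B" if "x \<in> verts B" "y \<in> verts B" for x y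
    using gmap_edge_iff[OF assms(1,2) _ that, of "gmap f B"] induced_gmap[OF assms(1,2) order_refl]
      induced_verts[OF assms(1)] by simp
  have edge_im: "\<exists>x\<in>verts B. \<exists>y\<in>verts B. u = f x \<and> v = f y" if uv: "{u, v} \<in> edges (gmap f B)" for u v
  proof -
    obtain e where e: "e \<in> edges B" "{u, v} = f ` e" using uv by auto
    then have "e \<subseteq> verts B" using assms(1) by (simp add: is_graph_def)
    moreover have "u \<in> f ` e" "v \<in> f ` e" using e(2) by auto
    ultimately show ?thesis by blast
  qed
  show ?thesis
    unfolding two_orientation_def
  proof (intro conjI ballI allI impI)
    show "map_prod f f ` S \<subseteq> verts (gmap f B) \<times> verts (gmap f B)" using SB by auto
  next
    fix p assume "p \<in> map_prod f f ` S"
    then obtain x y where xy: "(x, y) \<in> S" "p = (f x, f y)" by auto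
    then have "{f x, f y} \<in> edges (gmap f B)"
      using edge[of x y] two_orientation_edge[OF assms(3) xy(1)] SB by auto
    then show "case p of (x, y) \<Rightarrow> {x, y} \<in> edges (gmap f B)" using xy(2) by simp
  next
    fix u v assume uv: "{u, v} \<in> edges (gmap f B)"
    then obtain x y where xy: "x \<in> verts B" "y \<in> verts B" "u = f x" "v = f y"
      using edge_im by blast
    then have "{x, y} \<in> edges B" using edge uv by simp
    then show "((u, v) \<in> map_prod f f ` S) \<noteq> ((v, u) \<in> map_prod f f ` S)"
      using mem[OF xy(1,2)] mem[OF xy(2,1)] two_orientation_dir[OF assms(3), of x y] xy(3,4) by simp
  next
    fix u assume "u \<in> verts (gmap f B)"
    then obtain x where x: "x \<in> verts B" "u = f x" by auto
    have "{v. (u, v) \<in> map_prod f f ` S} = f ` (S `` {x})"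
    proof
      show "{v. (u, v) \<in> map_prod f f ` S} \<subseteq> f ` (S `` {x})"
      proof
        fix v assume "v \<in> {v. (u, v) \<in> map_prod f f ` S}"
        then have v: "(f x, v) \<in> map_prod f f ` S" using x(2) by simp
        then obtain w y where wy: "(w, y) \<in> S" "v = f y" by auto
        then have "y \<in> verts B" using SB by auto
        then have "(x, y) \<in> S" using mem[OF x(1)] v wy(2) by simp
        then show "v \<in> f ` (S `` {x})" using wy(2) by simp
      qed
      show "f ` (S `` {x}) \<subseteq> {v. (u, v) \<in> map_prod f f ` S}" using x(2) by force
    qed
    moreover have "finite (S `` {x})" "card (S `` {x}) \<le> 2"
      using two_orientation_out2[OF assms(3)] unfolding out2_def by auto
    ultimately show "finite {v. (u, v) \<in> map_prod f f ` S}" "card {v. (u, v) \<in> map_prod f f ` S} \<le> 2"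
      using card_image_le[of "S `` {x}" f] by auto
  qed
qed

lemma two_orientation_induced:
  assumes "two_orientation G S" "W \<subseteq> verts G"
  shows "two_orientation (induced G W) (S \<inter> (W \<times> W))"
  unfolding two_orientation_def
proof (intro conjI ballI allI impI)
  fix p assume "p \<in> S \<inter> (W \<times> W)"
  then show "case p of (x, y) \<Rightarrow> {x, y} \<in> edges (induced G W)"
    using two_orientation_edge[OF assms(1)] by auto
next
  fix x y assume "{x, y} \<in> edges (induced G W)"
  then show "((x, y) \<in> S \<inter> (W \<times> W)) \<noteq> ((y, x) \<in> S \<inter> (W \<times> W))"
    using two_orientation_dir[OF assms(1), of x y] by auto
next
  fix x
  have o: "finite (S `` {x})" "card (S `` {x}) \<le> 2"
    using two_orientation_out2[OF assms(1)] unfolding out2_def by auto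
  have sub: "{y. (x, y) \<in> S \<inter> (W \<times> W)} \<subseteq> S `` {x}" by auto
  show "finite {y. (x, y) \<in> S \<inter> (W \<times> W)}" using finite_subset[OF sub o(1)] .
  show "card {y. (x, y) \<in> S \<inter> (W \<times> W)} \<le> 2" using card_mono[OF o(1) sub] o(2) by simp
qed simp

text \<open>Inside \<open>W\<close> the arcs of \<open>S2\<close> are replaced by those of
  \<open>S1\<close>. As arcs of \<open>S2\<close> that start in \<open>W\<close> end in
  \<open>W\<close>, a vertex of \<open>G1\<close> keeps no arc of \<open>S2\<close>, and degrees
  stay at most 2. The same gluing proves amalgamation and transitivity.\<close>

lemma two_orientation_glue:
  assumes G: "is_graph G1" "is_graph G2" and W: "W = verts G1 \<inter> verts G2"
    "\<And>e. e \<subseteq> W \<Longrightarrow> e \<in> edges G1 \<longleftrightarrow> e \<in> edges G2"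
    and S: "two_orientation G1 S1" "two_orientation G2 S2"
    and closed: "\<And>x y. (x, y) \<in> S2 \<Longrightarrow> x \<in> W \<Longrightarrow> y \<in> W"
  shows "two_orientation (free_amalgam G1 G2) (S1 \<union> (S2 - W \<times> W))"
proof -
  have sub: "S1 \<subseteq> verts G1 \<times> verts G1" "S2 \<subseteq> verts G2 \<times> verts G2"
    using two_orientation_sub S by blast+
  have eV: "x \<in> verts G1" "y \<in> verts G1" if "{x, y} \<in> edges G1" for x y
    using that G(1) unfolding is_graph_def by auto
  have eV2: "x \<in> verts G2" "y \<in> verts G2" if "{x, y} \<in> edges G2" for x y
    using that G(2) unfolding is_graph_def by auto
  show ?thesis
    unfolding two_orientation_def
  proof (intro conjI ballI allI impI)
    show "S1 \<union> (S2 - W \<times> W) \<subseteq> verts (free_amalgam G1 G2) \<times> verts (free_amalgam G1 G2)"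
      using sub unfolding free_amalgam_def by auto
  next
    fix p assume "p \<in> S1 \<union> (S2 - W \<times> W)"
    then show "case p of (x, y) \<Rightarrow> {x, y} \<in> edges (free_amalgam G1 G2)"
      using two_orientation_edge[OF S(1)] two_orientation_edge[OF S(2)]
      unfolding free_amalgam_def by auto
  next
    fix x y assume "{x, y} \<in> edges (free_amalgam G1 G2)"
    then consider "{x, y} \<in> edges G1" | "{x, y} \<in> edges G2" "\<not> {x, y} \<subseteq> W"
      using W(2)[of "{x, y}"] unfolding free_amalgam_def by auto
    then show "((x, y) \<in> S1 \<union> (S2 - W \<times> W)) \<noteq> ((y, x) \<in> S1 \<union> (S2 - W \<times> W))"
    proof cases
      case 1
      have "x \<in> verts G1" "y \<in> verts G1" using eV[OF 1] .
      then have "(x, y) \<notin> S2 - W \<times> W" "(y, x) \<notin> S2 - W \<times> W" using sub(2) W(1) by auto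
      then show ?thesis using two_orientation_dir[OF S(1) 1] by auto
    next
      case 2
      have "x \<in> verts G2" "y \<in> verts G2" using eV2[OF 2(1)] .
      then have "(x, y) \<notin> S1" "(y, x) \<notin> S1" using sub(1) W(1) 2(2) by auto
      moreover have "(x, y) \<notin> W \<times> W" "(y, x) \<notin> W \<times> W" using 2(2) by auto
      ultimately show ?thesis using two_orientation_dir[OF S(2) 2(1)] by auto
    qed
  next
    fix x
    have o: "finite (S1 `` {x})" "card (S1 `` {x}) \<le> 2" "finite (S2 `` {x})" "card (S2 `` {x}) \<le> 2"
      using two_orientation_out2[OF S(1)] two_orientation_out2[OF S(2)] unfolding out2_def by auto
    have "{y. (x, y) \<in> S1 \<union> (S2 - W \<times> W)} \<subseteq> S1 `` {x} \<or> {y. (x, y) \<in> S1 \<union> (S2 - W \<times> W)} \<subseteq> S2 `` {x}"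
    proof (cases "x \<in> verts G1")
      case True
      have "(x, y) \<notin> S2 - W \<times> W" for y
        using True closed[of x y] sub(2) W(1) by auto
      then show ?thesis by auto
    next
      case False
      then have "(x, y) \<notin> S1" for y using sub(1) by auto
      then show ?thesis by auto
    qed
    then show "finite {y. (x, y) \<in> S1 \<union> (S2 - W \<times> W)}" "card {y. (x, y) \<in> S1 \<union> (S2 - W \<times> W)} \<le> 2"
      by (elim disjE; use o card_mono finite_subset le_trans in meson)+
  qed
qed

lemma finite_edges_within: "finite W \<Longrightarrow> finite {e \<in> E. e \<subseteq> W}"
  by (rule finite_subset[of _ "Pow W"]) auto

text \<open>The easy direction of Hakimi's theorem: edges within \<open>W\<close> are counted at
  their tails.\<close>

lemma two_orientation_sparse:
  assumes "two_orientation G S" "is_graph G"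
  shows "two_sparse G"
  unfolding two_sparse_def
proof (intro allI impI)
  fix W assume W: "finite W \<and> W \<subseteq> verts G"
  have "card (S \<inter> (W \<times> W)) \<le> card (Sigma W (\<lambda>x. S `` {x}))"
    using W two_orientation_out2[OF assms(1)] by (intro card_mono finite_SigmaI) (auto simp: out2_def)
  also have "\<dots> = (\<Sum>x\<in>W. card (S `` {x}))"
    using W two_orientation_out2[OF assms(1)] by (intro card_SigmaI) (auto simp: out2_def)
  also have "\<dots> \<le> card W * 2"
    using sum_bounded_above[of W "\<lambda>x. card (S `` {x})" 2] two_orientation_out2[OF assms(1)]
    by (simp add: out2_def)
  finally show "card (edges (induced G W)) \<le> 2 * card W"
    using card_orientation_edges[OF assms, of W] by simp
qed

lemma subgraph_gmap:
  assumes "subgraph A B" "is_graph B" "inj_on f (verts B)"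
  shows "subgraph (gmap f A) (gmap f B)"
  using assms induced_gmap[OF assms(2,3), of "verts A"] unfolding subgraph_def
  by (metis image_mono verts_gmap)

lemma subgraph_induced:
  assumes "subgraph A B" "W \<subseteq> verts B"
  shows "subgraph (induced A (verts A \<inter> W)) (induced B W)"
proof -
  have "A = induced B (verts A)" using assms(1) unfolding subgraph_def by simp
  then have "induced A (verts A \<inter> W) = induced B (verts A \<inter> W)"
    using induced_induced[of "verts A \<inter> W" "verts A" B] by simp
  then show ?thesis unfolding subgraph_def using induced_induced[of "verts A \<inter> W" W B] by simp
qed

lemma subgraph_trans:
  assumes "subgraph A B" "subgraph B D"
  shows "subgraph A D"
proof -
  have "A = induced B (verts A)" "B = induced D (verts B)" "verts A \<subseteq> verts B" "verts B \<subseteq> verts D"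
    using assms unfolding subgraph_def by auto
  then show ?thesis unfolding subgraph_def using induced_induced[of "verts A" "verts B" D] by simp
qed

lemma subgraph_edge: "subgraph A B \<Longrightarrow> e \<subseteq> verts A \<Longrightarrow> e \<in> edges A \<longleftrightarrow> e \<in> edges B"
  unfolding subgraph_def by (metis (mono_tags, lifting) edges_induced mem_Collect_eq)

lemma is_graph_free_amalgam: "is_graph B1 \<Longrightarrow> is_graph B2 \<Longrightarrow> is_graph (free_amalgam B1 B2)"
  unfolding is_graph_def free_amalgam_def by auto

lemma subgraph_free_amalgam:
  assumes "is_graph B1" "is_graph B2" "subgraph A B1" "subgraph A B2" "verts B1 \<inter> verts B2 = verts A"
  shows "subgraph B1 (free_amalgam B1 B2)"
proof -
  have "B1 = induced (free_amalgam B1 B2) (verts B1)"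
  proof (rule graph_eqI)
    have "e \<in> edges B1" if e: "e \<in> edges B2" "e \<subseteq> verts B1" for e
    proof -
      have "e \<subseteq> verts A" using e assms(2,5) unfolding is_graph_def by auto
      then show ?thesis using e(1) subgraph_edge[OF assms(3)] subgraph_edge[OF assms(4)] by simp
    qed
    then show "edges B1 = edges (induced (free_amalgam B1 B2) (verts B1))"
      using assms(1) unfolding is_graph_def free_amalgam_def by auto
  qed simp
  then show ?thesis unfolding subgraph_def by (simp add: free_amalgam_def)
qed

lemma free_amalgam_commute: "free_amalgam B1 B2 = free_amalgam B2 B1"
  by (simp add: free_amalgam_def Un_commute)

lemma leq_s_free_amalgam:
  assumes "is_graph B1" "is_graph B2" "leq_s A B1" "leq_s A B2" "verts B1 \<inter> verts B2 = verts A"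
  shows "leq_s B1 (free_amalgam B1 B2)"
proof -
  have sg: "subgraph A B1" "subgraph A B2" using assms(3,4) unfolding leq_s_def by auto
  obtain S1 where S1: "two_orientation B1 S1" using assms(3) unfolding leq_s_def by auto
  obtain S2 where S2: "two_orientation B2 S2" "\<not> (\<exists>(x, y)\<in>S2. x \<in> verts A \<and> y \<notin> verts A)"
    using assms(4) unfolding leq_s_def by auto
  let ?S = "S1 \<union> (S2 - verts A \<times> verts A)"
  have "two_orientation (free_amalgam B1 B2) ?S"
    using assms(5) subgraph_edge[OF sg(1)] subgraph_edge[OF sg(2)] S2(2)
    by (intro two_orientation_glue[OF assms(1,2) _ _ S1 S2(1)]) auto
  moreover have "\<not> (\<exists>(x, y)\<in>?S. x \<in> verts B1 \<and> y \<notin> verts B1)"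
    using two_orientation_sub[OF S1] two_orientation_sub[OF S2(1)] S2(2) assms(5) by auto
  ultimately show ?thesis
    unfolding leq_s_def using subgraph_free_amalgam[OF assms(1,2) sg assms(5)] by blast
qed

lemma leq_s_trans:
  assumes "leq_s A B" "leq_s B D" "is_graph D"
  shows "leq_s A D"
proof -
  have sg: "subgraph A B" "subgraph B D" using assms unfolding leq_s_def by auto
  have BD: "verts B \<subseteq> verts D" "B = induced D (verts B)" using sg(2) unfolding subgraph_def by auto
  have B: "is_graph B" using is_graph_induced[OF assms(3), of "verts B"] BD(2) by simp
  obtain S1 where S1: "two_orientation B S1" "\<not> (\<exists>(x, y)\<in>S1. x \<in> verts A \<and> y \<notin> verts A)"
    using assms(1) unfolding leq_s_def by auto
  obtain S2 where S2: "two_orientation D S2" "\<not> (\<exists>(x, y)\<in>S2. x \<in> verts B \<and> y \<notin> verts B)"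
    using assms(2) unfolding leq_s_def by auto
  let ?S = "S1 \<union> (S2 - verts B \<times> verts B)"
  \<comment> \<open>The amalgam of \<open>B\<close> with its own extension \<open>D\<close> is
    \<open>D\<close>, so the gluing here reorients \<open>D\<close> inside \<open>B\<close>.\<close>
  have "two_orientation (free_amalgam B D) ?S"
    using BD(1) subgraph_edge[OF sg(2)] S2(2)
    by (intro two_orientation_glue[OF B assms(3) _ _ S1(1) S2(1)]) auto
  moreover have "edges B \<subseteq> edges D" using arg_cong[OF BD(2), of edges] by auto
  then have "free_amalgam B D = D"
    using BD(1) by (intro graph_eqI) (auto simp: free_amalgam_def)
  moreover have "\<not> (\<exists>(x, y)\<in>?S. x \<in> verts A \<and> y \<notin> verts A)"
    using S1(2) S2(2) sg(1) unfolding subgraph_def by auto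
  ultimately show ?thesis unfolding leq_s_def using subgraph_trans[OF sg] by auto
qed

lemma class_C0D: "B \<in> class_C0 \<Longrightarrow> is_graph B \<and> finite (verts B) \<and> two_sparse B"
  by (simp add: class_C0_def)

lemma two_sparse_gmap:
  assumes "is_graph B" "two_sparse B" "inj_on f (verts B)"
  shows "two_sparse (gmap f B)"
  unfolding two_sparse_def
proof (intro allI impI)
  fix W assume W: "finite W \<and> W \<subseteq> verts (gmap f B)"
  then obtain U where U: "U \<subseteq> verts B" "W = f ` U" by (metis subset_imageE verts_gmap)
  have inj: "inj_on f U" using inj_on_subset[OF assms(3) U(1)] .
  have fU: "finite U" using W U(2) finite_imageD[OF _ inj] by simp
  have "card (edges (induced (gmap f B) W)) \<le> card (edges (induced B U))"
    unfolding U(2) induced_gmap[OF assms(1,3) U(1)] edges_gmap edges_induced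
    by (rule card_image_le[OF finite_edges_within[OF fU]])
  also have "\<dots> \<le> 2 * card U" using assms(2) fU U(1) unfolding two_sparse_def by blast
  finally show "card (edges (induced (gmap f B) W)) \<le> 2 * card W"
    unfolding U(2) card_image[OF inj] .
qed

lemma class_C0_gmap:
  assumes "B \<in> class_C0" "inj_on f (verts B)"
  shows "gmap f B \<in> class_C0"
proof -
  have B: "is_graph B" "finite (verts B)" "two_sparse B" using class_C0D[OF assms(1)] by auto
  have "is_graph (gmap f B)"
    unfolding is_graph_def
  proof
    fix e assume "e \<in> edges (gmap f B)"
    then obtain d where d: "d \<in> edges B" "e = f ` d" by auto
    then have "d \<subseteq> verts B" "card d = 2" using B(1) by (auto simp: is_graph_def)
    then show "e \<subseteq> verts (gmap f B) \<and> card e = 2"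
      using d(2) card_image[OF inj_on_subset[OF assms(2)], of d] by auto
  qed
  then show ?thesis using B two_sparse_gmap[OF B(1,3) assms(2)] by (simp add: class_C0_def)
qed

lemma class_C0_induced:
  assumes "B \<in> class_C0" "W \<subseteq> verts B"
  shows "induced B W \<in> class_C0"
proof -
  have B: "is_graph B" "finite (verts B)" "two_sparse B" using class_C0D[OF assms(1)] by auto
  have "two_sparse (induced B W)"
    unfolding two_sparse_def
  proof (intro allI impI)
    fix U assume U: "finite U \<and> U \<subseteq> verts (induced B W)"
    then have "card (edges (induced B U)) \<le> 2 * card U"
      using B(3) assms(2) unfolding two_sparse_def by auto
    then show "card (edges (induced (induced B W) U)) \<le> 2 * card U"
      using induced_induced[of U W B] U by simp
  qed
  then show ?thesis
    using is_graph_induced[OF B(1)] B(2) assms(2) by (auto simp: class_C0_def intro: finite_subset)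
qed

lemma free_amalgamation_C0: "free_amalgamation_class (class_C0 :: 'a graph set) leq_s"
  unfolding free_amalgamation_class_def
proof (intro ballI impI)
  fix A B1 B2 :: "'a graph"
  assume "A \<in> class_C0" and B: "B1 \<in> class_C0" "B2 \<in> class_C0"
    and h: "leq_s A B1 \<and> leq_s A B2 \<and> verts B1 \<inter> verts B2 = verts A"
  have g: "is_graph B1" "is_graph B2" "finite (verts B1)" "finite (verts B2)"
    using class_C0D[OF B(1)] class_C0D[OF B(2)] by auto
  have l1: "leq_s B1 (free_amalgam B1 B2)" using leq_s_free_amalgam[OF g(1,2), of A] h by blast
  have "leq_s B2 (free_amalgam B2 B1)" using leq_s_free_amalgam[OF g(2,1), of A] h by (simp add: Int_commute)
  then have l2: "leq_s B2 (free_amalgam B1 B2)" by (simp add: free_amalgam_commute)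
  obtain S where "two_orientation (free_amalgam B1 B2) S" using l1 unfolding leq_s_def by auto
  then have "two_sparse (free_amalgam B1 B2)"
    by (rule two_orientation_sparse[OF _ is_graph_free_amalgam[OF g(1,2)]])
  then have "free_amalgam B1 B2 \<in> class_C0"
    using is_graph_free_amalgam[OF g(1,2)] g(3,4) by (simp add: class_C0_def) (simp add: free_amalgam_def)
  then show "free_amalgam B1 B2 \<in> class_C0 \<and> leq_s B1 (free_amalgam B1 B2) \<and> leq_s B2 (free_amalgam B1 B2)"
    using l1 l2 by simp
qed

lemma amalgamation_class_C0: "amalgamation_class (class_C0 :: 'a::infinite graph set) leq_s"
proof
  fix A B D :: "'a graph" and f :: "'a \<Rightarrow> 'a" and W
  show "B \<in> class_C0 \<Longrightarrow> is_graph B" "B \<in> class_C0 \<Longrightarrow> finite (verts B)"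
    using class_C0D by blast+
  show "B \<in> class_C0 \<Longrightarrow> inj_on f (verts B) \<Longrightarrow> gmap f B \<in> class_C0" by (rule class_C0_gmap)
  show "B \<in> class_C0 \<Longrightarrow> W \<subseteq> verts B \<Longrightarrow> induced B W \<in> class_C0" by (rule class_C0_induced)
  show "leq_s A B \<Longrightarrow> subgraph A B" unfolding leq_s_def by blast
  show "leq_s A B \<Longrightarrow> leq_s B D \<Longrightarrow> D \<in> class_C0 \<Longrightarrow> leq_s A D"
    using leq_s_trans[of A B D] class_C0D[of D] by simp
  show "free_amalgamation_class (class_C0 :: 'a graph set) leq_s" by (rule free_amalgamation_C0)
  show "leq_s (gmap f A) (gmap f B)" if AB: "leq_s A B" "B \<in> class_C0" "inj_on f (verts B)"
  proof -
    have g: "is_graph B" using class_C0D AB(2) by blast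
    obtain S where S: "two_orientation B S" "\<not> (\<exists>(x, y)\<in>S. x \<in> verts A \<and> y \<notin> verts A)" "subgraph A B"
      using AB(1) unfolding leq_s_def by auto
    have AV: "verts A \<subseteq> verts B" using S(3) unfolding subgraph_def by simp
    have "v \<in> f ` verts A" if uv: "(u, v) \<in> map_prod f f ` S" "u \<in> f ` verts A" for u v
    proof -
      obtain x y where xy: "(x, y) \<in> S" "u = f x" "v = f y" using uv(1) by auto
      obtain x' where x': "x' \<in> verts A" "u = f x'" using uv(2) by auto
      have "x = x'"
        using inj_onD[OF AB(3), of x x'] xy x' AV two_orientation_sub[OF S(1)] by auto
      then show ?thesis using S(2) xy x'(1) by auto
    qed
    then have "\<not> (\<exists>(x, y)\<in>map_prod f f ` S. x \<in> verts (gmap f A) \<and> y \<notin> verts (gmap f A))"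
      unfolding verts_gmap case_prod_beta by (metis prod.collapse)
    then show ?thesis
      unfolding leq_s_def using subgraph_gmap[OF S(3) g AB(3)] two_orientation_gmap[OF g AB(3) S(1)] by blast
  qed
  show "leq_s (induced A (verts A \<inter> W)) (induced B W)" if AB: "leq_s A B" "B \<in> class_C0" "W \<subseteq> verts B"
  proof -
    obtain S where S: "two_orientation B S" "\<not> (\<exists>(x, y)\<in>S. x \<in> verts A \<and> y \<notin> verts A)" "subgraph A B"
      using AB(1) unfolding leq_s_def by auto
    have "\<not> (\<exists>(x, y)\<in>S \<inter> (W \<times> W). x \<in> verts A \<inter> W \<and> y \<notin> verts A \<inter> W)" using S(2) by auto
    then show ?thesis
      unfolding leq_s_def using subgraph_induced[OF S(3) AB(3)] two_orientation_induced[OF S(1) AB(3)]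
      by auto
  qed
  show "leq_s (induced B {}) B" if AB: "leq_s A B" "B \<in> class_C0"
  proof -
    obtain S where S: "two_orientation B S" using AB(1) unfolding leq_s_def by auto
    then show ?thesis unfolding leq_s_def subgraph_def by auto
  qed
qed

section \<open>Leaves, placing copies on a base, and counting out-edges\<close>

context limit_graph
begin

text \<open>Holds in both settings for different reasons: the edge of the leaf can be directed into
  \<open>W\<close>, or an edge can be amalgamated freely over one of its strong ends.\<close>

definition leafy :: bool where
  "leafy \<longleftrightarrow> (\<forall>W u. str W \<and> u \<in> W \<longrightarrow>
    (\<exists>l\<in>V - W. str (insert l W) \<and> (\<forall>w\<in>W. {l, w} \<in> edges M \<longleftrightarrow> w = u)))"

lemma leaves:
  assumes leafy: leafy and K: "str K" and I: "finite I" "fst ` I \<subseteq> K"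
  shows "\<exists>l. inj_on l I \<and> l ` I \<inter> K = {} \<and> str (K \<union> l ` I) \<and>
    (\<forall>i\<in>I. \<forall>v\<in>K \<union> l ` I. {l i, v} \<in> edges M \<longleftrightarrow> v = fst i)"
  using I
proof (induction I rule: finite_induct)
  case empty
  then show ?case using K by simp
next
  case (insert j I)
  then obtain l where l: "inj_on l I" "l ` I \<inter> K = {}" "str (K \<union> l ` I)"
    "\<forall>i\<in>I. \<forall>v\<in>K \<union> l ` I. {l i, v} \<in> edges M \<longleftrightarrow> v = fst i" by auto
  have j: "fst j \<in> K" "fst j \<in> K \<union> l ` I" using insert.prems by auto
  obtain x where x: "x \<in> V - (K \<union> l ` I)" "str (insert x (K \<union> l ` I))"
    "\<forall>w\<in>K \<union> l ` I. {x, w} \<in> edges M \<longleftrightarrow> w = fst j"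
    using leafy l(3) j(2) unfolding leafy_def by blast
  let ?l = "l(j := x)"
  have im: "?l ` insert j I = insert x (l ` I)" "\<And>i. i \<in> I \<Longrightarrow> ?l i = l i" using insert.hyps(2) by auto
  show ?case
  proof (intro exI conjI)
    show "inj_on ?l (insert j I)" using l(1) x(1) insert.hyps(2) by (auto simp: inj_on_def)
    show "?l ` insert j I \<inter> K = {}" unfolding im using l(2) x(1) by auto
    show "str (K \<union> ?l ` insert j I)" unfolding im using x(2) by simp
    show "\<forall>i\<in>insert j I. \<forall>v\<in>K \<union> ?l ` insert j I. {?l i, v} \<in> edges M \<longleftrightarrow> v = fst i"
    proof (intro ballI)
      fix i v assume i: "i \<in> insert j I" and v: "v \<in> K \<union> ?l ` insert j I"
      have v': "v = x \<or> v \<in> K \<union> l ` I" using v im(1) by auto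
      show "{?l i, v} \<in> edges M \<longleftrightarrow> v = fst i"
      proof (cases "i = j")
        case True
        then show ?thesis using v' x no_loop j by auto
      next
        case False
        then have i': "i \<in> I" "?l i = l i" using i by auto
        have ne: "l i \<noteq> fst j" "x \<noteq> fst i" using l(2) j(1) i'(1) x(1) insert.prems by auto
        have "{l i, x} \<notin> edges M" using x(3) i'(1) ne(1) by (auto simp: insert_commute)
        then show ?thesis using v' l(4) i' ne by auto
      qed
    qed
  qed
qed

lemma place:
  assumes K: "str (K \<union> L)" "str L" "indep L" "L \<inter> K = {}"
    and T: "str T" "indep T" "card T = card L"
    and X: "str X" "str (X \<union> T)" "X \<inter> T = {}" "indep (X \<union> T)"
    and Z: "finite Z" "Z \<subseteq> V"
  shows "\<exists>H\<in>automorphisms M. H ` L = T \<and> H ` K \<inter> (Z \<union> X \<union> T) = {} \<and>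
    (\<forall>x\<in>X. \<forall>y\<in>H ` K. {x, y} \<notin> edges M) \<and> (\<forall>K'. K' \<subseteq> K \<and> str K' \<longrightarrow> str (X \<union> H ` K'))"
proof -
  have "finite (X \<union> T \<union> Z)" "X \<union> T \<union> Z \<subseteq> V" using str_finite[OF X(2)] str_V[OF X(2)] Z by auto
  from str_cover[OF this] obtain W0 where W0: "X \<union> T \<union> Z \<subseteq> W0" "str W0" by blast
  obtain \<phi> where \<phi>: "bij_betw \<phi> L T"
    using finite_same_card_bij[OF str_finite[OF K(2)] str_finite[OF T(1)]] T(3) by auto
  have im: "\<phi> ` L = T" using \<phi> by (simp add: bij_betw_def)
  have "piso L \<phi>"
  proof (rule pisoI[OF K(2)])
    show "inj_on \<phi> L" using \<phi> by (simp add: bij_betw_def)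
    show "str (\<phi> ` L)" using im T(1) by simp
    fix x y assume "x \<in> L" "y \<in> L"
    then show "{x, y} \<in> edges M \<longleftrightarrow> {\<phi> x, \<phi> y} \<in> edges M"
      using K(3) T(2) im unfolding indep_def by blast
  qed
  then obtain H where H: "H \<in> automorphisms M" "\<forall>x\<in>L. H x = \<phi> x" "H ` (K \<union> L) \<inter> W0 = T"
    "free (H ` (K \<union> L)) W0" "str (H ` (K \<union> L) \<union> W0)"
    using extend[of L \<phi> "K \<union> L" W0] K(1) W0 im by auto
  have HL: "H ` L = T" using H(2) im by simp
  have KV: "K \<union> L \<subseteq> V" using str_V[OF K(1)] .
  have "H ` K \<inter> H ` L = H ` (K \<inter> L)"
    by (rule inj_on_image_Int[OF aut_inj[OF H(1) KV], symmetric]) auto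
  then have HKT: "H ` K \<inter> T = {}" using K(4) HL by (simp add: Int_commute)
  have HK0: "H ` K \<inter> (Z \<union> X \<union> T) = {}"
  proof -
    have "H ` K \<inter> W0 \<subseteq> T" using H(3) by blast
    then show ?thesis using HKT W0(1) by blast
  qed
  have sHK: "str (H ` (K \<union> L))" using str_aut[OF K(1) H(1)] .
  have XH: "X \<inter> H ` (K \<union> L) = {}" using HK0 HL X(3) by (auto simp: image_Un)
  have noedge: "{x, y} \<notin> edges M" if x: "x \<in> X" and y: "y \<in> H ` (K \<union> L)" for x y
  proof
    assume e: "{x, y} \<in> edges M"
    have "x \<in> W0" "x \<notin> H ` (K \<union> L)" using x W0(1) XH by auto
    then have "{x, y} \<subseteq> W0" using H(4) e y unfolding free_def by auto
    then have "y \<in> T" using H(3) y by auto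
    then show False using X(4) x e unfolding indep_def by auto
  qed
  have "str (H ` (K \<union> L) \<union> (X \<union> T))"
  proof (rule str_free_union[OF H(5) _ H(4)])
    show "str (H ` (K \<union> L) \<inter> W0)" using H(3) T(1) by simp
    show "str (H ` (K \<union> L))" by (rule sHK)
    show "str (X \<union> T)" by (rule X(2))
  qed (use H(3) W0(1) in auto)
  moreover have "H ` (K \<union> L) \<union> (X \<union> T) = X \<union> H ` (K \<union> L)" using HL by auto
  ultimately have big: "str (X \<union> H ` (K \<union> L))" by simp
  have fr: "free X (H ` (K \<union> L))" by (rule freeI) (rule noedge)
  have "str (X \<union> H ` K')" if K': "K' \<subseteq> K" "str K'" for K'
  proof (rule str_free_union[OF big _ fr X(1)])
    show "str (X \<inter> H ` (K \<union> L))" using XH str_empty by simp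
    show "str (H ` K')" using str_aut[OF K'(2) H(1)] .
  qed (use K'(1) XH in auto)
  then show ?thesis using H(1) HL HK0 noedge by blast
qed

text \<open>Every inner edge of the copy is counted once, at its tail, so the orientation inside the
  copy does not affect the total. The difference from \<open>2 * card D\<close> is the number of
  out-edges not controlled.\<close>

lemma out_degree_sum:
  assumes S: "two_orientation M S" and h: "h \<in> automorphisms M" and D: "finite D" "D \<subseteq> V"
    and T: "h ` D \<inter> T = {}"
  shows "(\<Sum>x\<in>D. card (S `` {h x} \<inter> (h ` D \<union> T))) =
    card {e \<in> edges M. e \<subseteq> D} + (\<Sum>x\<in>D. card (S `` {h x} \<inter> T))"
proof -
  have fo: "finite (S `` {x})" for x using two_orientation_out2[OF S] by (simp add: out2_def)
  have inj: "inj_on h D" using aut_inj[OF h D(2)] .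
  have "card (S `` {h x} \<inter> (h ` D \<union> T)) = card (S `` {h x} \<inter> h ` D) + card (S `` {h x} \<inter> T)" for x
    unfolding Int_Un_distrib using fo T by (intro card_Un_disjoint) auto
  then have "(\<Sum>x\<in>D. card (S `` {h x} \<inter> (h ` D \<union> T))) =
      (\<Sum>x\<in>D. card (S `` {h x} \<inter> h ` D)) + (\<Sum>x\<in>D. card (S `` {h x} \<inter> T))"
    by (simp add: sum.distrib)
  also have "(\<Sum>x\<in>D. card (S `` {h x} \<inter> h ` D)) = (\<Sum>z\<in>h ` D. card (S `` {z} \<inter> h ` D))"
    by (simp add: sum.reindex[OF inj])
  also have "\<dots> = card (Sigma (h ` D) (\<lambda>z. S `` {z} \<inter> h ` D))"
    using D(1) fo by (simp add: card_SigmaI)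
  also have "Sigma (h ` D) (\<lambda>z. S `` {z} \<inter> h ` D) = S \<inter> (h ` D \<times> h ` D)" by auto
  also have "card \<dots> = card {e \<in> edges M. e \<subseteq> h ` D}" by (rule card_orientation_edges[OF S M_graph])
  also have "{e \<in> edges M. e \<subseteq> h ` D} = (`) h ` {e \<in> edges M. e \<subseteq> D}"
    using arg_cong[OF aut_gmap[OF h D(2)], of edges] by simp
  also have "card \<dots> = card {e \<in> edges M. e \<subseteq> D}"
  proof (rule card_image, rule inj_onI)
    fix e e' assume "e \<in> {e \<in> edges M. e \<subseteq> D}" "e' \<in> {e \<in> edges M. e \<subseteq> D}" "h ` e = h ` e'"
    then show "e = e'" using inj_on_image_eq_iff[OF inj, of e e'] by simp
  qed
  finally show ?thesis .
qed

lemma universal: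
  assumes "B \<in> C"
  shows "\<exists>f. inj_on f (verts B) \<and> str (f ` verts B) \<and>
    (\<forall>x\<in>verts B. \<forall>y\<in>verts B. {x, y} \<in> edges B \<longleftrightarrow> {f x, f y} \<in> edges M)"
proof -
  obtain i f where f: "strong_embedding leq f B (A i)" using A_universal[OF assms] by blast
  then have f': "inj_on f (verts B)" "f ` verts B \<subseteq> verts (A i)"
    "\<forall>x\<in>verts B. \<forall>y\<in>verts B. {x, y} \<in> edges B \<longleftrightarrow> {f x, f y} \<in> edges (A i)"
    "leq (induced (A i) (f ` verts B)) (A i)"
    unfolding strong_embedding_def graph_embedding_def by auto
  have "str (f ` verts B)" unfolding str_def using f'(2,4) ind_A_mono[OF f'(2)] by auto
  moreover have "{u, v} \<in> edges (A i) \<longleftrightarrow> {u, v} \<in> edges M" if "u \<in> verts (A i)" "v \<in> verts (A i)" for u v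
    using that arg_cong[OF A_ind[of i], of edges] by auto
  ultimately show ?thesis using f' by (intro exI[of _ f]) blast
qed

end

section \<open>Slots in the limit of the 2-sparse graphs\<close>

locale limit_C0 = limit_graph class_C0 leq_s M A
  for M :: "'a::infinite graph" and A
begin

lemma str_orientation:
  assumes "str W" "W \<subseteq> X" "finite X" "X \<subseteq> V"
  shows "\<exists>O'. two_orientation (ind X) O' \<and> (\<forall>x y. (x, y) \<in> O' \<and> x \<in> W \<longrightarrow> y \<in> W)"
  using str_leq[OF assms] unfolding leq_s_def by auto

lemma str_orientationI:
  assumes "str X" "W \<subseteq> X" "two_orientation (ind X) O'" "\<And>x y. (x, y) \<in> O' \<Longrightarrow> x \<in> W \<Longrightarrow> y \<in> W"
  shows "str W"
proof (rule str_trans[OF assms(1)])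
  show "leq_s (ind W) (ind X)"
    unfolding leq_s_def subgraph_def
    using assms(2-4) induced_induced[OF assms(2), of M] by auto
qed

lemma empty_orientation: "(\<And>x y. x \<in> W \<Longrightarrow> y \<in> W \<Longrightarrow> {x, y} \<notin> edges M) \<Longrightarrow> two_orientation (ind W) {}"
  unfolding two_orientation_def by auto

lemma add_leaf_orientation:
  assumes W: "two_orientation (ind W) O'" "x \<notin> W" "u \<in> W"
    and B: "verts B = insert x W" "edges B = edges (ind W) \<union> {{x, u}}"
  shows "two_orientation B (insert (x, u) O')"
  unfolding two_orientation_def
proof (intro conjI ballI allI impI)
  have sub: "O' \<subseteq> W \<times> W" using two_orientation_sub[OF W(1)] by simp
  show "insert (x, u) O' \<subseteq> verts B \<times> verts B" using sub B(1) W(3) by auto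
  fix p assume "p \<in> insert (x, u) O'"
  then show "case p of (y, z) \<Rightarrow> {y, z} \<in> edges B"
    using two_orientation_edge[OF W(1)] B(2) by (cases p) auto
next
  have sub: "O' \<subseteq> W \<times> W" using two_orientation_sub[OF W(1)] by simp
  fix y z assume "{y, z} \<in> edges B"
  then consider "{y, z} \<in> edges (ind W)" | "y = x" "z = u" | "y = u" "z = x"
    using B(2) by (auto simp: doubleton_eq_iff)
  then show "((y, z) \<in> insert (x, u) O') \<noteq> ((z, y) \<in> insert (x, u) O')"
  proof cases
    case 1
    then have "y \<in> W" "z \<in> W" by auto
    then show ?thesis using two_orientation_dir[OF W(1) 1] W(2) by auto
  next
    case 2
    then show ?thesis using sub W(2,3) by auto
  next
    case 3
    then show ?thesis using sub W(2,3) by auto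
  qed
next
  have sub: "O' \<subseteq> W \<times> W" using two_orientation_sub[OF W(1)] by simp
  fix y
  have "{z. (y, z) \<in> insert (x, u) O'} = (if y = x then {u} else O' `` {y})"
    using sub W(2) by auto
  then show "finite {z. (y, z) \<in> insert (x, u) O'}" "card {z. (y, z) \<in> insert (x, u) O'} \<le> 2"
    using two_orientation_out2[OF W(1)] unfolding out2_def by auto
qed

text \<open>The edge of the leaf is directed from the leaf to \<open>u\<close>, so no arc leaves
  \<open>W\<close>, and the extended orientation proves both sparsity and strength.\<close>

lemma leafy_C0: leafy
  unfolding leafy_def
proof (intro allI impI)
  fix W u assume Wu: "str W \<and> u \<in> W"
  then have W: "str W" "u \<in> W" "finite W" "W \<subseteq> V" using str_finite str_V by auto
  obtain x where x: "x \<notin> W" using ex_new_if_finite[OF infinite_UNIV W(3)] by blast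
  define B where "B = Graph (insert x W) (edges (ind W) \<union> {{x, u}})"
  have vB: "verts B = insert x W" "edges B = edges (ind W) \<union> {{x, u}}" by (simp_all add: B_def)
  have ux: "x \<noteq> u" using x W(2) by auto
  obtain O' where O': "two_orientation (ind W) O'" using str_orientation[OF W(1) order_refl W(3,4)] by blast
  have OW: "O' \<subseteq> W \<times> W" using two_orientation_sub[OF O'] by simp
  have or: "two_orientation B (insert (x, u) O')" by (rule add_leaf_orientation[OF O' x W(2) vB])
  have gB: "is_graph B"
    using is_graph_ind[of W] ux W(2) unfolding is_graph_def vB by auto
  have BC: "B \<in> class_C0"
    using gB two_orientation_sparse[OF or gB] W(3) vB(1) by (simp add: class_C0_def)
  have iB: "induced B W = ind W"
    using vB x by (intro graph_eqI) auto
  have l: "leq_s (ind W) B"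
    unfolding leq_s_def subgraph_def
  proof (intro conjI exI)
    show "two_orientation B (insert (x, u) O')" by (rule or)
    show "\<not> (\<exists>(y, z)\<in>insert (x, u) O'. y \<in> verts (ind W) \<and> z \<notin> verts (ind W))" using OW x by auto
  qed (use iB vB in auto)
  have "W \<subseteq> verts B" using vB(1) by auto
  from embed[OF BC this W(1) iB l] obtain g where g: "inj_on g (verts B)" "\<forall>x\<in>W. g x = x"
    "gmap g B = ind (g ` verts B)" "str (g ` verts B)" by blast
  have gW: "g ` verts B = insert (g x) W" using vB(1) g(2) by simp
  have "g x \<notin> W"
  proof
    assume "g x \<in> W"
    then have "g (g x) = g x" "g x \<in> verts B" "x \<in> verts B" using g(2) vB(1) by auto
    then have "g x = x" using inj_onD[OF g(1)] by blast
    then show False using \<open>g x \<in> W\<close> x by simp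
  qed
  moreover have "g x \<in> V" using str_V[OF g(4)] gW by auto
  moreover have "{g x, w} \<in> edges M \<longleftrightarrow> w = u" if w: "w \<in> W" for w
  proof -
    have "{x, w} \<in> edges B \<longleftrightarrow> {g x, g w} \<in> edges M"
      by (rule gmap_edge_iff[OF gB g(1,3)]) (use w vB(1) in auto)
    moreover have "{x, w} \<in> edges B \<longleftrightarrow> w = u" using w x vB(2) W(2) by (auto simp: doubleton_eq_iff)
    ultimately show ?thesis using g(2) w by simp
  qed
  ultimately show "\<exists>l\<in>V - W. str (insert l W) \<and> (\<forall>w\<in>W. {l, w} \<in> edges M \<longleftrightarrow> w = u)"
    using g(4) gW by (intro bexI[of _ "g x"]) auto
qed

text \<open>The witness \<open>O'\<close> need not resemble the orientation of \<open>M\<close> on a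
  copy. It guarantees that inner edges and slots total \<open>2 * card D\<close>, and it makes the
  leaves strong.\<close>

definition slot_s :: "'a set \<Rightarrow> ('a \<times> nat) set \<Rightarrow> bool" where
  "slot_s D I \<longleftrightarrow> str D \<and> finite I \<and> fst ` I \<subseteq> D \<and>
    (\<exists>O'. two_orientation (ind D) O' \<and> (\<forall>x\<in>D. card (O' `` {x}) + card {i \<in> I. fst i = x} = 2))"

lemma orientation_out_sum:
  assumes "two_orientation (ind D) O'" "finite D"
  shows "(\<Sum>x\<in>D. card (O' `` {x})) = card {e \<in> edges M. e \<subseteq> D}"
proof -
  have sub: "O' \<subseteq> D \<times> D" using two_orientation_sub[OF assms(1)] by simp
  have "(\<Sum>x\<in>D. card (O' `` {x})) = card (Sigma D (\<lambda>x. O' `` {x}))"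
    using assms two_orientation_out2[OF assms(1)] by (simp add: card_SigmaI out2_def)
  also have "Sigma D (\<lambda>x. O' `` {x}) = O' \<inter> (D \<times> D)" using sub by auto
  also have "card \<dots> = card {e \<in> edges (ind D). e \<subseteq> D}"
    by (rule card_orientation_edges[OF assms(1) is_graph_ind])
  finally show ?thesis by simp
qed

text \<open>Here the edges are directed towards the leaves, opposite to \<open>leafy_C0\<close>. The
  slots fill the out-degrees of \<open>O'\<close> to exactly 2, and the leaves get out-degree 0, so
  their set is closed.\<close>

lemma str_leaves:
  assumes D: "two_orientation (ind D) O'" "\<forall>x\<in>D. card (O' `` {x}) + card {i \<in> I. fst i = x} = 2"
    and I: "finite I" "fst ` I \<subseteq> D"
    and l: "inj_on l I" "l ` I \<inter> D = {}" "str (D \<union> l ` I)"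
      "\<forall>i\<in>I. \<forall>v\<in>D \<union> l ` I. {l i, v} \<in> edges M \<longleftrightarrow> v = fst i"
  shows "str (l ` I)"
proof -
  let ?O = "O' \<union> (\<lambda>i. (fst i, l i)) ` I"
  have OD: "O' \<subseteq> D \<times> D" using two_orientation_sub[OF D(1)] by simp
  have or: "two_orientation (ind (D \<union> l ` I)) ?O"
    unfolding two_orientation_def
  proof (intro conjI ballI allI impI)
    show "?O \<subseteq> verts (ind (D \<union> l ` I)) \<times> verts (ind (D \<union> l ` I))" using OD I(2) by auto
  next
    fix p assume "p \<in> ?O"
    then consider "p \<in> O'" | i where "i \<in> I" "p = (fst i, l i)" by blast
    then show "case p of (x, y) \<Rightarrow> {x, y} \<in> edges (ind (D \<union> l ` I))"
    proof cases
      case 1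
      then show ?thesis using two_orientation_edge[OF D(1)] by (cases p) auto
    next
      case 2
      then have "{l i, fst i} \<in> edges M" "fst i \<in> D" using l(4) I(2) by auto
      then show ?thesis using 2 by (simp add: insert_commute)
    qed
  next
    fix x y assume xy: "{x, y} \<in> edges (ind (D \<union> l ` I))"
    then have mem: "{x, y} \<in> edges M" "x \<in> D \<union> l ` I" "y \<in> D \<union> l ` I" by auto
    consider "x \<in> D" "y \<in> D" | i where "i \<in> I" "x = l i" | i where "i \<in> I" "y = l i"
      using mem by blast
    then show "((x, y) \<in> ?O) \<noteq> ((y, x) \<in> ?O)"
    proof cases
      case 1
      then have "{x, y} \<in> edges (ind D)" using mem(1) by simp
      then have "(x, y) \<in> O' \<longleftrightarrow> (y, x) \<notin> O'" by (rule two_orientation_dir[OF D(1)])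
      then show ?thesis using 1 l(2) by auto
    next
      case 2
      then have y: "y = fst i" using l(4) mem(1,3) by auto
      have "x \<notin> D" using 2 l(2) by auto
      then have "(x, y) \<notin> ?O" using OD I(2) by auto
      moreover have "(y, x) \<in> ?O" using 2 y by auto
      ultimately show ?thesis by simp
    next
      case 3
      then have x: "x = fst i" using l(4) mem(1,2) by (auto simp: insert_commute)
      have "y \<notin> D" using 3 l(2) by auto
      then have "(y, x) \<notin> ?O" using OD I(2) by auto
      moreover have "(x, y) \<in> ?O" using 3 x by auto
      ultimately show ?thesis by simp
    qed
  next
    fix x
    have o: "finite (O' `` {x})" using two_orientation_out2[OF D(1)] by (simp add: out2_def)
    have eq: "{y. (x, y) \<in> ?O} = O' `` {x} \<union> l ` {i \<in> I. fst i = x}" by auto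
    show "finite {y. (x, y) \<in> ?O}" unfolding eq using o I(1) by simp
    show "card {y. (x, y) \<in> ?O} \<le> 2"
    proof (cases "x \<in> D")
      case True
      have "card {y. (x, y) \<in> ?O} \<le> card (O' `` {x}) + card (l ` {i \<in> I. fst i = x})"
        unfolding eq by (rule card_Un_le)
      also have "\<dots> \<le> card (O' `` {x}) + card {i \<in> I. fst i = x}"
        using card_image_le[of "{i \<in> I. fst i = x}" l] I(1) by simp
      finally show ?thesis using D(2) True by simp
    next
      case False
      then have "O' `` {x} = {}" "{i \<in> I. fst i = x} = {}" using OD I(2) by auto
      then show ?thesis unfolding eq by (simp only: image_empty Un_empty_left card.empty)
    qed
  qed
  show ?thesis
  proof (rule str_orientationI[OF l(3) _ or])
    fix x y assume "(x, y) \<in> ?O" "x \<in> l ` I"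
    then show "y \<in> l ` I" using OD I(2) l(2) by auto
  qed simp
qed

lemma slot_s_copies:
  assumes sl: "slot_s D I" and S: "two_orientation M S"
    and T: "card T = card I" "str X" "str (X \<union> T)" "X \<inter> T = {}" "indep (X \<union> T)" "spread S r T"
    and F: "finite F" "F \<subseteq> V" and sub: "\<And>T'. T' \<subseteq> X \<union> T \<Longrightarrow> str T'"
  shows "\<exists>h c. slot_copy S r D I T X F h c"
proof -
  note o2 = two_orientation_out2[OF S]
  have SV: "S \<subseteq> V \<times> V" using two_orientation_sub[OF S] .
  have D: "str D" "finite I" "fst ` I \<subseteq> D" using sl unfolding slot_s_def by auto
  have DV: "finite D" "D \<subseteq> V" using str_finite[OF D(1)] str_V[OF D(1)] .
  obtain O' where O': "two_orientation (ind D) O'" "\<forall>x\<in>D. card (O' `` {x}) + card {i \<in> I. fst i = x} = 2"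
    using sl unfolding slot_s_def by auto
  obtain l where l: "inj_on l I" "l ` I \<inter> D = {}" "str (D \<union> l ` I)"
    "\<forall>i\<in>I. \<forall>v\<in>D \<union> l ` I. {l i, v} \<in> edges M \<longleftrightarrow> v = fst i"
    using leaves[OF leafy_C0 D] by blast
  have L: "str (l ` I)" by (rule str_leaves[OF O' D(2,3) l])
  have iL: "indep (l ` I)"
    unfolding indep_def
  proof (intro ballI)
    fix x y assume "x \<in> l ` I" and y: "y \<in> l ` I"
    then obtain i where i: "i \<in> I" "x = l i" by blast
    have "y \<noteq> fst i" using y l(2) D(3) i(1) by auto
    then show "{x, y} \<notin> edges M" using l(4) i y by blast
  qed
  have T': "str T" "indep T" "card T = card (l ` I)" "finite T" "T \<subseteq> V"
    using sub[of T] T(1,5) card_image[OF l(1)] str_finite[OF T(3)] str_V[OF T(3)]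
    unfolding indep_def by auto
  \<comment> \<open>The balls around \<open>T\<close> keep the copy disjoint from the trees; the
    out-neighbours of \<open>T\<close> exclude arcs from \<open>T\<close> into the copy.\<close>
  let ?Z = "F \<union> (\<Union>t\<in>T. out_ball S r t) \<union> S `` T"
  have "finite (S `` T)"
    unfolding Image_eq_UN[of S T] using T'(4) o2 by (simp add: out2_def)
  then have Z: "finite ?Z" using F(1) T'(4) finite_out_ball[OF o2] by simp
  have ZV: "?Z \<subseteq> V" using F(2) out_ball_sub[OF SV] T'(5) SV by (intro Un_least UN_least) auto
  obtain H where H: "H \<in> automorphisms M" "H ` l ` I = T" "H ` D \<inter> (?Z \<union> X \<union> T) = {}"
    "\<forall>x\<in>X. \<forall>y\<in>H ` D. {x, y} \<notin> edges M" "\<forall>K'. K' \<subseteq> D \<and> str K' \<longrightarrow> str (X \<union> H ` K')"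
    using place[OF l(3) L iL l(2) T'(1-3) T(2-5) Z ZV] by (elim bexE conjE) (rule that)
  have lV: "l ` I \<subseteq> V" using str_V[OF L] .
  let ?c = "H \<circ> l"
  have injc: "inj_on ?c I" using comp_inj_on[OF l(1) aut_inj[OF H(1) lV]] .
  have cT: "?c ` I = T" using H(2) by (simp add: image_comp)
  have HT: "H ` D \<inter> T = {}" using H(3) by blast
  have slot: "(H x, ?c i) \<in> S \<longleftrightarrow> fst i = x" if xi: "x \<in> D" "i \<in> I" for x i
  proof -
    have V': "x \<in> V" "l i \<in> V" using xi DV(2) lV by auto
    have "{H (l i), H x} \<in> edges M \<longleftrightarrow> x = fst i"
      using aut_edge[OF H(1) V'(2,1)] l(4) xi by auto
    then have e: "{H x, ?c i} \<in> edges M \<longleftrightarrow> fst i = x" by (auto simp: insert_commute)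
    have "?c i \<in> T" using cT xi(2) by blast
    then have "(?c i, H x) \<notin> S" using H(3) xi(1) by blast
    then show ?thesis
      using e two_orientation_dir[OF S, of "H x" "?c i"] two_orientation_edge[OF S, of "H x" "?c i"] by blast
  qed
  have outT: "S `` {H x} \<inter> T = ?c ` {i \<in> I. fst i = x}" if "x \<in> D" for x
    using slot[OF that] cT by auto
  have cardT: "card (S `` {H x} \<inter> T) = card {i \<in> I. fst i = x}" if x: "x \<in> D" for x
    unfolding outT[OF x] by (rule card_image) (rule inj_on_subset[OF injc], auto)
  \<comment> \<open>The total equals \<open>2 * card D\<close> and no summand exceeds 2, so every
    summand is 2 and no out-edge of the copy goes elsewhere.\<close>
  have "(\<Sum>x\<in>D. card (S `` {H x} \<inter> (H ` D \<union> T))) =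
      (\<Sum>x\<in>D. card (O' `` {x})) + (\<Sum>x\<in>D. card {i \<in> I. fst i = x})"
    unfolding out_degree_sum[OF S H(1) DV HT] orientation_out_sum[OF O'(1) DV(1)] using cardT by simp
  also have "\<dots> = (\<Sum>x\<in>D. 2)" unfolding sum.distrib[symmetric] using O'(2) by (intro sum.cong) auto
  finally have sum2: "(\<Sum>x\<in>D. card (S `` {H x} \<inter> (H ` D \<union> T))) = (\<Sum>x\<in>D. 2)" .
  have fo: "finite (S `` {z})" "card (S `` {z}) \<le> 2" for z using o2 by (auto simp: out2_def)
  have le2: "card (S `` {H x} \<inter> (H ` D \<union> T)) \<le> 2" for x
    using card_mono[OF fo(1), of "S `` {H x} \<inter> (H ` D \<union> T)" "H x"] fo(2)[of "H x"] by simp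
  have two: "card (S `` {H x} \<inter> (H ` D \<union> T)) = 2" if "x \<in> D" for x
    by (rule sum_mono_inv[OF sum2 le2 that DV(1)])
  have all: "S `` {H x} \<subseteq> H ` D \<union> T" "card (S `` {H x}) = 2" if x: "x \<in> D" for x
  proof -
    have "card (S `` {H x}) \<le> card (S `` {H x} \<inter> (H ` D \<union> T))" using two[OF x] fo(2) by simp
    then have "S `` {H x} \<inter> (H ` D \<union> T) = S `` {H x}"
      using card_seteq[OF fo(1), of "S `` {H x} \<inter> (H ` D \<union> T)" "H x"] by blast
    then show "S `` {H x} \<subseteq> H ` D \<union> T" "card (S `` {H x}) = 2" using two[OF x] by auto
  qed
  have "slot_copy S r D I T X F H ?c"
    unfolding slot_copy_def cT
  proof (intro conjI)
    show "\<forall>x\<in>D. card (S `` {H x}) = 2 \<and> S `` {H x} \<subseteq> H ` D \<union> T" using all by blast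
    show "\<forall>x\<in>D. \<forall>i\<in>I. (H x, ?c i) \<in> S \<longleftrightarrow> fst i = x" using slot by blast
    have cI: "?c i \<in> T" if "i \<in> I" for i using cT that by blast
    show "\<forall>i\<in>I. out_ball S r (?c i) \<inter> H ` D = {}" using H(3) cI by blast
    show "\<forall>i\<in>I. out_ball S r (?c i) \<inter> F \<subseteq> (\<Union>t\<in>T. out_ball S r t)" using cI by blast
    show "(\<forall>t\<in>T. fades S t) \<longrightarrow> (\<forall>i\<in>I. fades S (?c i))" using cI by blast
    show "str (X \<union> H ` D)" using H(5) D(1) by blast
    show "X \<inter> H ` D = {}" "H ` D \<inter> F = {}" using H(3) by blast+
  qed (use H(1,4) injc T(6) in auto)
  then show ?thesis by blast
qed

lemma indep_subset_C0:
  assumes "str T" "indep T" "T' \<subseteq> T"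
  shows "str T'"
  by (rule str_orientationI[OF assms(1,3) empty_orientation]) (use assms(2) in \<open>auto simp: indep_def\<close>)

lemma triangle: "\<exists>x y z. x \<noteq> y \<and> y \<noteq> z \<and> x \<noteq> z \<and> str {x, y, z} \<and>
  {x, y} \<in> edges M \<and> {y, z} \<in> edges M \<and> {x, z} \<in> edges M"
proof -
  obtain N :: "'a set" where "finite N" "card N = 3"
    using infinite_arbitrarily_large[OF infinite_UNIV] by blast
  then obtain a b c :: 'a where abc: "a \<noteq> b" "b \<noteq> c" "a \<noteq> c" by (auto simp: card_3_iff)
  define B where "B = Graph {a, b, c} {{a, b}, {b, c}, {a, c}}"
  have vB: "verts B = {a, b, c}" "edges B = {{a, b}, {b, c}, {a, c}}" by (simp_all add: B_def)
  have gB: "is_graph B" unfolding is_graph_def vB using abc by auto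
  have "two_orientation B {(a, b), (b, c), (c, a)}"
    unfolding two_orientation_def vB
  proof (intro conjI ballI allI impI)
    fix x y assume "{x, y} \<in> {{a, b}, {b, c}, {a, c}}"
    then show "((x, y) \<in> {(a, b), (b, c), (c, a)}) \<noteq> ((y, x) \<in> {(a, b), (b, c), (c, a)})"
      using abc by (auto simp: doubleton_eq_iff)
  next
    fix x assume "x \<in> {a, b, c}"
    then have "{y. (x, y) \<in> {(a, b), (b, c), (c, a)}} = {if x = a then b else if x = b then c else a}"
      using abc by auto
    then show "finite {y. (x, y) \<in> {(a, b), (b, c), (c, a)}}"
      "card {y. (x, y) \<in> {(a, b), (b, c), (c, a)}} \<le> 2" by simp_all
  qed (auto simp: insert_commute)
  then have "two_sparse B" by (rule two_orientation_sparse[OF _ gB])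
  then have "B \<in> class_C0" using gB vB(1) by (simp add: class_C0_def)
  from universal[OF this] obtain f where f: "inj_on f {a, b, c}" "str (f ` {a, b, c})"
    "\<forall>x\<in>{a, b, c}. \<forall>y\<in>{a, b, c}. {x, y} \<in> edges B \<longleftrightarrow> {f x, f y} \<in> edges M"
    unfolding vB(1) by blast
  have "f a \<noteq> f b" "f b \<noteq> f c" "f a \<noteq> f c" using f(1) abc by (auto simp: inj_on_def)
  moreover have "{f a, f b} \<in> edges M" "{f b, f c} \<in> edges M" "{f a, f c} \<in> edges M"
    using f(3) unfolding vB(2) by auto
  ultimately show ?thesis using f(2) by (intro exI[of _ "f a"] exI[of _ "f b"] exI[of _ "f c"]) simp
qed

text \<open>The cyclic orientation gives each vertex out-degree 1 and leaves one slot apiece. The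
  transitive one makes \<open>x\<close> a sink and so shows that a vertex of the triangle is
  strong.\<close>

lemma triangle_orientation:
  assumes "x \<noteq> y" "y \<noteq> z" "x \<noteq> z" "{x, y} \<in> edges M" "{y, z} \<in> edges M" "{x, z} \<in> edges M"
  shows "two_orientation (ind {x, y, z}) {(x, y), (y, z), (z, x)}"
    and "two_orientation (ind {x, y, z}) {(y, x), (z, x), (y, z)}"
proof -
  have adj: "{u, v} \<in> edges (ind {x, y, z}) \<longleftrightarrow> u \<in> {x, y, z} \<and> v \<in> {x, y, z} \<and> u \<noteq> v" for u v
    using assms no_loop by (auto simp: insert_commute)
  show "two_orientation (ind {x, y, z}) {(x, y), (y, z), (z, x)}"
    unfolding two_orientation_def adj
  proof (intro conjI ballI allI impI)
    fix u assume "u \<in> verts (ind {x, y, z})"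
    have "{v. (u, v) \<in> {(x, y), (y, z), (z, x)}} \<subseteq> {if u = x then y else if u = y then z else x}"
      using assms(1-3) by auto
    from finite_subset[OF this] card_mono[OF _ this]
    show "finite {v. (u, v) \<in> {(x, y), (y, z), (z, x)}}" "card {v. (u, v) \<in> {(x, y), (y, z), (z, x)}} \<le> 2"
      by simp_all
  qed (use assms(1-3) in auto)
  show "two_orientation (ind {x, y, z}) {(y, x), (z, x), (y, z)}"
    unfolding two_orientation_def adj
  proof (intro conjI ballI allI impI)
    fix u assume "u \<in> verts (ind {x, y, z})"
    have "{v. (u, v) \<in> {(y, x), (z, x), (y, z)}} \<subseteq> {x, z}" by auto
    from finite_subset[OF this] card_mono[OF _ this]
    show "finite {v. (u, v) \<in> {(y, x), (z, x), (y, z)}}" "card {v. (u, v) \<in> {(y, x), (z, x), (y, z)}} \<le> 2"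
      using assms(3) by simp_all
  qed (use assms(1-3) in auto)
qed

sublocale slots: slot_graph class_C0 leq_s M A slot_s
proof
  fix T T' assume "str T" "indep T" "T' \<subseteq> T"
  then show "str T'" by (rule indep_subset_C0)
next
  obtain x y z where t: "x \<noteq> y" "y \<noteq> z" "x \<noteq> z" "str {x, y, z}"
    "{x, y} \<in> edges M" "{y, z} \<in> edges M" "{x, z} \<in> edges M" using triangle by blast
  have single: "str {u}" if u: "u \<in> {x, y, z}" for u
  proof -
    have "\<exists>v w. {x, y, z} = {u, v, w} \<and> u \<noteq> v \<and> v \<noteq> w \<and> u \<noteq> w"
    proof -
      consider "u = x" | "u = y" | "u = z" using u by blast
      then show ?thesis
      proof cases
        case 1
        then show ?thesis using t(1-3) by (intro exI[of _ y] exI[of _ z]) simp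
      next
        case 2
        then show ?thesis using t(1-3) by (intro exI[of _ x] exI[of _ z]) auto
      next
        case 3
        then show ?thesis using t(1-3) by (intro exI[of _ x] exI[of _ y]) auto
      qed
    qed
    then obtain v w where vw: "{x, y, z} = {u, v, w}" "u \<noteq> v" "v \<noteq> w" "u \<noteq> w" by blast
    have e: "{u, v} \<in> edges M" "{v, w} \<in> edges M" "{u, w} \<in> edges M"
    proof -
      have "{p, q} \<in> edges M" if "p \<in> {x, y, z}" "q \<in> {x, y, z}" "p \<noteq> q" for p q
        using that t(5-7) by (auto simp: insert_commute)
      then show "{u, v} \<in> edges M" "{v, w} \<in> edges M" "{u, w} \<in> edges M"
        using vw by auto
    qed
    show ?thesis
      by (rule str_orientationI[OF t(4)[unfolded vw(1)] _ triangle_orientation(2)[OF vw(2-4) e]])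
        (use vw in auto)
  qed
  then show "\<exists>a. str {a}" by blast
  let ?D = "{x, y, z}" and ?I = "{(x, 0), (y, 0), (z, 0)} :: ('a \<times> nat) set"
  have i1: "card {i \<in> ?I. fst i = u} = 1" if "u \<in> ?D" for u
  proof -
    have "{i \<in> ?I. fst i = u} = {(u, 0)}" using that by auto
    then show ?thesis by simp
  qed
  have "slot_s ?D ?I"
    unfolding slot_s_def
  proof (intro conjI exI ballI)
    show "two_orientation (ind ?D) {(x, y), (y, z), (z, x)}" by (rule triangle_orientation(1)[OF t(1-3,5-7)])
    fix u assume u: "u \<in> ?D"
    have "{(x, y), (y, z), (z, x)} `` {u} = {if u = x then y else if u = y then z else x}"
      using t(1-3) u by auto
    then show "card ({(x, y), (y, z), (z, x)} `` {u}) + card {i \<in> ?I. fst i = u} = 2"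
      using i1[OF u] by simp
  qed (use t(4) in auto)
  then show "\<exists>D I. slot_s D I \<and> D \<noteq> {} \<and> (\<forall>y\<in>D. str {y} \<and> card {i \<in> I. fst i = y} = 1)"
    using single i1 by (intro exI[of _ ?D] exI[of _ ?I]) auto
next
  fix a R assume a: "str {a}" and R: "finite R" "R \<subseteq> V" "a \<in> R"
  obtain O' where O': "two_orientation (ind R) O'" "\<forall>x y. (x, y) \<in> O' \<and> x \<in> {a} \<longrightarrow> y \<in> {a}"
    using str_orientation[OF a _ R(1,2)] R(3) by auto
  \<comment> \<open>A strong vertex is a sink of some orientation of \<open>R\<close>, which leaves
    at most \<open>2 * (card R - 1)\<close> edges.\<close>
  have "O' `` {a} = {}"
    using O' two_orientation_edge[OF O'(1), of a a] no_loop[of a] by auto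
  then have "card {e \<in> edges M. e \<subseteq> R} = (\<Sum>x\<in>R - {a}. card (O' `` {x}))"
    unfolding orientation_out_sum[OF O'(1) R(1), symmetric] using R by (simp add: sum.remove)
  also have "\<dots> \<le> card (R - {a}) * 2"
    using sum_bounded_above[of "R - {a}" "\<lambda>x. card (O' `` {x})" 2] two_orientation_out2[OF O'(1)]
    by (simp add: out2_def)
  also have "\<dots> < 2 * card R"
  proof -
    have "card (R - {a}) < card R" using R by (intro card_Diff1_less) auto
    then show ?thesis by simp
  qed
  finally show "card {e \<in> edges M. e \<subseteq> R} < 2 * card R" .
next
  fix D I assume "slot_s D I"
  then show "finite D \<and> D \<subseteq> V \<and> finite I \<and> fst ` I \<subseteq> D"
    unfolding slot_s_def using str_finite str_V by auto
next
  fix D :: "'a set" assume D: "finite D" "D \<subseteq> V"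
  obtain D' where D': "D \<subseteq> D'" "str D'" using str_cover[OF D] by blast
  have f: "finite D'" "D' \<subseteq> V" using str_finite[OF D'(2)] str_V[OF D'(2)] .
  obtain O' where O': "two_orientation (ind D') O'" using str_orientation[OF D'(2) order_refl f] by blast
  \<comment> \<open>As many slots at each vertex as its out-degree falls short of 2.\<close>
  let ?I = "Sigma D' (\<lambda>x. {..<2 - card (O' `` {x})})"
  have c: "card {i \<in> ?I. fst i = x} = 2 - card (O' `` {x})" if "x \<in> D'" for x
  proof -
    have "{i \<in> ?I. fst i = x} = {x} \<times> {..<2 - card (O' `` {x})}" using that by auto
    then show ?thesis by (simp add: card_cartesian_product)
  qed
  have "slot_s D' ?I"
    unfolding slot_s_def
  proof (intro conjI exI ballI)
    show "two_orientation (ind D') O'" by (rule O')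
    fix x assume "x \<in> D'"
    then show "card (O' `` {x}) + card {i \<in> ?I. fst i = x} = 2"
      using c two_orientation_out2[OF O'] by (simp add: out2_def)
  qed (use D'(2) f in auto)
  then show "\<exists>D' I. D \<subseteq> D' \<and> slot_s D' I" using D'(1) by blast
next
  fix x assume x: "str {x}"
  show "slot_s {x} {(x, 0), (x, 1)}"
    unfolding slot_s_def
  proof (intro conjI exI ballI)
    show "two_orientation (ind {x}) {}" using no_loop by (intro empty_orientation) auto
    fix y assume "y \<in> {x}"
    then have "{i \<in> {(x, 0), (x, 1)}. fst i = y} = {(x, 0), (x, 1 :: nat)}" by auto
    then show "card ({} `` {y}) + card {i \<in> {(x, 0), (x, 1 :: nat)}. fst i = y} = 2" by simp
  qed (use x in auto)
next
  fix D I and r :: nat assume sl: "slot_s D I"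
  show "\<exists>k. \<forall>S T X F. two_orientation M S \<and> card T = k \<and> str X \<and>
      str (X \<union> T) \<and> X \<inter> T = {} \<and> indep (X \<union> T) \<and> spread S r T \<and> finite F \<and> F \<subseteq> V \<longrightarrow>
      (\<exists>h c. slot_copy S r D I T X F h c)"
  proof (intro exI[of _ "card I"] allI impI)
    fix S T X F assume a: "two_orientation M S \<and> card T = card I \<and> str X \<and>
      str (X \<union> T) \<and> X \<inter> T = {} \<and> indep (X \<union> T) \<and> spread S r T \<and> finite F \<and> F \<subseteq> V"
    then have "str T'" if "T' \<subseteq> X \<union> T" for T' using indep_subset_C0[OF _ _ that] by blast
    then show "\<exists>h c. slot_copy S r D I T X F h c" using slot_s_copies[OF sl] a by blast
  qed
qed

end

section \<open>The classes defined by the predimension\<close>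

text \<open>The predimension of an induced subgraph as a function of its vertex set, the form in
  which submodularity is applied.\<close>

definition dl :: "'a graph \<Rightarrow> 'a set \<Rightarrow> int" where
  "dl G W = 2 * int (card W) - int (card {e \<in> edges G. e \<subseteq> W})"

text \<open>Edges between \<open>X - Y\<close> and \<open>Y - X\<close>: the defect in
  submodularity. For disjoint sets these are all edges joining them.\<close>

definition crossing :: "'a graph \<Rightarrow> 'a set \<Rightarrow> 'a set \<Rightarrow> 'a set set" where
  "crossing G X Y = {e \<in> edges G. e \<subseteq> X \<union> Y \<and> \<not> e \<subseteq> X \<and> \<not> e \<subseteq> Y}"

lemma predim_induced [simp]: "predim (induced G W) = dl G W"
  by (simp add: predim_def dl_def)

lemma finite_crossing: "finite X \<Longrightarrow> finite Y \<Longrightarrow> finite (crossing G X Y)"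
  by (rule finite_subset[of _ "Pow (X \<union> Y)"]) (auto simp: crossing_def)

lemma dl_Un:
  assumes "finite X" "finite Y"
  shows "dl G (X \<union> Y) = dl G X + dl G Y - dl G (X \<inter> Y) - int (card (crossing G X Y))"
proof -
  let ?E = "\<lambda>W. {e \<in> edges G. e \<subseteq> W}"
  have fin: "finite (?E X)" "finite (?E Y)" "finite (crossing G X Y)"
    using assms by (simp_all add: finite_edges_within finite_crossing)
  have "?E (X \<union> Y) = (?E X \<union> ?E Y) \<union> crossing G X Y" unfolding crossing_def by auto
  then have "card (?E (X \<union> Y)) = card (?E X \<union> ?E Y) + card (crossing G X Y)"
    using fin by (simp add: card_Un_disjoint crossing_def disjoint_iff)
  moreover have "card (?E X \<union> ?E Y) + card (?E (X \<inter> Y)) = card (?E X) + card (?E Y)"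
  proof -
    have "?E (X \<inter> Y) = ?E X \<inter> ?E Y" by auto
    then show ?thesis using card_Un_Int[OF fin(1,2)] by simp
  qed
  moreover have "card (X \<union> Y) + card (X \<inter> Y) = card X + card Y" using card_Un_Int[OF assms] by simp
  ultimately show ?thesis unfolding dl_def by linarith
qed

lemma dl_submodular:
  "finite X \<Longrightarrow> finite Y \<Longrightarrow> dl G (X \<union> Y) \<le> dl G X + dl G Y - dl G (X \<inter> Y)"
  using dl_Un[of X Y G] by simp

lemma dl_empty [simp]: "is_graph G \<Longrightarrow> dl G {} = 0"
  by (auto simp: dl_def is_graph_def)

lemma dl_vertex [simp]: "is_graph G \<Longrightarrow> dl G {a} = 2"
proof -
  assume "is_graph G"
  then have "{e \<in> edges G. e \<subseteq> {a}} = {}" by (auto simp: is_graph_def subset_singleton_iff)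
  then show ?thesis by (simp add: dl_def)
qed

lemma dl_subgraph: "subgraph A B \<Longrightarrow> W \<subseteq> verts A \<Longrightarrow> dl A W = dl B W"
proof -
  assume a: "subgraph A B" "W \<subseteq> verts A"
  have "{e \<in> edges A. e \<subseteq> W} = {e \<in> edges B. e \<subseteq> W}" using subgraph_edge[OF a(1)] a(2) by auto
  then show ?thesis by (simp add: dl_def)
qed

lemma dl_gmap:
  assumes "is_graph G" "inj_on f (verts G)" "W \<subseteq> verts G"
  shows "dl (gmap f G) (f ` W) = dl G W"
proof -
  have inj: "inj_on f W" using inj_on_subset[OF assms(2,3)] .
  have "{e \<in> edges (gmap f G). e \<subseteq> f ` W} = (`) f ` {e \<in> edges G. e \<subseteq> W}"
    using arg_cong[OF induced_gmap[OF assms], of edges] by simp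
  moreover have "inj_on ((`) f) {e \<in> edges G. e \<subseteq> W}"
    using inj_on_image_Pow[OF inj] by (rule inj_on_subset) auto
  ultimately have "card {e \<in> edges (gmap f G). e \<subseteq> f ` W} = card {e \<in> edges G. e \<subseteq> W}"
    using card_image[of "(`) f" "{e \<in> edges G. e \<subseteq> W}"] by simp
  then show ?thesis unfolding dl_def by (simp add: card_image[OF inj])
qed

lemma leq_d_iff:
  "leq_d A B \<longleftrightarrow> subgraph A B \<and> (\<forall>W. verts A \<subset> W \<and> W \<subseteq> verts B \<longrightarrow> dl B (verts A) < dl B W)"
proof -
  have "predim A = dl B (verts A)" if s: "subgraph A B"
  proof -
    have "A = induced B (verts A)" using s unfolding subgraph_def by blast
    then have "predim A = predim (induced B (verts A))" by (rule arg_cong)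
    then show ?thesis unfolding predim_induced .
  qed
  then show ?thesis unfolding leq_d_def predim_induced by (cases "subgraph A B") simp_all
qed

text \<open>For \<open>W\<close> not inside \<open>B\<close>, submodularity turns the strict gain
  from \<open>B\<close> to \<open>W \<union> B\<close> into a strict gain from
  \<open>W \<inter> B\<close> to \<open>W\<close>, and \<open>W \<inter> B\<close> is at least as
  large in predimension as \<open>A\<close>.\<close>

lemma leq_d_trans:
  assumes "leq_d A B" "leq_d B D" "finite (verts D)"
  shows "leq_d A D"
  unfolding leq_d_iff
proof (intro conjI allI impI)
  have sg: "subgraph A B" "subgraph B D" using assms unfolding leq_d_iff by auto
  show "subgraph A D" using subgraph_trans[OF sg] .
  have sub: "verts A \<subseteq> verts B" "verts B \<subseteq> verts D" using sg unfolding subgraph_def by auto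
  have AB: "dl D (verts A) < dl D W" if "verts A \<subset> W" "W \<subseteq> verts B" for W
    using assms(1) that dl_subgraph[OF sg(2)] sub(1) unfolding leq_d_iff by metis
  fix W assume W: "verts A \<subset> W \<and> W \<subseteq> verts D"
  show "dl D (verts A) < dl D W"
  proof (cases "W \<subseteq> verts B")
    case True
    then show ?thesis using AB W by blast
  next
    case False
    then have "verts B \<subset> W \<union> verts B" "W \<union> verts B \<subseteq> verts D" using W sub by auto
    then have "dl D (verts B) < dl D (W \<union> verts B)" using assms(2) unfolding leq_d_iff by blast
    moreover have "dl D (W \<union> verts B) \<le> dl D W + dl D (verts B) - dl D (W \<inter> verts B)"
      using W sub assms(3) finite_subset by (intro dl_submodular) auto
    moreover have "dl D (verts A) \<le> dl D (W \<inter> verts B)"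
    proof (cases "verts A = W \<inter> verts B")
      case False
      then have "verts A \<subset> W \<inter> verts B" using W sub by auto
      then show ?thesis using AB[of "W \<inter> verts B"] by simp
    qed simp
    ultimately show ?thesis by simp
  qed
qed

lemma leq_d_restrict:
  assumes "leq_d A B" "finite (verts B)" "W \<subseteq> verts B"
  shows "leq_d (induced A (verts A \<inter> W)) (induced B W)"
  unfolding leq_d_iff
proof (intro conjI allI impI)
  have sg: "subgraph A B" using assms(1) unfolding leq_d_iff by simp
  have sub: "verts A \<subseteq> verts B" using sg unfolding subgraph_def by simp
  have fin: "finite (verts A)" "finite W" using sub assms(2,3) finite_subset by auto
  show "subgraph (induced A (verts A \<inter> W)) (induced B W)" by (rule subgraph_induced[OF sg assms(3)])
  fix X assume X: "verts (induced A (verts A \<inter> W)) \<subset> X \<and> X \<subseteq> verts (induced B W)"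
  then have X': "verts A \<inter> W \<subset> X" "X \<subseteq> W" "X \<inter> verts A = verts A \<inter> W" by auto
  have dW: "dl (induced B W) Z = dl B Z" if "Z \<subseteq> W" for Z
    by (rule dl_subgraph) (use that assms(3) in \<open>auto simp: subgraph_def\<close>)
  have "verts A \<subset> X \<union> verts A" "X \<union> verts A \<subseteq> verts B" using X' sub assms(3) by auto
  then have "dl B (verts A) < dl B (X \<union> verts A)" using assms(1) unfolding leq_d_iff by blast
  moreover have "dl B (X \<union> verts A) \<le> dl B X + dl B (verts A) - dl B (X \<inter> verts A)"
    using fin X'(2) finite_subset by (intro dl_submodular) auto
  ultimately show "dl (induced B W) (verts (induced A (verts A \<inter> W))) < dl (induced B W) X"
    using X' dW[of X] dW[of "verts A \<inter> W"] by simp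
qed

lemma class_CF_dl: "B \<in> class_CF F \<longleftrightarrow> B \<in> class_C0 \<and> (\<forall>W\<subseteq>verts B. F (real (card W)) \<le> real_of_int (dl B W))"
  by (simp add: class_CF_def)

lemma amalgamation_class_CF:
  fixes F :: "real \<Rightarrow> real"
  assumes free: "free_amalgamation_class (class_CF F :: 'a::infinite graph set) leq_d"
    and vertex: "\<And>B a. B \<in> (class_CF F :: 'a graph set) \<Longrightarrow> a \<in> verts B \<Longrightarrow> leq_d (induced B {a}) B"
  shows "amalgamation_class (class_CF F :: 'a graph set) leq_d"
proof
  fix A B D :: "'a graph" and f :: "'a \<Rightarrow> 'a" and W
  have CF: "is_graph B" "finite (verts B)" if "B \<in> class_CF F" for B :: "'a graph"
    using that class_C0D[of B] unfolding class_CF_dl by auto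
  show "B \<in> class_CF F \<Longrightarrow> is_graph B" "B \<in> class_CF F \<Longrightarrow> finite (verts B)" by (fact CF)+
  show "gmap f B \<in> class_CF F" if B: "B \<in> class_CF F" "inj_on f (verts B)"
  proof -
    have "F (real (card W)) \<le> real_of_int (dl (gmap f B) W)" if W: "W \<subseteq> verts (gmap f B)" for W
    proof -
      obtain U where U: "U \<subseteq> verts B" "W = f ` U" using W by (metis subset_imageE verts_gmap)
      have "card W = card U" unfolding U(2) by (rule card_image[OF inj_on_subset[OF B(2) U(1)]])
      then show ?thesis
        using B(1) U dl_gmap[OF CF(1)[OF B(1)] B(2) U(1)] unfolding class_CF_dl by simp
    qed
    then show ?thesis using class_C0_gmap[OF _ B(2)] B(1) unfolding class_CF_dl by blast
  qed
  show "induced B W \<in> class_CF F" if B: "B \<in> class_CF F" "W \<subseteq> verts B"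
  proof -
    have "dl (induced B W) U = dl B U" if "U \<subseteq> W" for U
      by (rule dl_subgraph) (use that B(2) in \<open>auto simp: subgraph_def\<close>)
    then show ?thesis using B class_C0_induced[OF _ B(2)] unfolding class_CF_dl by auto
  qed
  show "leq_d (gmap f A) (gmap f B)" if AB: "leq_d A B" "B \<in> class_CF F" "inj_on f (verts B)"
    unfolding leq_d_iff
  proof (intro conjI allI impI)
    have sg: "subgraph A B" "verts A \<subseteq> verts B" using AB(1) unfolding leq_d_iff subgraph_def by auto
    show "subgraph (gmap f A) (gmap f B)" by (rule subgraph_gmap[OF sg(1) CF(1)[OF AB(2)] AB(3)])
    fix W assume W: "verts (gmap f A) \<subset> W \<and> W \<subseteq> verts (gmap f B)"
    then obtain U where U: "U \<subseteq> verts B" "W = f ` U" by (metis subset_imageE verts_gmap)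
    have "verts A \<subset> U"
      using W U sg(2) inj_on_image_subset_iff[OF AB(3), of "verts A" U] by auto
    then show "dl (gmap f B) (verts (gmap f A)) < dl (gmap f B) W"
      using AB(1) U dl_gmap[OF CF(1)[OF AB(2)] AB(3)] sg(2) unfolding leq_d_iff by simp
  qed
  show "leq_d A B \<Longrightarrow> subgraph A B" unfolding leq_d_iff by simp
  show "leq_d A B \<Longrightarrow> leq_d B D \<Longrightarrow> D \<in> class_CF F \<Longrightarrow> leq_d A D"
    using leq_d_trans[of A B D] CF(2)[of D] by simp
  show "leq_d A B \<Longrightarrow> B \<in> class_CF F \<Longrightarrow> W \<subseteq> verts B \<Longrightarrow>
      leq_d (induced A (verts A \<inter> W)) (induced B W)"
    using leq_d_restrict[of A B W] CF(2)[of B] by simp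
  show "leq_d (induced B {}) B" if B: "B \<in> class_CF F"
    unfolding leq_d_iff
  proof (intro conjI allI impI)
    show "subgraph (induced B {}) B" by (simp add: subgraph_def)
    fix W assume W: "verts (induced B {}) \<subset> W \<and> W \<subseteq> verts B"
    then obtain a where a: "a \<in> W" "a \<in> verts B" by auto
    \<comment> \<open>A single vertex has predimension 2 and is closed, so no non-empty set falls
      below 2.\<close>
    have "dl B {a} \<le> dl B W"
    proof (cases "W = {a}")
      case False
      then have "verts (induced B {a}) \<subset> W" using a(1) by auto
      then have "dl B (verts (induced B {a})) < dl B W" using vertex[OF B a(2)] W unfolding leq_d_iff by blast
      then show ?thesis by simp
    qed simp
    then show "dl B (verts (induced B {})) < dl B W" using CF(1)[OF B] by simp
  qed
  show "free_amalgamation_class (class_CF F :: 'a graph set) leq_d" by (rule free)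
qed

section \<open>Slots in the limit of a predimension class\<close>

locale limit_CF = limit_graph "class_CF F" leq_d M A
  for F :: "real \<Rightarrow> real" and M :: "'a::infinite graph" and A +
  assumes vertex_closed: "B \<in> class_CF F \<Longrightarrow> a \<in> verts (B :: 'a graph) \<Longrightarrow> leq_d (induced B {a}) B"
    and edge_exists: "\<exists>B\<in>(class_CF F :: 'a graph set). edges B \<noteq> {}"
begin

abbreviation \<delta> :: "'a set \<Rightarrow> int" where "\<delta> \<equiv> dl M"

lemma \<delta>_simps [simp]: "\<delta> {} = 0" "\<delta> {a} = 2"
  using M_graph by simp_all

lemma str_less:
  assumes "str W" "W \<subset> X" "finite X" "X \<subseteq> V"
  shows "\<delta> W < \<delta> X"
proof -
  have l: "leq_d (ind W) (ind X)" using str_leq[OF assms(1) _ assms(3,4)] assms(2) by blast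
  have "dl (ind X) W < dl (ind X) X" using l assms(2) unfolding leq_d_iff by auto
  moreover have "dl (ind X) Z = \<delta> Z" if "Z \<subseteq> X" for Z
    by (rule dl_subgraph) (use that assms(4) in \<open>auto simp: subgraph_def\<close>)
  ultimately show ?thesis using assms(2) by auto
qed

lemma strI:
  assumes "str X" "W \<subseteq> X" "\<And>Z. W \<subset> Z \<Longrightarrow> Z \<subseteq> X \<Longrightarrow> \<delta> W < \<delta> Z"
  shows "str W"
proof (rule str_trans[OF assms(1)])
  have "dl (ind X) Z = \<delta> Z" if "Z \<subseteq> X" for Z
    by (rule dl_subgraph) (use that str_V[OF assms(1)] in \<open>auto simp: subgraph_def\<close>)
  then show "leq_d (ind W) (ind X)"
    unfolding leq_d_iff subgraph_def using assms(2,3) induced_induced[OF assms(2), of M] by auto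
qed

lemma str_vertex:
  assumes "a \<in> V"
  shows "str {a}"
proof -
  obtain i where i: "a \<in> verts (A i)" using assms verts_M by blast
  then have "leq_d (induced (A i) {a}) (A i)" by (rule vertex_closed[OF A_C])
  then show ?thesis unfolding str_def using i ind_A_mono[of "{a}" i] by auto
qed

lemma \<delta>_gt: "finite W \<Longrightarrow> W \<subseteq> V \<Longrightarrow> a \<in> W \<Longrightarrow> W \<noteq> {a} \<Longrightarrow> \<delta> W > 2"
  using str_less[OF str_vertex, of a W] by auto

lemma \<delta>_ge: "finite W \<Longrightarrow> W \<subseteq> V \<Longrightarrow> W \<noteq> {} \<Longrightarrow> \<delta> W \<ge> 2"
proof -
  assume a: "finite W" "W \<subseteq> V" "W \<noteq> {}"
  then obtain x where "x \<in> W" by blast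
  then show ?thesis using \<delta>_gt[OF a(1,2), of x] by (cases "W = {x}") auto
qed

text \<open>Some member of the class has an edge, and all vertices are strong. An edge of
  \<open>M\<close> can thus be moved so that one end is \<open>u\<close> and the other is free from
  \<open>W\<close> over \<open>u\<close>.\<close>

lemma leafy_CF: leafy
  unfolding leafy_def
proof (intro allI impI)
  fix W u assume Wu: "str W \<and> u \<in> W"
  obtain B :: "'a graph" where B: "B \<in> class_CF F" "edges B \<noteq> {}" using edge_exists by blast
  obtain e where e: "e \<in> edges B" using B(2) by blast
  obtain x y where xy: "x \<in> verts B" "y \<in> verts B" "x \<noteq> y" "e = {x, y}"
    using pair_edge[OF C_graph[OF B(1)] e] by blast
  have "{x, y} \<subseteq> verts B" using xy by simp
  from universal[OF C_induced[OF B(1) this]] obtain f where f: "inj_on f {x, y}" "str (f ` {x, y})"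
    "\<forall>u\<in>{x, y}. \<forall>v\<in>{x, y}. {u, v} \<in> edges (induced B {x, y}) \<longleftrightarrow> {f u, f v} \<in> edges M"
    unfolding verts_induced by blast
  define a where "a = f x"
  define b where "b = f y"
  have ab: "a \<noteq> b" "str {a, b}" "{a, b} \<in> edges M"
    using f e xy unfolding a_def b_def by (auto simp: inj_on_def)
  have abV: "{a, b} \<subseteq> V" using str_V[OF ab(2)] .
  have uV: "u \<in> V" using Wu str_V[of W] by auto
  have "piso {a} (\<lambda>_. u)"
    using str_vertex abV uV no_loop by (intro pisoI) auto
  then have "\<exists>h\<in>automorphisms M. (\<forall>x\<in>{a}. h x = u) \<and> h ` {a, b} \<inter> W = (\<lambda>_. u) ` {a} \<and>
      free (h ` {a, b}) W \<and> str (h ` {a, b} \<union> W)"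
    using ab(2) Wu by (intro extend) auto
  then obtain h where h: "h \<in> automorphisms M" "h a = u" "h ` {a, b} \<inter> W = {u}"
    "free (h ` {a, b}) W" "str (h ` {a, b} \<union> W)" by auto
  have "h a \<noteq> h b" using aut_inj[OF h(1) abV] ab(1) by (auto simp: inj_on_def)
  moreover have "h b = u" if "h b \<in> W"
  proof -
    have "h b \<in> h ` {a, b} \<inter> W" using that by blast
    then show ?thesis unfolding h(3) by simp
  qed
  ultimately have hb: "h b \<notin> W" using h(2) by auto
  have eq: "h ` {a, b} \<union> W = insert (h b) W" using h(2) Wu by auto
  have "h b \<in> V" using aut_in[OF h(1)] abV by auto
  moreover have "{h b, w} \<in> edges M \<longleftrightarrow> w = u" if w: "w \<in> W" for w
  proof
    assume wb: "{h b, w} \<in> edges M"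
    have "{h b, w} \<subseteq> h ` {a, b} \<union> W" using w by auto
    then have "{h b, w} \<subseteq> h ` {a, b}" using h(4) wb hb unfolding free_def by auto
    then show "w = u" using w h(3) by auto
  next
    assume "w = u"
    then show "{h b, w} \<in> edges M"
      using aut_edge[OF h(1), of a b] abV ab(3) h(2) by (auto simp: insert_commute)
  qed
  ultimately show "\<exists>l\<in>V - W. str (insert l W) \<and> (\<forall>w\<in>W. {l, w} \<in> edges M \<longleftrightarrow> w = u)"
    using h(5) eq hb by (intro bexI[of _ "h b"]) auto
qed

text \<open>Join each vertex of \<open>U\<close> to a vertex of a base none of whose vertices has an edge directed out
  to \<open>U\<close>. Then \<open>val U W\<close> is what the out-degrees in \<open>W \<supseteq> U\<close> fall short of 2 in total, provided
  all out-edges from \<open>W\<close> end in \<open>W\<close> or in the base.\<close>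

definition val :: "'a set \<Rightarrow> 'a set \<Rightarrow> int" where
  "val U W = \<delta> W - int (card (W \<inter> U))"

text \<open>This is what \<open>str_leaves\<close> needs: adding a non-empty part of the copy to its
  leaves must raise the predimension strictly. In particular \<open>val U W\<close> is at least 1
  for non-empty \<open>W\<close>, so value 1 is the best that can be reached.\<close>

definition pos :: "'a set \<Rightarrow> 'a set \<Rightarrow> bool" where
  "pos U W \<longleftrightarrow> (\<forall>X\<subseteq>W. X \<noteq> {} \<longrightarrow> val U X \<ge> 1)"

lemma val_empty [simp]: "val U {} = 0"
  by (simp add: val_def)

lemma val_Un:
  assumes "finite X" "finite Y"
  shows "val U (X \<union> Y) = val U X + val U Y - val U (X \<inter> Y) - int (card (crossing M X Y))"
proof -
  have "card ((X \<union> Y) \<inter> U) + card ((X \<inter> Y) \<inter> U) = card (X \<inter> U) + card (Y \<inter> U)"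
  proof -
    have "(X \<union> Y) \<inter> U = (X \<inter> U) \<union> (Y \<inter> U)" "(X \<inter> Y) \<inter> U = (X \<inter> U) \<inter> (Y \<inter> U)" by blast+
    then show ?thesis using card_Un_Int[of "X \<inter> U" "Y \<inter> U"] assms by simp
  qed
  then show ?thesis unfolding val_def dl_Un[OF assms] by linarith
qed

lemma val_cong: "W \<inter> U = W \<inter> U' \<Longrightarrow> val U W = val U' W"
  by (simp add: val_def)

lemma crossing_pair:
  assumes "e \<in> crossing M X Y"
  shows "\<exists>x\<in>X - Y. \<exists>y\<in>Y - X. e = {x, y}"
proof -
  have e: "e \<in> edges M" "e \<subseteq> X \<union> Y" "\<not> e \<subseteq> X" "\<not> e \<subseteq> Y" using assms unfolding crossing_def by auto
  obtain u v where uv: "e = {u, v}" using pair_edge[OF M_graph e(1)] by blast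
  consider "u \<in> X - Y" "v \<in> Y - X" | "v \<in> X - Y" "u \<in> Y - X" using e(2-4) uv by auto
  then show ?thesis using uv by cases (auto simp: insert_commute)
qed

lemma crossing_edge: "{x, y} \<in> edges M \<Longrightarrow> x \<in> X - Y \<Longrightarrow> y \<in> Y - X \<Longrightarrow> {x, y} \<in> crossing M X Y"
  unfolding crossing_def by auto

lemma crossing_le_1:
  assumes "\<And>x y. x \<in> X \<Longrightarrow> y \<in> Y \<Longrightarrow> {x, y} \<in> edges M \<Longrightarrow> x = a \<and> y = b"
  shows "card (crossing M X Y) \<le> 1"
proof -
  have "crossing M X Y \<subseteq> {{a, b}}"
  proof
    fix e assume e: "e \<in> crossing M X Y"
    then obtain x y where xy: "x \<in> X" "y \<in> Y" "e = {x, y}" using crossing_pair by blast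
    then have "{x, y} \<in> edges M" using e unfolding crossing_def by auto
    then show "e \<in> {{a, b}}" using assms[OF xy(1,2)] xy(3) by auto
  qed
  from card_mono[OF _ this] show ?thesis by simp
qed

text \<open>A set meeting both sides loses at most one edge, while each side contributes at least 1.
  Joining two sets of value 1 in this way gives value 1 again, the point of doubling a copy.\<close>

lemma pos_join:
  assumes fin: "finite X" "finite Y" and disj: "X \<inter> Y = {}" and U: "U1 \<subseteq> X" "U2 \<subseteq> Y"
    and p: "pos U1 X" "pos U2 Y" and ab: "a \<in> X" "b \<in> Y"
    and e: "\<And>x y. x \<in> X \<Longrightarrow> y \<in> Y \<Longrightarrow> {x, y} \<in> edges M \<longleftrightarrow> x = a \<and> y = b"
  shows "pos (U1 \<union> U2) (X \<union> Y)" "val (U1 \<union> U2) (X \<union> Y) = val U1 X + val U2 Y - 1"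
proof -
  have c1: "val (U1 \<union> U2) Z = val U1 Z" if "Z \<subseteq> X" for Z
    by (rule val_cong) (use that U disj in blast)
  have c2: "val (U1 \<union> U2) Z = val U2 Z" if "Z \<subseteq> Y" for Z
    by (rule val_cong) (use that U disj in blast)
  have sum: "val (U1 \<union> U2) (Z1 \<union> Z2) = val U1 Z1 + val U2 Z2 - int (card (crossing M Z1 Z2))"
    if Z: "Z1 \<subseteq> X" "Z2 \<subseteq> Y" for Z1 Z2
  proof -
    have "finite Z1" "finite Z2" "Z1 \<inter> Z2 = {}" using Z fin disj finite_subset by auto
    then show ?thesis using val_Un[of Z1 Z2 "U1 \<union> U2"] c1[OF Z(1)] c2[OF Z(2)] by simp
  qed
  show "pos (U1 \<union> U2) (X \<union> Y)"
    unfolding pos_def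
  proof (intro allI impI)
    fix Z assume Z: "Z \<subseteq> X \<union> Y" "Z \<noteq> {}"
    let ?Z1 = "Z \<inter> X" and ?Z2 = "Z \<inter> Y"
    have eq: "Z = ?Z1 \<union> ?Z2" using Z(1) by blast
    have s: "val (U1 \<union> U2) Z = val U1 ?Z1 + val U2 ?Z2 - int (card (crossing M ?Z1 ?Z2))"
      using sum[of ?Z1 ?Z2] eq by simp
    have le: "card (crossing M ?Z1 ?Z2) \<le> 1" by (rule crossing_le_1) (use e in auto)
    consider "?Z1 = {}" "?Z2 \<noteq> {}" | "?Z1 \<noteq> {}" "?Z2 = {}" | "?Z1 \<noteq> {}" "?Z2 \<noteq> {}" using Z eq by auto
    then show "val (U1 \<union> U2) Z \<ge> 1"
    proof cases
      case 1
      then have "Z \<subseteq> Y" using eq by blast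
      then show ?thesis using p(2) c2[of Z] Z(2) unfolding pos_def by simp
    next
      case 2
      then have "Z \<subseteq> X" using eq by blast
      then show ?thesis using p(1) c1[of Z] Z(2) unfolding pos_def by simp
    next
      case 3
      then have "val U1 ?Z1 \<ge> 1" "val U2 ?Z2 \<ge> 1" using p unfolding pos_def by auto
      then show ?thesis using s le by linarith
    qed
  qed
  have "{a, b} \<in> crossing M X Y" using e[OF ab] ab disj by (intro crossing_edge) auto
  then have "crossing M X Y \<noteq> {}" by blast
  then have "card (crossing M X Y) = 1"
    using crossing_le_1[of X Y a b] e finite_crossing[OF fin, of M] card_gt_0_iff[of "crossing M X Y"]
    by force
  then show "val (U1 \<union> U2) (X \<union> Y) = val U1 X + val U2 Y - 1" using sum[of X Y] by simp
qed

lemma val_singleton [simp]: "val {x} {x} = 1" "x \<notin> U \<Longrightarrow> val U {x} = 2"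
  by (simp_all add: val_def)

lemma pos_singleton: "pos {x} {x}"
  unfolding pos_def by (auto simp: subset_singleton_iff)

text \<open>A leaf that carries its own slot contributes \<open>2 - 1\<close>, and the edge
  attaching it takes 1 away.\<close>

lemma pos_leaf:
  assumes "finite W" "l \<notin> W" "U \<subseteq> W" "pos U W" "u \<in> W" "\<And>w. w \<in> W \<Longrightarrow> {l, w} \<in> edges M \<longleftrightarrow> w = u"
  shows "pos (insert l U) (insert l W)" "val (insert l U) (insert l W) = val U W"
proof -
  have d: "W \<inter> {l} = {}" using assms(2) by simp
  have e: "{x, y} \<in> edges M \<longleftrightarrow> x = u \<and> y = l" if "x \<in> W" "y \<in> {l}" for x y
    using that assms(6)[of x] by (auto simp: insert_commute)
  note j = pos_join[OF assms(1) _ d assms(3) _ assms(4) pos_singleton assms(5) _ e]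
  show "pos (insert l U) (insert l W)" using j(1) by simp
  show "val (insert l U) (insert l W) = val U W" using j(2) by simp
qed

end

section \<open>Directed paths carrying full trees\<close>

text \<open>Each path vertex has as successors the next path vertex and the root of a full tree.
  Radius \<open>n\<close> at \<open>q i\<close> uses at most the path up to
  \<open>q (i + n)\<close>, whence \<open>i + n \<le> m\<close>. The inclusion is carried through
  the induction to separate the two subtrees.\<close>

lemma chain_full:
  assumes o2: "out2 S" and q: "inj_on q {1..m}" and \<tau>: "inj_on \<tau> {1..m}"
    and sp: "spread S r (\<tau> ` {1..m})"
    and out: "\<And>i. 1 \<le> i \<Longrightarrow> i < m \<Longrightarrow> S `` {q i} = {q (Suc i), \<tau> i}"
    and disj: "\<And>i. i \<in> {1..m} \<Longrightarrow> out_ball S r (\<tau> i) \<inter> q ` {1..m} = {}"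
    and "n \<le> r" "1 \<le> i" "i + n \<le> m"
  shows "full S n (q i)"
    and "out_ball S n (q i) \<subseteq> q ` {i..m} \<union> (\<Union>j\<in>{i..m}. out_ball S r (\<tau> j))"
proof -
  have "full S n (q i) \<and> out_ball S n (q i) \<subseteq> q ` {i..m} \<union> (\<Union>j\<in>{i..m}. out_ball S r (\<tau> j))"
    using assms(7-9)
  proof (induction n arbitrary: i)
    case 0
    then show ?case by auto
  next
    case (Suc n)
    have i: "1 \<le> i" "i < m" "n \<le> r" using Suc.prems by auto
    have IH: "full S n (q (Suc i))"
      "out_ball S n (q (Suc i)) \<subseteq> q ` {Suc i..m} \<union> (\<Union>j\<in>{Suc i..m}. out_ball S r (\<tau> j))"
      using Suc.IH[of "Suc i"] Suc.prems by auto
    have mem: "q i \<in> q ` {1..m}" "q (Suc i) \<in> q ` {1..m}" using i by auto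
    have sub: "out_ball S n (\<tau> i) \<subseteq> out_ball S r (\<tau> i)" by (rule out_ball_mono[OF i(3)])
    have \<tau>i: "out_ball S r (\<tau> i) \<inter> q ` {1..m} = {}" using disj[of i] i by simp
    have \<tau>j: "out_ball S r (\<tau> i) \<inter> out_ball S r (\<tau> j) = {}" if j: "j \<in> {Suc i..m}" for j
    proof -
      have ij: "i \<in> {1..m}" "j \<in> {1..m}" "i \<noteq> j" using j i by auto
      then have "\<tau> i \<noteq> \<tau> j" using \<tau> by (auto dest: inj_onD)
      then show ?thesis using sp ij(1,2) by (simp add: spread_def)
    qed
    have fulln: "full S n (\<tau> i)"
    proof -
      have "full S r (\<tau> i)" using sp i by (simp add: spread_def)
      then show ?thesis using not_full_mono[OF o2 _ i(3)] by blast
    qed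
    have qi_notin: "q i \<notin> q ` {Suc i..m}" using q i by (auto dest: inj_onD)
    have qi_ball: "q i \<notin> out_ball S r (\<tau> j)" if "j \<in> {Suc i..m}" for j
      using disj[of j] that mem(1) i by auto
    have "full S (Suc n) (q i)"
    proof (rule full_SucI[OF o2 out[OF i(1,2)]])
      show "q (Suc i) \<noteq> \<tau> i"
      proof
        assume "q (Suc i) = \<tau> i"
        then have "\<tau> i \<in> out_ball S r (\<tau> i) \<inter> q ` {1..m}" using mem(2) by simp
        then show False using \<tau>i by blast
      qed
      show "q i \<notin> out_ball S n (q (Suc i))" using IH(2) qi_notin qi_ball by blast
      show "q i \<notin> out_ball S n (\<tau> i)" using \<tau>i mem(1) sub by blast
      show "out_ball S n (q (Suc i)) \<inter> out_ball S n (\<tau> i) = {}"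
      proof -
        have "q ` {Suc i..m} \<subseteq> q ` {1..m}" by auto
        then have "(q ` {Suc i..m} \<union> (\<Union>j\<in>{Suc i..m}. out_ball S r (\<tau> j))) \<inter> out_ball S r (\<tau> i) = {}"
          using \<tau>i \<tau>j by blast
        then show ?thesis using IH(2) sub by blast
      qed
    qed (use IH(1) fulln in auto)
    moreover have "out_ball S (Suc n) (q i) \<subseteq> q ` {i..m} \<union> (\<Union>j\<in>{i..m}. out_ball S r (\<tau> j))"
    proof -
      have mono: "q ` {Suc i..m} \<subseteq> q ` {i..m}"
        "(\<Union>j\<in>{Suc i..m}. out_ball S r (\<tau> j)) \<subseteq> (\<Union>j\<in>{i..m}. out_ball S r (\<tau> j))"
        by (intro image_mono UN_mono; auto)+
      have "i \<in> {i..m}" using i by simp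
      then have "q i \<in> q ` {i..m}" "out_ball S n (\<tau> i) \<subseteq> (\<Union>j\<in>{i..m}. out_ball S r (\<tau> j))"
        using sub by blast+
      moreover have "out_ball S n (q (Suc i)) \<subseteq> q ` {i..m} \<union> (\<Union>j\<in>{i..m}. out_ball S r (\<tau> j))"
        by (rule order_trans[OF IH(2) Un_mono[OF mono]])
      ultimately show ?thesis unfolding out_ball_Suc out[OF i(1,2)] by (simp add: le_supI2)
    qed
    ultimately show ?case by blast
  qed
  then show "full S n (q i)"
    and "out_ball S n (q i) \<subseteq> q ` {i..m} \<union> (\<Union>j\<in>{i..m}. out_ball S r (\<tau> j))" by blast+
qed

context limit_graph
begin

text \<open>\<open>arm D x m p\<close>: the path \<open>p 1, \<dots>, p m\<close> is attached to the vertex \<open>x = p 0\<close> of \<open>D\<close>.\<close>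

definition arm :: "'a set \<Rightarrow> 'a \<Rightarrow> nat \<Rightarrow> (nat \<Rightarrow> 'a) \<Rightarrow> bool" where
  "arm D x m p \<longleftrightarrow> p 0 = x \<and> inj_on p {1..m} \<and> p ` {1..m} \<inter> D = {} \<and>
    (\<forall>i\<in>{1..m}. \<forall>v\<in>D \<union> p ` {1..<i}. {p i, v} \<in> edges M \<longleftrightarrow> v = p (i - 1))"

text \<open>When no out-edge of a copy of \<open>D\<close> together with an attached path is lost, the path is directed
  away from \<open>D\<close>, so its first vertex can serve as the target of one more slot.\<close>

lemma arm_copy:
  assumes S: "two_orientation M S" and h: "h \<in> automorphisms M"
    and D: "finite D" "x0 \<in> D" "U \<subseteq> D" "D \<union> p ` {1..m} \<subseteq> V" and arm: "arm D x0 m p"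
    and m: "m = r + 2"
    and T: "h ` (D \<union> p ` {1..m}) \<inter> T = {}" "finite T" "inj_on t (U \<union> p ` {1..m})"
      "t ` (U \<union> p ` {1..m}) \<subseteq> T" "spread S r T"
    and slot: "\<And>x z. x \<in> D \<union> p ` {1..m} \<Longrightarrow> z \<in> T \<Longrightarrow>
      (h x, z) \<in> S \<longleftrightarrow> x \<in> U \<union> p ` {1..m} \<and> z = t x"
    and N: "\<And>v w. v \<in> D \<union> p ` {1..m} \<Longrightarrow> w \<in> N \<Longrightarrow> {h v, w} \<in> edges M \<Longrightarrow> v = p m"
    and out: "\<And>x. x \<in> D \<union> p ` {1..m} \<Longrightarrow> S `` {h x} \<subseteq> h ` (D \<union> p ` {1..m}) \<union> N \<union> T"
      "\<And>x. x \<in> D \<union> p ` {1..m} \<Longrightarrow> card (S `` {h x}) = 2"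
    and count: "2 * card D = card {e \<in> edges M. e \<subseteq> D} + card U + 1"
    and balls: "\<And>z. z \<in> T \<Longrightarrow> out_ball S r z \<inter> h ` (D \<union> p ` {1..m}) = {}"
    and F: "h ` (D \<union> p ` {1..m}) \<inter> F = {}"
    and X: "str (X \<union> h ` D)" "\<forall>x\<in>X. \<forall>y\<in>h ` D. {x, y} \<notin> edges M" "X \<inter> h ` D = {}"
  shows "\<exists>c. slot_copy S r D (insert (x0, 1) ((\<lambda>u. (u, 0)) ` U)) T X F h c"
proof -
  note o2 = two_orientation_out2[OF S]
  let ?P = "p ` {1..m}"
  let ?Q = "D \<union> ?P"
  have p: "p 0 = x0" "inj_on p {1..m}" "?P \<inter> D = {}"
    and adj: "\<And>i v. i \<in> {1..m} \<Longrightarrow> v \<in> D \<union> p ` {1..<i} \<Longrightarrow> {p i, v} \<in> edges M \<longleftrightarrow> v = p (i - 1)"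
    using arm unfolding arm_def by auto
  have hinj: "inj_on h ?Q" using aut_inj[OF h D(4)] .
  have edgeh: "{h u, h v} \<in> edges M \<longleftrightarrow> {u, v} \<in> edges M" if "u \<in> ?Q" "v \<in> ?Q" for u v
    using aut_edge[OF h, of u v] that D(4) by blast
  have p_mem: "p i \<in> ?P" if "i \<in> {1..m}" for i using that by blast
  have p0: "p i \<in> D \<longleftrightarrow> i = 0" if "i \<le> m" for i
  proof (cases "i = 0")
    case True
    then show ?thesis using p(1) D(2) by simp
  next
    case False
    then have "p i \<in> ?P" using that p_mem[of i] by simp
    then show ?thesis using p(3) False by blast
  qed
  have first: "(h x0, h (p 1)) \<in> S"
  proof (rule ccontr)
    assume no: "(h x0, h (p 1)) \<notin> S"
    have within: "S `` {h x} \<subseteq> h ` D \<union> T" if x: "x \<in> D" for x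
    proof
      fix w assume w: "w \<in> S `` {h x}"
      then have e: "{h x, w} \<in> edges M" using two_orientation_edge[OF S, of "h x" w] by simp
      have xQ: "x \<in> ?Q" using x by simp
      consider "w \<in> h ` D" | i where "i \<in> {1..m}" "w = h (p i)" | "w \<in> N" | "w \<in> T"
        using out(1)[OF xQ] w by blast
      then show "w \<in> h ` D \<union> T"
      proof cases
        case 2
        have "{p i, x} \<in> edges M" using e edgeh[OF xQ, of "p i"] 2 by (auto simp: insert_commute)
        then have "x = p (i - 1)" using adj[OF 2(1), of x] x by simp
        then have "i - 1 = 0" using p0[of "i - 1"] x 2(1) by auto
        then have "i = 1" "x = x0" using 2(1) \<open>x = p (i - 1)\<close> p(1) by auto
        then show ?thesis using no w 2(2) by simp
      next
        case 3
        then have "x = p m" using N[OF xQ 3 e] by simp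
        then show ?thesis using p0[of m] x m by auto
      qed auto
    qed
    have DT: "h ` D \<inter> T = {}" "D \<subseteq> V" using T(1) D(4) by auto
    have "(\<Sum>x\<in>D. card (S `` {h x} \<inter> (h ` D \<union> T))) = (\<Sum>x\<in>D. 2)"
    proof (intro sum.cong refl)
      fix x assume x: "x \<in> D"
      then have "S `` {h x} \<inter> (h ` D \<union> T) = S `` {h x}" using within by blast
      then show "card (S `` {h x} \<inter> (h ` D \<union> T)) = 2" using out(2)[of x] x by simp
    qed
    moreover have "(\<Sum>x\<in>D. card (S `` {h x} \<inter> T)) = card U"
    proof -
      have "S `` {h x} \<inter> T = (if x \<in> U then {t x} else {})" if x: "x \<in> D" for x
      proof -
        have "x \<in> U \<union> ?P \<longleftrightarrow> x \<in> U" using x p(3) by auto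
        moreover have "t x \<in> T" if "x \<in> U" using that T(4) by auto
        ultimately show ?thesis using slot[of x] x by auto
      qed
      then have "(\<Sum>x\<in>D. card (S `` {h x} \<inter> T)) = (\<Sum>x\<in>D. if x \<in> U then 1 else 0)"
        by (intro sum.cong refl) simp
      also have "\<dots> = card (D \<inter> U)" using D(1) by (simp add: sum.If_cases)
      also have "D \<inter> U = U" using D(3) by blast
      finally show ?thesis .
    qed
    ultimately show False using out_degree_sum[OF S h D(1) DT(2,1)] count by simp
  qed
  \<comment> \<open>The edge to the previous path vertex already points into \<open>p i\<close>.
    Only the next path vertex and the base vertex remain, so out-degree 2 uses both.\<close>
  have next_out: "S `` {h (p i)} = {h (p (Suc i)), t (p i)}"
    if i: "1 \<le> i" "i < m" and prev: "(h (p (i - 1)), h (p i)) \<in> S" for i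
  proof -
    have im: "i \<in> {1..m}" "p i \<in> ?Q" using i p_mem by auto
    have "S `` {h (p i)} \<subseteq> {h (p (Suc i)), t (p i)}"
    proof
      fix w assume "w \<in> S `` {h (p i)}"
      then have w: "(h (p i), w) \<in> S" "{h (p i), w} \<in> edges M"
        using two_orientation_edge[OF S, of "h (p i)" w] by auto
      consider v where "v \<in> D \<union> p ` {1..<i}" "w = h v" | j where "j \<in> {i..m}" "w = h (p j)"
        | "w \<in> N" | "w \<in> T"
      proof -
        have "w \<in> h ` ?Q \<union> N \<union> T" using out(1)[OF im(2)] w(1) by blast
        moreover have "{1..m} = {1..<i} \<union> {i..m}" using i by auto
        then have "h ` ?Q = h ` (D \<union> p ` {1..<i}) \<union> (h \<circ> p) ` {i..m}" by (simp add: image_Un image_comp Un_assoc)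
        ultimately have "w \<in> h ` (D \<union> p ` {1..<i}) \<or> w \<in> (h \<circ> p) ` {i..m} \<or> w \<in> N \<or> w \<in> T" by simp
        then show ?thesis
        proof (elim disjE)
          assume "w \<in> h ` (D \<union> p ` {1..<i})"
          then show ?thesis using that(1) by blast
        next
          assume "w \<in> (h \<circ> p) ` {i..m}"
          then obtain j where "j \<in> {i..m}" "w = (h \<circ> p) j" by blast
          then show ?thesis using that(2)[of j] by simp
        qed (use that(3,4) in simp_all)
      qed
      then show "w \<in> {h (p (Suc i)), t (p i)}"
      proof cases
        case 1
        have vQ: "v \<in> ?Q" using 1(1) i by auto
        have "{p i, v} \<in> edges M" using w(2) edgeh[OF im(2) vQ] 1(2) by simp
        then have "v = p (i - 1)" using adj[OF im(1) 1(1)] by simp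
        then have "(w, h (p i)) \<in> S" using prev 1(2) by simp
        then show ?thesis using two_orientation_dir[OF S w(2)] w(1) by simp
      next
        case 2
        have jm: "j \<in> {1..m}" "p j \<in> ?Q" using 2(1) i p_mem by auto
        have e: "{p i, p j} \<in> edges M" using w(2) edgeh[OF im(2) jm(2)] 2(2) by simp
        then have "i \<noteq> j" using no_loop[of "p i"] by auto
        then have ij: "i < j" using 2(1) by auto
        then have "p i \<in> D \<union> p ` {1..<j}" using i by auto
        then have "p i = p (j - 1)" using adj[OF jm(1)] e by (simp add: insert_commute)
        moreover have "j - 1 \<in> {1..m}" using jm(1) ij i by auto
        ultimately have "i = j - 1" using inj_onD[OF p(2), of i "j - 1"] im(1) by blast
        then have "j = Suc i" using ij by simp
        then show ?thesis using 2(2) by simp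
      next
        case 3
        then have "p i = p m" using N[OF im(2) 3 w(2)] by simp
        then show ?thesis using inj_onD[OF p(2), of i m] im(1) i by auto
      next
        case 4
        then show ?thesis using slot[OF im(2) 4] w(1) by simp
      qed
    qed
    moreover have "card (S `` {h (p i)}) = 2" using out(2)[OF im(2)] .
    ultimately show ?thesis
      by (intro card_seteq) (auto simp: card_insert_if)
  qed
  have chain: "(h (p (i - 1)), h (p i)) \<in> S" if "1 \<le> i" "i \<le> m" for i
    using that
  proof (induction i rule: dec_induct)
    case base
    then show ?case using first p(1) by simp
  next
    case (step i)
    then have "S `` {h (p i)} = {h (p (Suc i)), t (p i)}" by (intro next_out) auto
    then show ?case by auto
  qed
  have out_chain: "S `` {h (p i)} = {h (p (Suc i)), t (p i)}" if "1 \<le> i" "i < m" for i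
    using next_out[OF that] chain[of i] that by simp
  let ?q = "h \<circ> p" and ?\<tau> = "t \<circ> p"
  have \<tau>T: "?\<tau> ` {1..m} \<subseteq> T" using T(4) by auto
  have sp\<tau>: "spread S r (?\<tau> ` {1..m})" using spread_subset[OF T(5) \<tau>T] .
  have inj\<tau>: "inj_on ?\<tau> {1..m}" using p(2) T(3) by (intro comp_inj_on) (auto elim: inj_on_subset)
  have injq: "inj_on ?q {1..m}" using p(2) hinj by (intro comp_inj_on) (auto elim: inj_on_subset)
  have disj: "out_ball S r (?\<tau> i) \<inter> ?q ` {1..m} = {}" if "i \<in> {1..m}" for i
  proof -
    have "?\<tau> i \<in> T" using \<tau>T that by blast
    then show ?thesis using balls by (auto simp: image_comp[symmetric])
  qed
  \<comment> \<open>The length \<open>r + 2\<close> exceeds 1 even for \<open>r = 0\<close>, so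
    \<open>p 1\<close> always has a known pair of successors, one of them in \<open>T\<close>;
    fading of \<open>p 1\<close> relies on this.\<close>
  have full1: "full S r (h (p 1))"
    and ball1: "out_ball S r (h (p 1)) \<subseteq> h ` ?P \<union> (\<Union>j\<in>{1..m}. out_ball S r (t (p j)))"
    using chain_full[OF o2 injq inj\<tau> sp\<tau> _ disj order_refl, of 1] out_chain m
    by (simp_all add: image_image)
  let ?I = "insert (x0, 1) ((\<lambda>u. (u, 0 :: nat)) ` U)"
  \<comment> \<open>The second component labels the kind of target, 0 for a base vertex and 1 for
    the start of the path. Hence \<open>x0\<close> may carry a slot of each kind.\<close>
  let ?c = "\<lambda>i :: 'a \<times> nat. if snd i = 0 then t (fst i) else h (p 1)"
  have cI: "?c i \<in> T \<and> fst i \<in> U \<and> ?c i = t (fst i) \<or> i = (x0, 1)" if "i \<in> ?I" for i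
    using that T(4) by auto
  have "p 1 \<in> ?P" by (rule p_mem) (use m in simp)
  then have hp1: "h (p 1) \<in> h ` ?P" "h (p 1) \<notin> T" using T(1) by blast+
  have PD: "h ` ?P \<inter> h ` D = {}"
    using inj_on_image_Int[OF hinj, of ?P D] p(3) by auto
  have tu_p1: "out_ball S r (t u) \<inter> out_ball S r (h (p 1)) = {}" if u: "u \<in> U" for u
  proof -
    have tT: "t u \<in> T" using T(4) u by auto
    have "out_ball S r (t u) \<inter> out_ball S r (t (p j)) = {}" if j: "j \<in> {1..m}" for j
    proof -
      have pj: "p j \<in> ?P" by (rule p_mem[OF j])
      then have "u \<noteq> p j" using u p(3) D(3) by blast
      then have "t u \<noteq> t (p j)" using inj_onD[OF T(3), of u "p j"] u pj by blast
      moreover have "t (p j) \<in> T" using T(4) pj by blast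
      ultimately show ?thesis using T(5) tT by (simp add: spread_def)
    qed
    then have "out_ball S r (t u) \<inter> (\<Union>j\<in>{1..m}. out_ball S r (t (p j))) = {}" by blast
    moreover have "out_ball S r (t u) \<inter> h ` ?P = {}" using balls[OF tT] by blast
    ultimately have "out_ball S r (t u) \<inter> (h ` ?P \<union> (\<Union>j\<in>{1..m}. out_ball S r (t (p j)))) = {}"
      by (simp only: Int_Un_distrib Un_empty)
    then show ?thesis using ball1 by (metis Int_mono order_refl subset_empty)
  qed
  have "slot_copy S r D ?I T X F h ?c"
    unfolding slot_copy_def
  proof (intro conjI)
    show "h \<in> automorphisms M" by (rule h)
    show "inj_on ?c ?I"
    proof (rule inj_onI)
      fix i j assume ij: "i \<in> ?I" "j \<in> ?I" "?c i = ?c j"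
      consider "fst i \<in> U" "snd i = 0" "fst j \<in> U" "snd j = 0" | "i = (x0, 1)" "j = (x0, 1)"
        | "i = (x0, 1)" "fst j \<in> U" "snd j = 0" | "fst i \<in> U" "snd i = 0" "j = (x0, 1)"
        using ij(1,2) by auto
      then show "i = j"
      proof cases
        case 1
        then have "fst i = fst j" using ij(3) inj_onD[OF T(3), of "fst i" "fst j"] by simp
        then show ?thesis using 1 by (simp add: prod_eq_iff)
      next
        case 3
        then have "h (p 1) = t (fst j)" "t (fst j) \<in> T" using ij(3) T(4) by auto
        then show ?thesis using hp1(2) by simp
      next
        case 4
        then have "h (p 1) = t (fst i)" "t (fst i) \<in> T" using ij(3) T(4) by auto
        then show ?thesis using hp1(2) by simp
      qed simp
    qed
    show "h ` D \<inter> F = {}" using F by auto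
    show "\<forall>x\<in>D. \<forall>i\<in>?I. (h x, ?c i) \<in> S \<longleftrightarrow> fst i = x"
    proof (intro ballI)
      fix x i assume x: "x \<in> D" and i: "i \<in> ?I"
      consider "i = (x0, 1)" | u where "u \<in> U" "i = (u, 0)" using i by blast
      then show "(h x, ?c i) \<in> S \<longleftrightarrow> fst i = x"
      proof cases
        case 1
        have "(h x, h (p 1)) \<in> S \<longleftrightarrow> x0 = x"
        proof
          assume "(h x, h (p 1)) \<in> S"
          then have "{h x, h (p 1)} \<in> edges M" by (rule two_orientation_edge[OF S])
          then have "{p 1, x} \<in> edges M" using edgeh[of x "p 1"] x p_mem[of 1] m by (auto simp: insert_commute)
          then show "x0 = x" using adj[of 1 x] x m p(1) by simp
        qed (use first in simp)
        then show ?thesis using 1 by simp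
      next
        case 2
        have tT: "t u \<in> T" using T(4) 2(1) by auto
        have "(h x, t u) \<in> S \<longleftrightarrow> x \<in> U \<union> ?P \<and> t u = t x" using slot[of x "t u"] x tT by simp
        also have "\<dots> \<longleftrightarrow> u = x" using 2(1) inj_onD[OF T(3), of u x] by auto
        finally show ?thesis using 2(2) by simp
      qed
    qed
    show "\<forall>x\<in>D. card (S `` {h x}) = 2 \<and> S `` {h x} \<subseteq> h ` D \<union> ?c ` ?I"
    proof (intro ballI conjI)
      fix x assume x: "x \<in> D"
      then have xQ: "x \<in> ?Q" by simp
      show "card (S `` {h x}) = 2" using out(2)[OF xQ] .
      show "S `` {h x} \<subseteq> h ` D \<union> ?c ` ?I"
      proof
        fix w assume "w \<in> S `` {h x}"
        then have w: "(h x, w) \<in> S" "{h x, w} \<in> edges M"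
          using two_orientation_edge[OF S, of "h x" w] by auto
        consider "w \<in> h ` D" | i where "i \<in> {1..m}" "w = h (p i)" | "w \<in> N" | "w \<in> T"
          using out(1)[OF xQ] w by blast
        then show "w \<in> h ` D \<union> ?c ` ?I"
        proof cases
          case 2
          have "{p i, x} \<in> edges M" using w(2) edgeh[OF xQ, of "p i"] 2 by (auto simp: insert_commute)
          then have xp: "x = p (i - 1)" using adj[OF 2(1), of x] x by simp
          then have "i - 1 = 0" using p0[of "i - 1"] x 2(1) by auto
          then have "i = 1" using 2(1) by auto
          then have "w = ?c (x0, 1)" using 2(2) by simp
          then show ?thesis by blast
        next
          case 3
          then have "x = p m" using N[OF xQ 3 w(2)] by simp
          then show ?thesis using p0[of m] x m by auto
        next
          case 4
          then have "x \<in> U \<union> ?P" "w = t x" using slot[OF xQ 4] w(1) by auto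
          then have "x \<in> U" using x p(3) by auto
          then have "(x, 0) \<in> ?I" "w = ?c (x, 0)" using \<open>w = t x\<close> by auto
          then show ?thesis by blast
        qed simp
      qed
    qed
    show "spread S r (?c ` ?I)"
      unfolding spread_def
    proof (intro conjI ballI impI)
      show "finite (?c ` ?I)" using finite_subset[OF D(3,1)] by simp
      fix z assume z: "z \<in> ?c ` ?I"
      then have z': "z \<in> t ` U \<or> z = h (p 1)" by auto
      show "full S r z" using z' full1 T(4,5) unfolding spread_def by auto
      fix w assume w: "w \<in> ?c ` ?I" "z \<noteq> w"
      then have w': "w \<in> t ` U \<or> w = h (p 1)" by auto
      show "out_ball S r z \<inter> out_ball S r w = {}"
      proof (cases "z \<in> t ` U \<and> w \<in> t ` U")
        case True
        then have "z \<in> T" "w \<in> T" using T(4) by auto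
        then show ?thesis using T(5) w(2) by (simp add: spread_def)
      next
        case False
        then consider u where "u \<in> U" "z = t u" "w = h (p 1)" | u where "u \<in> U" "w = t u" "z = h (p 1)"
          using z' w' w(2) by blast
        then show ?thesis using tu_p1 by cases (auto simp: Int_commute)
      qed
    qed
    have ball_p1_D: "out_ball S r (h (p 1)) \<inter> h ` D = {}"
    proof -
      have "out_ball S r (t (p j)) \<inter> h ` D = {}" if "j \<in> {1..m}" for j
      proof -
        have "t (p j) \<in> T" using T(4) p_mem[OF that] by blast
        then show ?thesis using balls by blast
      qed
      then have "(\<Union>j\<in>{1..m}. out_ball S r (t (p j))) \<inter> h ` D = {}" by blast
      then have "(h ` ?P \<union> (\<Union>j\<in>{1..m}. out_ball S r (t (p j)))) \<inter> h ` D = {}"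
        using PD by (simp only: Int_Un_distrib2 Un_empty)
      then show ?thesis using ball1 by (metis Int_mono order_refl subset_empty)
    qed
    show "\<forall>i\<in>?I. out_ball S r (?c i) \<inter> h ` D = {}"
    proof
      fix i assume "i \<in> ?I"
      from cI[OF this] show "out_ball S r (?c i) \<inter> h ` D = {}"
      proof
        assume "?c i \<in> T \<and> fst i \<in> U \<and> ?c i = t (fst i)"
        then show ?thesis using balls[of "?c i"] by blast
      qed (use ball_p1_D in simp)
    qed
    show "\<forall>i\<in>?I. out_ball S r (?c i) \<inter> F \<subseteq> (\<Union>t\<in>T. out_ball S r t)"
    proof
      fix i assume "i \<in> ?I"
      from cI[OF this] show "out_ball S r (?c i) \<inter> F \<subseteq> (\<Union>t\<in>T. out_ball S r t)"
      proof
        assume i: "i = (x0, 1)"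
        have "h ` ?P \<inter> F = {}" using F by auto
        moreover have "(\<Union>j\<in>{1..m}. out_ball S r (t (p j))) \<subseteq> (\<Union>t\<in>T. out_ball S r t)"
          using T(4) p_mem by (intro UN_least) blast
        ultimately have "(h ` ?P \<union> (\<Union>j\<in>{1..m}. out_ball S r (t (p j)))) \<inter> F \<subseteq> (\<Union>t\<in>T. out_ball S r t)"
          by blast
        then have "out_ball S r (h (p 1)) \<inter> F \<subseteq> (\<Union>t\<in>T. out_ball S r t)"
          by (rule order_trans[OF Int_mono[OF ball1 order_refl]])
        then show ?thesis using i by simp
      qed blast
    qed
    show "(\<forall>t\<in>T. fades S t) \<longrightarrow> (\<forall>i\<in>?I. fades S (?c i))"
    proof (intro impI ballI)
      fix i assume f: "\<forall>t\<in>T. fades S t" and "i \<in> ?I"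
      from cI[OF this(2)] show "fades S (?c i)"
      proof
        assume i: "i = (x0, 1)"
        have "t (p 1) \<in> T" using T(4) \<open>p 1 \<in> ?P\<close> by blast
        then have "fades S (t (p 1))" using f by blast
        moreover have "(h (p 1), t (p 1)) \<in> S" using out_chain[of 1] m by auto
        ultimately have "fades S (h (p 1))" using fades_pred[OF o2] by blast
        then show ?thesis using i by simp
      qed (use f in blast)
    qed
  qed (use X in auto)
  then show ?thesis by blast
qed

end

context limit_CF
begin

text \<open>The path grows by leaves, each of which is put into \<open>U\<close>, so
  \<open>pos_leaf\<close> keeps positivity and the value.\<close>

lemma arm_exists:
  assumes D: "str D" "x0 \<in> D" "U \<subseteq> D" "pos U D"
  shows "\<exists>p. arm D x0 m p \<and> str (D \<union> p ` {1..m}) \<and> pos (U \<union> p ` {1..m}) (D \<union> p ` {1..m}) \<and>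
    val (U \<union> p ` {1..m}) (D \<union> p ` {1..m}) = val U D"
proof (induction m)
  case 0
  show ?case using D by (intro exI[of _ "\<lambda>_. x0"]) (auto simp: arm_def)
next
  case (Suc m)
  then obtain p where p: "arm D x0 m p" "str (D \<union> p ` {1..m})" "pos (U \<union> p ` {1..m}) (D \<union> p ` {1..m})"
    "val (U \<union> p ` {1..m}) (D \<union> p ` {1..m}) = val U D" by blast
  let ?P = "p ` {1..m}"
  have p': "p 0 = x0" "inj_on p {1..m}" "?P \<inter> D = {}"
    and adj: "\<And>i v. i \<in> {1..m} \<Longrightarrow> v \<in> D \<union> p ` {1..<i} \<Longrightarrow> {p i, v} \<in> edges M \<longleftrightarrow> v = p (i - 1)"
    using p(1) unfolding arm_def by auto
  have pm: "p m \<in> D \<union> ?P" using p'(1) D(2) by (cases "m = 0") auto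
  obtain l where l: "l \<in> V - (D \<union> ?P)" "str (insert l (D \<union> ?P))"
    "\<forall>w\<in>D \<union> ?P. {l, w} \<in> edges M \<longleftrightarrow> w = p m"
    using leafy_CF p(2) pm unfolding leafy_def by blast
  let ?p = "p(Suc m := l)"
  have im: "?p ` {1..k} = p ` {1..k}" "?p ` {1..<Suc k} = p ` {1..<Suc k}" if "k \<le> m" for k
    using that by (auto intro!: image_cong)
  have "{1..Suc m} = insert (Suc m) {1..m}" by auto
  moreover have "?p ` insert (Suc m) {1..m} = insert l (?p ` {1..m})" by (simp only: image_insert fun_upd_same)
  ultimately have imS: "?p ` {1..Suc m} = insert l ?P" using im(1)[of m] by simp
  have "arm D x0 (Suc m) ?p"
    unfolding arm_def
  proof (intro conjI ballI)
    show "?p 0 = x0" using p'(1) by simp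
    have "inj_on ?p {1..m} \<longleftrightarrow> inj_on p {1..m}" by (rule inj_on_cong) simp
    with p'(2) have "inj_on ?p {1..m}" by simp
    then show "inj_on ?p {1..Suc m}"
      using l(1) im(1)[of m] unfolding \<open>{1..Suc m} = insert (Suc m) {1..m}\<close> inj_on_insert by simp
    show "?p ` {1..Suc m} \<inter> D = {}" unfolding imS using p'(3) l(1) by auto
    fix i v assume i: "i \<in> {1..Suc m}" and v: "v \<in> D \<union> ?p ` {1..<i}"
    show "{?p i, v} \<in> edges M \<longleftrightarrow> v = ?p (i - 1)"
    proof (cases "i = Suc m")
      case True
      then have "v \<in> D \<union> ?P" using v im(2)[of m] by (auto simp: atLeastLessThanSuc_atLeastAtMost)
      then show ?thesis using l(3) True by simp
    next
      case False
      then have i': "i \<in> {1..m}" using i by auto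
      then have "i = Suc (i - 1)" by auto
      then have "?p ` {1..<i} = p ` {1..<i}" using im(2)[of "i - 1"] i' by (metis atLeastAtMost_iff diff_le_self le_trans)
      then show ?thesis using adj[OF i'] v i' False by auto
    qed
  qed
  moreover have eq: "D \<union> ?p ` {1..Suc m} = insert l (D \<union> ?P)" "U \<union> ?p ` {1..Suc m} = insert l (U \<union> ?P)"
    unfolding imS by auto
  moreover have "pos (insert l (U \<union> ?P)) (insert l (D \<union> ?P))"
    "val (insert l (U \<union> ?P)) (insert l (D \<union> ?P)) = val (U \<union> ?P) (D \<union> ?P)"
    using pos_leaf[OF str_finite[OF p(2)], of l "U \<union> ?P" "p m"] l p(3) D(3) pm by auto
  ultimately show ?case using l(2) p(4) by (intro exI[of _ ?p]) (simp only: eq)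
qed

lemma \<delta>_aut: "g \<in> automorphisms M \<Longrightarrow> W \<subseteq> V \<Longrightarrow> \<delta> (g ` W) = \<delta> W"
proof -
  assume g: "g \<in> automorphisms M" "W \<subseteq> V"
  have "dl (ind (g ` W)) (g ` W) = dl (ind W) W"
    using dl_gmap[OF is_graph_ind, of g W W] aut_inj[OF g] aut_gmap[OF g] by simp
  then show ?thesis by (simp add: dl_def)
qed

lemma pos_aut:
  assumes g: "g \<in> automorphisms M" and W: "W \<subseteq> V" "U \<subseteq> W" "pos U W"
  shows "pos (g ` U) (g ` W)" "val (g ` U) (g ` W) = val U W"
proof -
  have v: "val (g ` U) (g ` X) = val U X" if X: "X \<subseteq> W" for X
  proof -
    have inj: "inj_on g W" using aut_inj[OF g W(1)] .
    have "g ` X \<inter> g ` U = g ` (X \<inter> U)" using inj_on_image_Int[OF inj X W(2)] by simp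
    moreover have "card (g ` (X \<inter> U)) = card (X \<inter> U)" by (rule card_image, rule inj_on_subset[OF inj]) (use X in auto)
    ultimately show ?thesis unfolding val_def using \<delta>_aut[OF g, of X] X W(1) by simp
  qed
  show "val (g ` U) (g ` W) = val U W" using v by simp
  show "pos (g ` U) (g ` W)"
    unfolding pos_def
  proof (intro allI impI)
    fix Z assume "Z \<subseteq> g ` W" "Z \<noteq> {}"
    then obtain X where "X \<subseteq> W" "Z = g ` X" "X \<noteq> {}" by (metis image_is_empty subset_imageE)
    then show "val (g ` U) Z \<ge> 1" using v W(3) unfolding pos_def by simp
  qed
qed

text \<open>A leaf \<open>l\<close> is attached at \<open>q\<close>, and a copy of \<open>Q\<close>
  is amalgamated over \<open>l\<close> in the place of \<open>q\<close>. The only edge between the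
  two copies is the one from \<open>q\<close> to \<open>l\<close>.\<close>

lemma double:
  assumes Q: "str Q" "q \<in> Q"
  shows "\<exists>g\<in>automorphisms M. Q \<inter> g ` Q = {} \<and> str (Q \<union> g ` Q) \<and>
    (\<forall>v\<in>Q. \<forall>w\<in>g ` Q. {v, w} \<in> edges M \<longleftrightarrow> v = q \<and> w = g q)"
proof -
  obtain l where l: "l \<in> V - Q" "str (insert l Q)" "\<forall>w\<in>Q. {l, w} \<in> edges M \<longleftrightarrow> w = q"
    using leafy_CF Q unfolding leafy_def by blast
  have qV: "q \<in> V" using str_V[OF Q(1)] Q(2) by blast
  have "piso {q} (\<lambda>_. l)" using str_vertex qV l(1) no_loop by (intro pisoI) auto
  then have "\<exists>g\<in>automorphisms M. (\<forall>x\<in>{q}. g x = l) \<and> g ` Q \<inter> insert l Q = (\<lambda>_. l) ` {q} \<and>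
      free (g ` Q) (insert l Q) \<and> str (g ` Q \<union> insert l Q)"
    using Q l(2) by (intro extend) auto
  then obtain g where g: "g \<in> automorphisms M" "g q = l" "g ` Q \<inter> insert l Q = {l}"
    "free (g ` Q) (insert l Q)" "str (g ` Q \<union> insert l Q)" by auto
  have lg: "l \<in> g ` Q" using g(2) Q(2) by blast
  have "Q \<inter> g ` Q \<subseteq> g ` Q \<inter> insert l Q" by blast
  then have disj: "Q \<inter> g ` Q = {}" unfolding g(3) using l(1) by blast
  have "g ` Q \<union> insert l Q = Q \<union> g ` Q" using lg by auto
  moreover have "{v, w} \<in> edges M \<longleftrightarrow> v = q \<and> w = g q" if v: "v \<in> Q" and w: "w \<in> g ` Q" for v w
  proof
    assume e: "{v, w} \<in> edges M"
    have "\<not> {v, w} \<subseteq> g ` Q" using v disj by auto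
    then have "{v, w} \<subseteq> insert l Q" using g(4) e v w unfolding free_def by auto
    then have "w = l" using w g(3) by auto
    then show "v = q \<and> w = g q" using e l(3) v g(2) by (auto simp: insert_commute)
  next
    assume "v = q \<and> w = g q"
    then show "{v, w} \<in> edges M" using l(3) Q(2) g(2) by (auto simp: insert_commute)
  qed
  ultimately show ?thesis using g(1,5) disj by (intro bexI[of _ g]) auto
qed

text \<open>Adding a part \<open>?X\<close> of \<open>K\<close> to the leaves adds
  \<open>\<delta> ?X\<close> and at most one edge for each vertex of \<open>?X \<inter> U\<close>.
  The gain is at least \<open>val U ?X\<close>, which is positive.\<close>

lemma str_leaves:
  assumes K: "str (K \<union> l ` I)" and I: "I = (\<lambda>u. (u, 0 :: nat)) ` U" "U \<subseteq> K" and p: "pos U K"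
    and l: "l ` I \<inter> K = {}" "\<forall>i\<in>I. \<forall>v\<in>K \<union> l ` I. {l i, v} \<in> edges M \<longleftrightarrow> v = fst i"
  shows "str (l ` I)"
proof (rule strI[OF K])
  have fin: "finite K" "finite (l ` I)" using str_finite[OF K] by auto
  fix Z assume Z: "l ` I \<subset> Z" "Z \<subseteq> K \<union> l ` I"
  let ?X = "Z \<inter> K"
  have eq: "Z = l ` I \<union> ?X" "l ` I \<inter> ?X = {}" "?X \<noteq> {}" using Z l(1) by auto
  have "crossing M (l ` I) ?X \<subseteq> (\<lambda>u. {l (u, 0), u}) ` (?X \<inter> U)"
  proof
    fix e assume e: "e \<in> crossing M (l ` I) ?X"
    then obtain x v where xv: "x \<in> l ` I" "v \<in> ?X" "e = {x, v}" using crossing_pair by blast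
    then obtain i where i: "i \<in> I" "x = l i" by blast
    have "{l i, v} \<in> edges M" using e xv(3) i(2) unfolding crossing_def by simp
    then have "v = fst i" using l(2) i(1) xv(2) by auto
    then have "v \<in> U" "i = (v, 0)" using i(1) I(1) by auto
    then show "e \<in> (\<lambda>u. {l (u, 0), u}) ` (?X \<inter> U)" using xv(2,3) i(2) by blast
  qed
  then have "card (crossing M (l ` I) ?X) \<le> card ((\<lambda>u. {l (u, 0), u}) ` (?X \<inter> U))"
    using fin(1) by (intro card_mono) auto
  also have "\<dots> \<le> card (?X \<inter> U)" using fin(1) by (intro card_image_le) auto
  finally have c: "card (crossing M (l ` I) ?X) \<le> card (?X \<inter> U)" .
  have "\<delta> (l ` I \<union> ?X) = \<delta> (l ` I) + \<delta> ?X - int (card (crossing M (l ` I) ?X))"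
    using dl_Un[OF fin(2), of ?X M] fin(1) eq(2) by simp
  moreover have "val U ?X \<ge> 1" using p eq(3) unfolding pos_def by auto
  ultimately have "\<delta> (l ` I) < \<delta> (l ` I \<union> ?X)" using c unfolding val_def by linarith
  then show "\<delta> (l ` I) < \<delta> Z" using eq(1) by simp
qed auto

text \<open>Here a total of one out-edge is lost. Two copies of \<open>D\<close>, with paths attached at \<open>x\<close> whose
  ends are joined by an edge, lose one out-edge together, so one of them loses none and its path
  provides the extra slot \<open>(x, 1)\<close>.\<close>

definition slot_d :: "'a set \<Rightarrow> ('a \<times> nat) set \<Rightarrow> bool" where
  "slot_d D I \<longleftrightarrow> str D \<and> (\<exists>U x. U \<subseteq> D \<and> x \<in> D \<and> pos U D \<and> val U D = 1 \<and>
    I = insert (x, 1) ((\<lambda>u. (u, 0)) ` U))"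

lemma slot_d_copies:
  assumes sl: "slot_d D I"
  shows "\<exists>k. \<forall>S T X F. two_orientation M S \<and> card T = k \<and> str X \<and> str T \<and>
      str (X \<union> T) \<and> X \<inter> T = {} \<and> indep (X \<union> T) \<and> spread S r T \<and> finite F \<and> F \<subseteq> V \<longrightarrow>
      (\<exists>h c. slot_copy S r D I T X F h c)"
proof -
  obtain U x0 where D: "str D" "U \<subseteq> D" "x0 \<in> D" "pos U D" "val U D = 1"
    and I: "I = insert (x0, 1) ((\<lambda>u. (u, 0)) ` U)" using sl unfolding slot_d_def by blast
  have DV: "finite D" "D \<subseteq> V" using str_finite[OF D(1)] str_V[OF D(1)] .
  have DU: "D \<inter> U = U" using D(2) by blast
  have "\<delta> D = int (card U) + 1" using D(5) DU unfolding val_def by simp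
  then have count: "2 * card D = card {e \<in> edges M. e \<subseteq> D} + card U + 1" unfolding dl_def by linarith
  define m where "m = r + 2"
  obtain p where p: "arm D x0 m p" "str (D \<union> p ` {1..m})"
    "pos (U \<union> p ` {1..m}) (D \<union> p ` {1..m})" "val (U \<union> p ` {1..m}) (D \<union> p ` {1..m}) = val U D"
    using arm_exists[OF D(1,3,2,4), of m] by blast
  define Q where "Q = D \<union> p ` {1..m}"
  define UQ where "UQ = U \<union> p ` {1..m}"
  have Q: "str Q" "pos UQ Q" "val UQ Q = 1" "UQ \<subseteq> Q" "D \<subseteq> Q"
    using p D(2,5) unfolding Q_def UQ_def by auto
  have QV: "finite Q" "Q \<subseteq> V" using str_finite[OF Q(1)] str_V[OF Q(1)] .
  have pm: "p m \<in> Q" unfolding Q_def m_def by auto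
  obtain g where g: "g \<in> automorphisms M" "Q \<inter> g ` Q = {}" "str (Q \<union> g ` Q)"
    "\<forall>v\<in>Q. \<forall>w\<in>g ` Q. {v, w} \<in> edges M \<longleftrightarrow> v = p m \<and> w = g (p m)"
    using double[OF Q(1) pm] by blast
  define K where "K = Q \<union> g ` Q"
  define UK where "UK = UQ \<union> g ` UQ"
  have gpm: "g (p m) \<in> g ` Q" using pm by blast
  have gUQ: "g ` UQ \<subseteq> g ` Q" using Q(4) by blast
  \<comment> \<open>Each copy with its path has value 1, and the joining edge takes 1 away, so the
    pair still loses only one out-edge in total.\<close>
  have K: "pos UK K" "val UK K = 1"
    using pos_join[OF QV(1) finite_imageI[OF QV(1)] g(2) Q(4) gUQ Q(2) pos_aut(1)[OF g(1) QV(2) Q(4,2)] pm gpm]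
      g(4) pos_aut(2)[OF g(1) QV(2) Q(4,2)] Q(3) unfolding K_def UK_def by auto
  have sK: "str K" "finite K" "K \<subseteq> V" "UK \<subseteq> K"
    using g(3) str_finite[OF g(3)] str_V[OF g(3)] Q(4) unfolding K_def UK_def by auto
  have "K \<inter> UK = UK" using sK(4) by blast
  then have "\<delta> K = int (card UK) + 1" using K(2) unfolding val_def by simp
  then have countK: "2 * card K = card {e \<in> edges M. e \<subseteq> K} + card UK + 1" unfolding dl_def by linarith
  define IK where "IK = (\<lambda>u. (u, 0 :: nat)) ` UK"
  have IK: "finite IK" "fst ` IK \<subseteq> K" "card IK = card UK"
    using sK(4) finite_subset[OF sK(4,2)] unfolding IK_def by (auto simp: card_image inj_on_def)
  obtain l where l: "inj_on l IK" "l ` IK \<inter> K = {}" "str (K \<union> l ` IK)"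
    "\<forall>i\<in>IK. \<forall>v\<in>K \<union> l ` IK. {l i, v} \<in> edges M \<longleftrightarrow> v = fst i"
    using leaves[OF leafy_CF sK(1) IK(1,2)] by blast
  have L: "str (l ` IK)" by (rule str_leaves[OF l(3) IK_def sK(4) K(1) l(2,4)])
  have iL: "indep (l ` IK)"
    unfolding indep_def
  proof (intro ballI)
    fix x y assume "x \<in> l ` IK" and y: "y \<in> l ` IK"
    then obtain i where i: "i \<in> IK" "x = l i" by blast
    have "y \<noteq> fst i" using y l(2) IK(2) i(1) by auto
    then show "{x, y} \<notin> edges M" using l(4) i y by blast
  qed
  have lV: "l ` IK \<subseteq> V" using str_V[OF L] .
  show ?thesis
  proof (intro exI[of _ "card IK"] allI impI)
    fix S T X F
    assume a: "two_orientation M S \<and> card T = card IK \<and> str X \<and> str T \<and>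
      str (X \<union> T) \<and> X \<inter> T = {} \<and> indep (X \<union> T) \<and> spread S r T \<and> finite F \<and> F \<subseteq> V"
    then have S: "two_orientation M S" and T: "card T = card (l ` IK)" "str T" "spread S r T"
      and X: "str X" "str (X \<union> T)" "X \<inter> T = {}" "indep (X \<union> T)" and F: "finite F" "F \<subseteq> V"
      using card_image[OF l(1)] by auto
    note o2 = two_orientation_out2[OF S]
    have SV: "S \<subseteq> V \<times> V" using two_orientation_sub[OF S] .
    have iT: "indep T" using X(4) unfolding indep_def by auto
    have TV: "finite T" "T \<subseteq> V" using str_finite[OF T(2)] str_V[OF T(2)] .
    \<comment> \<open>Avoiding the out-neighbours of \<open>T\<close> again forces the edges between
      copies and base to point to the base.\<close>
    let ?Z = "F \<union> (\<Union>t\<in>T. out_ball S r t) \<union> S `` T"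
    have "finite (S `` T)"
      unfolding Image_eq_UN[of S T] using TV(1) o2 by (simp add: out2_def)
    then have Z: "finite ?Z" using F(1) TV(1) finite_out_ball[OF o2] by simp
    have ZV: "?Z \<subseteq> V" using F(2) out_ball_sub[OF SV] TV(2) SV by (intro Un_least UN_least) auto
    obtain H where H: "H \<in> automorphisms M" "H ` l ` IK = T" "H ` K \<inter> (?Z \<union> X \<union> T) = {}"
      "\<forall>x\<in>X. \<forall>y\<in>H ` K. {x, y} \<notin> edges M" "\<forall>K'. K' \<subseteq> K \<and> str K' \<longrightarrow> str (X \<union> H ` K')"
      using place[OF l(3) L iL l(2) T(2) iT T(1) X Z ZV] by (elim bexE conjE) (rule that)
    have injHl: "inj_on (H \<circ> l) IK" using comp_inj_on[OF l(1) aut_inj[OF H(1) lV]] .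
    define \<tau> where "\<tau> y = H (l (y, 0))" for y
    have \<tau>T: "\<tau> y \<in> T" if "y \<in> UK" for y using H(2) that unfolding \<tau>_def IK_def by blast
    have \<tau>inj: "inj_on \<tau> UK"
      using injHl unfolding \<tau>_def IK_def by (auto simp: inj_on_def)
    have slotK: "(H y, z) \<in> S \<longleftrightarrow> y \<in> UK \<and> z = \<tau> y" if yz: "y \<in> K" "z \<in> T" for y z
    proof -
      obtain u where u: "u \<in> UK" "z = \<tau> u" using yz(2) H(2) unfolding IK_def \<tau>_def by blast
      have i: "(u, 0) \<in> IK" using u(1) unfolding IK_def by blast
      then have V': "y \<in> V" "l (u, 0) \<in> V" using yz(1) sK(3) lV by auto
      have "{H (l (u, 0)), H y} \<in> edges M \<longleftrightarrow> y = u"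
        using aut_edge[OF H(1) V'(2,1)] l(4) i yz(1) by auto
      then have e: "{H y, z} \<in> edges M \<longleftrightarrow> y = u" using u(2) by (simp add: \<tau>_def insert_commute)
      have "(z, H y) \<notin> S" using H(3) yz by blast
      then have "(H y, z) \<in> S \<longleftrightarrow> y = u"
        using e two_orientation_dir[OF S, of "H y" z] two_orientation_edge[OF S, of "H y" z] by blast
      then show ?thesis using u inj_onD[OF \<tau>inj, of y u] by auto
    qed
    have HT: "H ` K \<inter> T = {}" using H(3) by blast
    let ?f = "\<lambda>y. card (S `` {H y} \<inter> (H ` K \<union> T))"
    have fo: "finite (S `` {z})" "card (S `` {z}) \<le> 2" for z using o2 by (auto simp: out2_def)
    have le2: "?f y \<le> 2" for y
      using card_mono[OF fo(1), of "S `` {H y} \<inter> (H ` K \<union> T)" "H y"] fo(2)[of "H y"] by simp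
    have "(\<Sum>y\<in>K. card (S `` {H y} \<inter> T)) = card UK"
    proof -
      have "S `` {H y} \<inter> T = (if y \<in> UK then {\<tau> y} else {})" if "y \<in> K" for y
        using slotK[OF that] \<tau>T by auto
      then have "(\<Sum>y\<in>K. card (S `` {H y} \<inter> T)) = (\<Sum>y\<in>K. if y \<in> UK then 1 else 0)"
        by (intro sum.cong refl) simp
      also have "\<dots> = card (K \<inter> UK)" using sK(2) by (simp add: sum.If_cases)
      finally show ?thesis using \<open>K \<inter> UK = UK\<close> by simp
    qed
    then have sum: "(\<Sum>y\<in>K. ?f y) + 1 = 2 * card K"
      using out_degree_sum[OF S H(1) sK(2,3) HT] countK by simp
    \<comment> \<open>A deficient vertex in each of the two disjoint copies would lose at least two
      out-edges, one more than \<open>sum\<close> permits.\<close>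
    have one_lossless: "(\<forall>y\<in>Q. ?f y = 2) \<or> (\<forall>y\<in>g ` Q. ?f y = 2)"
    proof (rule ccontr)
      assume "\<not> ?thesis"
      then obtain y1 y2 where y: "y1 \<in> Q" "?f y1 \<noteq> 2" "y2 \<in> g ` Q" "?f y2 \<noteq> 2" by blast
      have ne: "y1 \<noteq> y2" using y(1,3) g(2) by blast
      have "(\<Sum>y\<in>K. ?f y + (if y \<in> {y1, y2} then 1 else 0)) \<le> (\<Sum>y\<in>K. 2)"
      proof (rule sum_mono)
        fix z assume "z \<in> K"
        show "?f z + (if z \<in> {y1, y2} then 1 else 0) \<le> 2"
        proof (cases "z \<in> {y1, y2}")
          case True
          then have "?f z \<noteq> 2" using y(2,4) by blast
          then have "?f z \<le> 1" using le2[of z] by simp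
          then show ?thesis using True by simp
        next
          case False
          then show ?thesis using le2[of z] by simp
        qed
      qed
      moreover have "(\<Sum>y\<in>K. if y \<in> {y1, y2} then 1 else 0) = card (K \<inter> {y1, y2})"
        using sum.inter_restrict[OF sK(2), of "\<lambda>_. 1::nat" "{y1, y2}"] by simp
      moreover have "K \<inter> {y1, y2} = {y1, y2}" using y unfolding K_def by blast
      ultimately have "(\<Sum>y\<in>K. ?f y) + 2 \<le> 2 * card K" using ne by (simp add: sum.distrib)
      then show False using sum by simp
    qed
    have arm_case: "\<exists>h c. slot_copy S r D I T X F h c"
      if k: "k \<in> automorphisms M" and im: "k ` Q \<subseteq> K" and R: "R \<subseteq> K" "K = k ` Q \<union> R"
        and e: "\<And>v w. v \<in> Q \<Longrightarrow> w \<in> R \<Longrightarrow> {k v, w} \<in> edges M \<Longrightarrow> v = p m"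
        and two: "\<forall>y\<in>k ` Q. ?f y = 2" and UU: "\<And>v. v \<in> Q \<Longrightarrow> k v \<in> UK \<longleftrightarrow> v \<in> UQ" for k R
    proof -
      define h where "h = restrict (H \<circ> k) V"
      have hA: "h \<in> automorphisms M" unfolding h_def by (rule aut_comp[OF H(1) k])
      have hv: "h v = H (k v)" if "v \<in> Q" for v using that QV(2) by (auto simp: h_def)
      have him: "h ` W = H ` k ` W" if "W \<subseteq> Q" for W
        unfolding image_image using hv that by (intro image_cong) auto
      have kinj: "inj_on k Q" using aut_inj[OF k QV(2)] .
      have hQ: "h ` Q \<inter> (?Z \<union> X \<union> T) = {}" using him[OF order_refl] im H(3) by blast
      have hD: "h ` D \<subseteq> H ` K" using him[OF Q(5)] im Q(5) by blast
      have kUQ: "k v \<in> UK" if "v \<in> UQ" for v using UU[of v] that Q(4) by blast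
      have "\<exists>c. slot_copy S r D (insert (x0, 1) ((\<lambda>u. (u, 0)) ` U)) T X F h c"
      proof (rule arm_copy[OF S hA DV(1) D(3,2) _ p(1) m_def, where t = "\<lambda>v. \<tau> (k v)" and N = "H ` R",
            folded Q_def UQ_def])
        show "Q \<subseteq> V" "finite T" by (fact QV(2) TV(1))+
        show "h ` Q \<inter> T = {}" "h ` Q \<inter> F = {}" using hQ by blast+
        show "inj_on (\<lambda>v. \<tau> (k v)) UQ"
        proof (rule inj_onI)
          fix v w assume "v \<in> UQ" "w \<in> UQ" "\<tau> (k v) = \<tau> (k w)"
          then have "k v = k w" using inj_onD[OF \<tau>inj] kUQ by blast
          then show "v = w" using inj_onD[OF kinj] \<open>v \<in> UQ\<close> \<open>w \<in> UQ\<close> Q(4) by blast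
        qed
        show "(\<lambda>v. \<tau> (k v)) ` UQ \<subseteq> T" using \<tau>T kUQ by blast
        show "spread S r T" by (rule T(3))
        show "(h v, z) \<in> S \<longleftrightarrow> v \<in> UQ \<and> z = \<tau> (k v)" if "v \<in> Q" "z \<in> T" for v z
          using slotK[of "k v" z] UU[OF that(1)] that im hv[OF that(1)] by auto
        show "v = p m" if v: "v \<in> Q" and w: "w \<in> H ` R" and hw: "{h v, w} \<in> edges M" for v w
        proof -
          obtain w' where w': "w' \<in> R" "w = H w'" using w by blast
          have "{k v, w'} \<in> edges M"
            using hw hv[OF v] w'(2) aut_edge[OF H(1), of "k v" w'] im v R(1) w'(1) sK(3) by auto
          then show ?thesis using e[OF v w'(1)] by simp
        qed
        have ful: "S `` {h v} \<subseteq> H ` K \<union> T \<and> card (S `` {h v}) = 2" if v: "v \<in> Q" for v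
        proof -
          have f2: "card (S `` {h v} \<inter> (H ` K \<union> T)) = 2" using two v hv[OF v] by auto
          then have "card (S `` {h v}) \<le> card (S `` {h v} \<inter> (H ` K \<union> T))" using fo(2) by simp
          then have "S `` {h v} \<inter> (H ` K \<union> T) = S `` {h v}"
            using card_seteq[OF fo(1), of "S `` {h v} \<inter> (H ` K \<union> T)" "h v"] by blast
          then show ?thesis using f2 by auto
        qed
        have HK: "H ` K = h ` Q \<union> H ` R" using R(2) him[OF order_refl] by blast
        show "S `` {h v} \<subseteq> h ` Q \<union> H ` R \<union> T" if "v \<in> Q" for v using ful[OF that] HK by blast
        show "card (S `` {h v}) = 2" if "v \<in> Q" for v using ful[OF that] by blast
        show "2 * card D = card {e \<in> edges M. e \<subseteq> D} + card U + 1" by (rule count)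
        show "out_ball S r z \<inter> h ` Q = {}" if "z \<in> T" for z using hQ that by blast
        show "str (X \<union> h ` D)"
        proof -
          have "str (k ` D)" by (rule str_aut[OF D(1) k])
          moreover have "k ` D \<subseteq> K" using im Q(5) by blast
          ultimately show ?thesis using H(5) him[OF Q(5)] by simp
        qed
        show "\<forall>x\<in>X. \<forall>y\<in>h ` D. {x, y} \<notin> edges M" using H(4) hD by blast
        show "X \<inter> h ` D = {}" using hD H(3) by blast
      qed
      then show ?thesis using I by blast
    qed
    show "\<exists>h c. slot_copy S r D I T X F h c"
      using one_lossless
    proof
      assume two: "\<forall>y\<in>Q. ?f y = 2"
      let ?id = "restrict id V"
      have idQ: "?id v = v" if "v \<in> Q" for v using that QV(2) by auto
      have idQ': "?id ` Q = Q" using idQ by simp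
      show ?thesis
      proof (rule arm_case[OF aut_id, of "g ` Q"])
        show "?id ` Q \<subseteq> K" "g ` Q \<subseteq> K" "K = ?id ` Q \<union> g ` Q" unfolding idQ' K_def by auto
        show "v = p m" if "v \<in> Q" "w \<in> g ` Q" "{?id v, w} \<in> edges M" for v w
          using g(4) that idQ[OF that(1)] by auto
        show "\<forall>y\<in>?id ` Q. ?f y = 2" unfolding idQ' by (rule two)
        show "?id v \<in> UK \<longleftrightarrow> v \<in> UQ" if "v \<in> Q" for v
          using idQ[OF that] that gUQ g(2) unfolding UK_def by auto
      qed
    next
      assume two: "\<forall>y\<in>g ` Q. ?f y = 2"
      have ginj: "inj_on g Q" using aut_inj[OF g(1) QV(2)] .
      show ?thesis
      proof (rule arm_case[OF g(1), of Q])
        show "g ` Q \<subseteq> K" "Q \<subseteq> K" "K = g ` Q \<union> Q" unfolding K_def by auto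
        show "v = p m" if "v \<in> Q" "w \<in> Q" "{g v, w} \<in> edges M" for v w
        proof -
          have "g v \<in> g ` Q" using that(1) by blast
          then have "g v = g (p m)" using g(4) that(2,3) by (metis insert_commute)
          then show ?thesis using inj_onD[OF ginj] that(1) pm by blast
        qed
        show "\<forall>y\<in>g ` Q. ?f y = 2" by (rule two)
        show "g v \<in> UK \<longleftrightarrow> v \<in> UQ" if "v \<in> Q" for v
        proof -
          have "g v \<notin> UQ" using that g(2) Q(4) by blast
          moreover have "g v \<in> g ` UQ \<longleftrightarrow> v \<in> UQ" using inj_on_image_mem_iff[OF ginj that Q(4)] .
          ultimately show ?thesis unfolding UK_def by blast
        qed
      qed
    qed
  qed
qed

lemma crossing_empty:
  assumes "\<And>x y. x \<in> X - Y \<Longrightarrow> y \<in> Y - X \<Longrightarrow> {x, y} \<notin> edges M"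
  shows "crossing M X Y = {}"
proof (rule ccontr)
  assume "crossing M X Y \<noteq> {}"
  then obtain e where e: "e \<in> crossing M X Y" by blast
  then obtain x y where "x \<in> X - Y" "y \<in> Y - X" "e = {x, y}" using crossing_pair by blast
  then show False using assms e unfolding crossing_def by auto
qed

lemma indep_subset_CF:
  assumes "str T" "indep T" "T' \<subseteq> T"
  shows "str T'"
proof (rule strI[OF assms(1,3)])
  have fT: "finite T" using str_finite[OF assms(1)] .
  have d: "\<delta> Z = 2 * int (card Z)" if Z: "Z \<subseteq> T" for Z
  proof -
    have E0: "{e \<in> edges M. e \<subseteq> Z} = {}"
    proof (rule ccontr)
      assume "{e \<in> edges M. e \<subseteq> Z} \<noteq> {}"
      then obtain e where e: "e \<in> edges M" "e \<subseteq> Z" by blast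
      obtain x y where "e = {x, y}" using pair_edge[OF M_graph e(1)] by blast
      then show False using e Z assms(2) unfolding indep_def by auto
    qed
    show ?thesis unfolding dl_def E0 by simp
  qed
  fix Z assume Z: "T' \<subset> Z" "Z \<subseteq> T"
  have "card T' < card Z" using Z fT finite_subset by (intro psubset_card_mono) auto
  then show "\<delta> T' < \<delta> Z" using d[OF Z(2)] d[OF assms(3)] by simp
qed

lemma leaf_CF:
  assumes "str W" "u \<in> W"
  shows "\<exists>l. l \<notin> W \<and> str (insert l W) \<and> (\<forall>w\<in>W. {l, w} \<in> edges M \<longleftrightarrow> w = u)"
  using leafy_CF assms unfolding leafy_def by blast

text \<open>Length 3 is the least that works: the ends of an induced path have predimension 4, an
  induced path with two edges also has 4, and one with three edges has 5. Only the latter can be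
  amalgamated over its two ends.\<close>

lemma path4:
  "\<exists>a b c d. distinct [a, b, c, d] \<and> str {a, b, c, d} \<and> str {a, d} \<and>
    {a, b} \<in> edges M \<and> {b, c} \<in> edges M \<and> {c, d} \<in> edges M \<and>
    {a, c} \<notin> edges M \<and> {a, d} \<notin> edges M \<and> {b, d} \<notin> edges M"
proof -
  obtain B :: "'a graph" where B: "B \<in> class_CF F" "edges B \<noteq> {}" using edge_exists by blast
  then obtain x where "x \<in> verts B" using pair_edge[OF C_graph[OF B(1)]] by blast
  then obtain a where a: "a \<in> V" using universal[OF B(1)] str_V by blast
  obtain b where b: "b \<notin> {a}" "str {b, a}" "\<forall>w\<in>{a}. {b, w} \<in> edges M \<longleftrightarrow> w = a"
    using leaf_CF[OF str_vertex[OF a], of a] by blast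
  obtain c where c: "c \<notin> {b, a}" "str {c, b, a}" "\<forall>w\<in>{b, a}. {c, w} \<in> edges M \<longleftrightarrow> w = b"
    using leaf_CF[OF b(2), of b] by blast
  obtain d where d: "d \<notin> {c, b, a}" "str {d, c, b, a}" "\<forall>w\<in>{c, b, a}. {d, w} \<in> edges M \<longleftrightarrow> w = c"
    using leaf_CF[OF c(2), of c] by blast
  have e: "{a, b} \<in> edges M" "{b, c} \<in> edges M" "{c, d} \<in> edges M"
    "{a, c} \<notin> edges M" "{a, d} \<notin> edges M" "{b, d} \<notin> edges M"
    using b c d by (auto simp: insert_commute)
  have dist: "distinct [a, b, c, d]" using b(1) c(1) d(1) by auto
  have sW: "str {a, b, c, d}" using d(2) by (simp add: insert_commute)
  have WV: "{a, b, c, d} \<subseteq> V" using str_V[OF sW] .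
  \<comment> \<open>The path grows by leaves that carry their own slots. For the whole path,
    positivity says that \<open>\<delta>\<close> minus 4 is at least 1.\<close>
  have "pos {d, c, b, a} {d, c, b, a}"
  proof (rule pos_leaf(1)[of "{c, b, a}" _ _ c])
    show "pos {c, b, a} {c, b, a}"
    proof (rule pos_leaf(1)[of "{b, a}" _ _ b])
      show "pos {b, a} {b, a}" by (rule pos_leaf(1)[of "{a}" _ _ a]) (use b pos_singleton in auto)
    qed (use c in auto)
  qed (use d in auto)
  then have p: "val {d, c, b, a} {a, b, c, d} \<ge> 1" unfolding pos_def by (simp add: insert_commute)
  have "{a, b, c, d} \<inter> {d, c, b, a} = {a, b, c, d}" by auto
  moreover have "card {a, b, c, d} = 4" using dist by simp
  ultimately have full: "\<delta> {a, b, c, d} \<ge> 5" using p unfolding val_def by simp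
  have le4: "\<delta> {a, d} \<le> 4" using dist unfolding dl_def by simp
  have "str {a, d}"
  proof (rule strI[OF sW])
    fix Z assume Z: "{a, d} \<subset> Z" "Z \<subseteq> {a, b, c, d}"
    consider "Z = {a, b} \<union> {d}" | "Z = {c, d} \<union> {a}" | "Z = {a, b, c, d}" using Z by blast
    then show "\<delta> {a, d} < \<delta> Z"
    proof cases
      case 1
      have cr: "crossing M {a, b} {d} = {}" using e by (intro crossing_empty) auto
      have "{a, b} \<inter> {d} = {}" using dist by auto
      then have "\<delta> Z = \<delta> {a, b} + 2" using dl_Un[of "{a, b}" "{d}" M] M_graph unfolding cr 1 by simp
      moreover have "\<delta> {a, b} > 2" using WV dist by (intro \<delta>_gt[of _ a]) auto
      ultimately show ?thesis using le4 by simp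
    next
      case 2
      have cr: "crossing M {c, d} {a} = {}" using e by (intro crossing_empty) (auto simp: insert_commute)
      have "{c, d} \<inter> {a} = {}" using dist by auto
      then have "\<delta> Z = \<delta> {c, d} + 2" using dl_Un[of "{c, d}" "{a}" M] M_graph unfolding cr 2 by simp
      moreover have "\<delta> {c, d} > 2" using WV dist by (intro \<delta>_gt[of _ c]) auto
      ultimately show ?thesis using le4 by simp
    next
      case 3
      then show ?thesis using full le4 by simp
    qed
  qed simp
  then show ?thesis using dist sW e by blast
qed

text \<open>The path of \<open>path4\<close> is amalgamated over its two ends, which are moved to
  \<open>x\<close> and \<open>y\<close>; \<open>p\<close> and \<open>q\<close> are its inner
  vertices.\<close>

lemma link:
  assumes D: "str D" "x \<in> D" "y \<in> D" "x \<noteq> y" "{x, y} \<notin> edges M" and xy: "str {x, y}"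
  shows "\<exists>p q. p \<notin> D \<and> q \<notin> D \<and> p \<noteq> q \<and> str (insert p (insert q D)) \<and> {p, q} \<in> edges M \<and>
    (\<forall>w\<in>D. {p, w} \<in> edges M \<longleftrightarrow> w = x) \<and> (\<forall>w\<in>D. {q, w} \<in> edges M \<longleftrightarrow> w = y)"
proof -
  obtain a b c d where P: "distinct [a, b, c, d]" "str {a, b, c, d}" "str {a, d}"
    "{a, b} \<in> edges M" "{b, c} \<in> edges M" "{c, d} \<in> edges M"
    "{a, c} \<notin> edges M" "{a, d} \<notin> edges M" "{b, d} \<notin> edges M" using path4 by blast
  have PV: "{a, b, c, d} \<subseteq> V" using str_V[OF P(2)] .
  let ?\<phi> = "\<lambda>v. if v = a then x else y"
  have "piso {a, d} ?\<phi>"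
  proof (rule pisoI[OF P(3)])
    show "inj_on ?\<phi> {a, d}" using D(4) P(1) by (auto simp: inj_on_def)
    have "?\<phi> ` {a, d} = {x, y}" using P(1) by auto
    then show "str (?\<phi> ` {a, d})" using xy by simp
    fix u v assume "u \<in> {a, d}" "v \<in> {a, d}"
    then show "{u, v} \<in> edges M \<longleftrightarrow> {?\<phi> u, ?\<phi> v} \<in> edges M"
      using P(1,8) D(5) no_loop by (auto simp: insert_commute)
  qed
  then have "\<exists>h\<in>automorphisms M. (\<forall>v\<in>{a, d}. h v = ?\<phi> v) \<and> h ` {a, b, c, d} \<inter> D = ?\<phi> ` {a, d} \<and>
      free (h ` {a, b, c, d}) D \<and> str (h ` {a, b, c, d} \<union> D)"
    using P(1,2) D by (intro extend) auto
  then obtain h where h: "h \<in> automorphisms M" "\<forall>v\<in>{a, d}. h v = ?\<phi> v"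
    "h ` {a, b, c, d} \<inter> D = ?\<phi> ` {a, d}" "free (h ` {a, b, c, d}) D" "str (h ` {a, b, c, d} \<union> D)"
    by blast
  have had: "h a = x" "h d = y" using h(2) P(1) by auto
  have int: "h ` {a, b, c, d} \<inter> D = {x, y}" using h(3) P(1) by auto
  have hinj: "inj_on h {a, b, c, d}" using aut_inj[OF h(1) PV] .
  have ne: "h b \<noteq> x" "h b \<noteq> y" "h c \<noteq> x" "h c \<noteq> y" "h b \<noteq> h c"
    using P(1) hinj unfolding had[symmetric] by (auto simp: inj_on_def)
  have notD: "h b \<notin> D" "h c \<notin> D"
  proof -
    show "h b \<notin> D"
    proof
      assume "h b \<in> D"
      then have "h b \<in> h ` {a, b, c, d} \<inter> D" by simp
      then show False unfolding int using ne by simp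
    qed
    show "h c \<notin> D"
    proof
      assume "h c \<in> D"
      then have "h c \<in> h ` {a, b, c, d} \<inter> D" by simp
      then show False unfolding int using ne by simp
    qed
  qed
  have edge: "{h u, h v} \<in> edges M \<longleftrightarrow> {u, v} \<in> edges M" if "u \<in> {a, b, c, d}" "v \<in> {a, b, c, d}" for u v
    using aut_edge[OF h(1), of u v] that PV by blast
  have inxy: "w \<in> {x, y}" if w: "w \<in> D" "{h u, w} \<in> edges M" "h u \<notin> D" "u \<in> {a, b, c, d}" for u w
  proof -
    have "{h u, w} \<subseteq> h ` {a, b, c, d} \<union> D" using w by auto
    then have "{h u, w} \<subseteq> h ` {a, b, c, d}" using h(4) w(2,3) unfolding free_def by auto
    then have "w \<in> h ` {a, b, c, d} \<inter> D" using w(1) by simp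
    then show ?thesis unfolding int .
  qed
  have hb: "{h b, w} \<in> edges M \<longleftrightarrow> w = x" if w: "w \<in> D" for w
  proof
    assume e: "{h b, w} \<in> edges M"
    have "{h b, y} \<notin> edges M" using edge[of b d] P(9) had by simp
    then show "w = x" using inxy[OF w e notD(1)] e by auto
  next
    assume "w = x"
    then show "{h b, w} \<in> edges M" using edge[of b a] P(4) had by (simp add: insert_commute)
  qed
  have hc: "{h c, w} \<in> edges M \<longleftrightarrow> w = y" if w: "w \<in> D" for w
  proof
    assume e: "{h c, w} \<in> edges M"
    have "{h c, x} \<notin> edges M" using edge[of c a] P(7) had by (simp add: insert_commute)
    then show "w = y" using inxy[OF w e notD(2)] e by auto
  next
    assume "w = y"
    then show "{h c, w} \<in> edges M" using edge[of c d] P(6) had by simp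
  qed
  have "h ` {a, b, c, d} \<union> D = insert (h b) (insert (h c) D)" using had D(2,3) by auto
  then have "str (insert (h b) (insert (h c) D))" using h(5) by simp
  moreover have "{h b, h c} \<in> edges M" using edge[of b c] P(5) by simp
  ultimately show ?thesis using notD ne(5) hb hc by (intro exI[of _ "h b"] exI[of _ "h c"]) blast
qed

text \<open>A cycle of length 6: \<open>path4\<close> closed up by \<open>link\<close>. With slots
  at all vertices but \<open>a\<close> the value is \<open>12 - 6 - 5 = 1\<close>, and the extra
  slot goes to \<open>a\<close>. Positivity holds on the path without \<open>a\<close>, and adding
  \<open>a\<close> brings 2 against at most two edges.\<close>

lemma slot_cycle_CF:
  "\<exists>D I. slot_d D I \<and> D \<noteq> {} \<and> (\<forall>y\<in>D. str {y} \<and> card {i \<in> I. fst i = y} = 1)"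
proof -
  obtain a b c d where P: "distinct [a, b, c, d]" "str {a, b, c, d}" "str {a, d}"
    "{a, b} \<in> edges M" "{b, c} \<in> edges M" "{c, d} \<in> edges M"
    "{a, c} \<notin> edges M" "{a, d} \<notin> edges M" "{b, d} \<notin> edges M" using path4 by blast
  have "\<exists>p q. p \<notin> {a, b, c, d} \<and> q \<notin> {a, b, c, d} \<and> p \<noteq> q \<and> str (insert p (insert q {a, b, c, d})) \<and>
    {p, q} \<in> edges M \<and> (\<forall>w\<in>{a, b, c, d}. {p, w} \<in> edges M \<longleftrightarrow> w = a) \<and>
    (\<forall>w\<in>{a, b, c, d}. {q, w} \<in> edges M \<longleftrightarrow> w = d)"
    by (rule link[OF P(2) _ _ _ P(8,3)]) (use P(1) in auto)
  then obtain p q where pq: "p \<notin> {a, b, c, d}" "q \<notin> {a, b, c, d}" "p \<noteq> q"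
    "str (insert p (insert q {a, b, c, d}))" "{p, q} \<in> edges M"
    "\<forall>w\<in>{a, b, c, d}. {p, w} \<in> edges M \<longleftrightarrow> w = a" "\<forall>w\<in>{a, b, c, d}. {q, w} \<in> edges M \<longleftrightarrow> w = d"
    by blast
  let ?W = "{p, q, d, c, b}"
  let ?D = "insert a ?W"
  have D: "str ?D" using pq(4) by (simp add: insert_commute)
  have pW: "pos ?W ?W" "val ?W ?W = 1"
  proof -
    have 1: "pos {c, b} {c, b}" "val {c, b} {c, b} = val {b} {b}"
      using pos_leaf[of "{b}" c "{b}" b] P(1,5) pos_singleton by (auto simp: insert_commute)
    have 2: "pos {d, c, b} {d, c, b}" "val {d, c, b} {d, c, b} = val {c, b} {c, b}"
      using pos_leaf[of "{c, b}" d "{c, b}" c] P(1,6,9) 1 by (auto simp: insert_commute)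
    have 3: "pos {q, d, c, b} {q, d, c, b}" "val {q, d, c, b} {q, d, c, b} = val {d, c, b} {d, c, b}"
      using pos_leaf[of "{d, c, b}" q "{d, c, b}" d] pq(2,7) 2 by auto
    have "pos ?W ?W \<and> val ?W ?W = val {q, d, c, b} {q, d, c, b}"
      using pos_leaf[of "{q, d, c, b}" p "{q, d, c, b}" q] pq(1,3,5,6) P(1) 3 by auto
    then show "pos ?W ?W" "val ?W ?W = 1" using 1 2 3 by simp_all
  qed
  have aW: "a \<notin> ?W" using P(1) pq(1,2) by auto
  have cr: "crossing M {a} Z \<subseteq> {{a, b}, {a, p}}" if Z: "Z \<subseteq> ?W" for Z
  proof
    fix e assume e: "e \<in> crossing M {a} Z"
    then obtain y where y: "y \<in> Z" "e = {a, y}" using crossing_pair by blast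
    have ed: "{a, y} \<in> edges M" using e y(2) unfolding crossing_def by simp
    have "y \<noteq> d" "y \<noteq> c" using ed P(7,8) by auto
    moreover have "y \<noteq> q" using ed pq(7) P(1) by (auto simp: insert_commute)
    ultimately have "y = p \<or> y = b" using y(1) Z by auto
    then show "e \<in> {{a, b}, {a, p}}" using y(2) by auto
  qed
  have valZ: "val ?W (insert a Z) = 2 + val ?W Z - int (card (crossing M {a} Z))" if Z: "Z \<subseteq> ?W" for Z
  proof -
    have "finite Z" "{a} \<inter> Z = {}" using Z aW finite_subset[OF Z] by auto
    then show ?thesis using val_Un[of "{a}" Z ?W] aW by simp
  qed
  have le2: "card (crossing M {a} Z) \<le> 2" if Z: "Z \<subseteq> ?W" for Z
    using card_mono[OF _ cr[OF Z]] by (simp add: card_insert_if split: if_splits)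
  have "pos ?W ?D"
    unfolding pos_def
  proof (intro allI impI)
    fix Z assume Z: "Z \<subseteq> ?D" "Z \<noteq> {}"
    show "val ?W Z \<ge> 1"
    proof (cases "a \<in> Z")
      case False
      then have "Z \<subseteq> ?W" using Z(1) by blast
      then show ?thesis using pW(1) Z(2) unfolding pos_def by blast
    next
      case True
      let ?Y = "Z - {a}"
      have Y: "?Y \<subseteq> ?W" "Z = insert a ?Y" using Z(1) True by blast+
      show ?thesis
      proof (cases "?Y = {}")
        case True
        then have "Z = {a}" using \<open>a \<in> Z\<close> by blast
        then show ?thesis using aW by simp
      next
        case False
        then have "val ?W ?Y \<ge> 1" using pW(1) Y(1) unfolding pos_def by blast
        then show ?thesis using valZ[OF Y(1)] le2[OF Y(1)] Y(2) by simp
      qed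
    qed
  qed
  moreover have "val ?W ?D = 1"
  proof -
    have "{a, b} \<in> crossing M {a} ?W" "{a, p} \<in> crossing M {a} ?W"
      using P(4) pq(6) aW by (auto intro!: crossing_edge simp: insert_commute)
    then have "{{a, b}, {a, p}} \<subseteq> crossing M {a} ?W" by blast
    moreover have "{a, b} \<noteq> {a, p}" using pq(1) by (auto simp: doubleton_eq_iff)
    ultimately have "card (crossing M {a} ?W) \<ge> 2"
      using card_mono[OF finite_crossing[of "{a}" ?W M], of "{{a, b}, {a, p}}"] by simp
    then show ?thesis using valZ[OF order_refl] le2[OF order_refl] pW(2) by simp
  qed
  ultimately have "slot_d ?D (insert (a, 1) ((\<lambda>u. (u, 0)) ` ?W))"
    unfolding slot_d_def using D by (intro conjI exI[of _ ?W] exI[of _ a]) auto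
  moreover let ?I = "insert (a, 1) ((\<lambda>u. (u, 0 :: nat)) ` ?W)"
  have "card {i \<in> ?I. fst i = y} = 1" if y: "y \<in> ?D" for y
  proof -
    have "{i \<in> ?I. fst i = y} = {(y, if y = a then 1 else 0)}" using y aW by auto
    then show ?thesis by simp
  qed
  moreover have "str {y}" if "y \<in> ?D" for y using str_vertex str_V[OF D] that by blast
  ultimately show ?thesis by (intro exI[of _ ?D] exI[of _ ?I]) blast
qed

text \<open>If no vertex can be added to \<open>U\<close>, every vertex lies in a tight set, one of value 1. A maximal
  tight set \<open>X\<close> has no edges to the rest, and a path of length 3 from \<open>X\<close> to a vertex outside \<open>X\<close>
  lowers the value.\<close>

lemma improve:
  assumes D: "str D" "U \<subseteq> D" "pos U D" "val U D \<ge> 2"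
  shows "\<exists>D' U'. D \<subseteq> D' \<and> str D' \<and> U' \<subseteq> D' \<and> pos U' D' \<and> val U' D' < val U D"
proof -
  have fD: "finite D" "D \<subseteq> V" using str_finite[OF D(1)] str_V[OF D(1)] .
  show ?thesis
  \<comment> \<open>If every set containing \<open>x\<close> has value at least 2, a slot at
    \<open>x\<close> costs 1 and leaves all values positive.\<close>
  proof (cases "\<exists>x\<in>D - U. \<forall>X\<subseteq>D. x \<in> X \<longrightarrow> val U X \<ge> 2")
    case True
    then obtain x where x: "x \<in> D" "x \<notin> U" "\<And>X. X \<subseteq> D \<Longrightarrow> x \<in> X \<Longrightarrow> val U X \<ge> 2" by blast
    have v: "val (insert x U) X = val U X - (if x \<in> X then 1 else 0)" if "X \<subseteq> D" for X
      using x(2) finite_subset[OF that fD(1)] unfolding val_def by simp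
    have "pos (insert x U) D"
      unfolding pos_def
    proof (intro allI impI)
      fix X assume X: "X \<subseteq> D" "X \<noteq> {}"
      then have "val U X \<ge> 1" using D(3) unfolding pos_def by blast
      then show "val (insert x U) X \<ge> 1" using v[OF X(1)] x(3)[OF X(1)] by (cases "x \<in> X") simp_all
    qed
    moreover have "val (insert x U) D < val U D" using v[of D] x(1) by simp
    ultimately show ?thesis using D(1,2) x(1) by (intro exI[of _ D] exI[of _ "insert x U"]) simp
  next
    case False
    have tight: "\<exists>X\<subseteq>D. y \<in> X \<and> val U X = 1" if y: "y \<in> D" for y
    proof (cases "y \<in> U")
      case True
      then show ?thesis using y by (intro exI[of _ "{y}"]) (simp add: val_def)
    next
      case False
      then obtain X where X: "X \<subseteq> D" "y \<in> X" "\<not> val U X \<ge> 2"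
        using \<open>\<not> (\<exists>x\<in>D - U. \<forall>X\<subseteq>D. x \<in> X \<longrightarrow> val U X \<ge> 2)\<close> y by blast
      then have "val U X \<ge> 1" using D(3) unfolding pos_def by blast
      then show ?thesis using X by (intro exI[of _ X]) simp
    qed
    have "D \<noteq> {}" using D(4) by auto
    then obtain x where x: "x \<in> D" by blast
    let ?T = "{X. X \<subseteq> D \<and> x \<in> X \<and> val U X = 1}"
    have "finite ?T" using fD(1) by (auto intro: finite_subset[of _ "Pow D"])
    moreover have "?T \<noteq> {}" using tight[OF x] by blast
    ultimately obtain X where X: "X \<in> ?T" "\<forall>Y\<in>?T. X \<subseteq> Y \<longrightarrow> X = Y"
      using finite_has_maximal[of ?T] by blast
    have X': "X \<subseteq> D" "x \<in> X" "val U X = 1" using X(1) by auto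
    have fX: "finite X" using finite_subset[OF X'(1) fD(1)] .
    have max: "Y \<subseteq> X" if Y: "Y \<subseteq> D" "val U (X \<union> Y) \<le> 1" for Y
    proof -
      have "X \<union> Y \<subseteq> D" "X \<union> Y \<noteq> {}" using X'(1,2) Y(1) by auto
      then have "val U (X \<union> Y) \<ge> 1" using D(3) unfolding pos_def by simp
      then have "X \<union> Y \<in> ?T" using Y X' by auto
      then have "X = X \<union> Y" using X(2) by simp
      then show ?thesis by (rule ssubst) simp
    qed
    \<comment> \<open>Take a tight set around \<open>y\<close>. An edge between it and
      \<open>X\<close>, or a common vertex, would by \<open>val_Un\<close> make the union tight,
      against maximality.\<close>
    have noedge: "{w, y} \<notin> edges M" if w: "w \<in> X" and y: "y \<in> D - X" for w y
    proof
      assume e: "{w, y} \<in> edges M"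
      obtain Y where Y: "Y \<subseteq> D" "y \<in> Y" "val U Y = 1" using tight y by blast
      have fY: "finite Y" using finite_subset[OF Y(1) fD(1)] .
      have "val U (X \<union> Y) = 2 - val U (X \<inter> Y) - int (card (crossing M X Y))"
        using val_Un[OF fX fY, of U] X'(3) Y(3) by simp
      moreover have "val U (X \<inter> Y) + int (card (crossing M X Y)) \<ge> 1"
      proof (cases "X \<inter> Y = {}")
        case True
        then have "{w, y} \<in> crossing M X Y" using e w y Y(2) by (intro crossing_edge) auto
        then have "card (crossing M X Y) > 0" using finite_crossing[OF fX fY, of M] card_gt_0_iff by blast
        then show ?thesis using True by simp
      next
        case False
        moreover have "X \<inter> Y \<subseteq> D" using X'(1) by blast
        ultimately have "val U (X \<inter> Y) \<ge> 1" using D(3) unfolding pos_def by blast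
        then show ?thesis by simp
      qed
      ultimately have "val U (X \<union> Y) \<le> 1" by simp
      then have "Y \<subseteq> X" using max[OF Y(1)] by blast
      then show False using y Y(2) by blast
    qed
    have "X \<noteq> D" using X'(3) D(4) by auto
    then obtain y where y: "y \<in> D - X" using X'(1) by blast
    have xy: "x \<noteq> y" "{x, y} \<notin> edges M" using noedge[OF X'(2) y] X'(2) y by auto
    have split: "Z = (Z \<inter> X) \<union> (Z - X)" "(Z \<inter> X) \<inter> (Z - X) = {}" for Z by auto
    have cross0: "crossing M (Z \<inter> X) (Z - X) = {}" if "Z \<subseteq> D" for Z
      using noedge that by (intro crossing_empty) auto
    \<comment> \<open>Without edges between \<open>X\<close> and the rest, predimensions of the two
      parts add up. Each part is at least 2, and one exceeds 2 unless both are singletons.\<close>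
    have "str {x, y}"
    proof (rule strI[OF D(1)])
      show "{x, y} \<subseteq> D" using x y by auto
      fix Z assume Z: "{x, y} \<subset> Z" "Z \<subseteq> D"
      have f: "finite (Z \<inter> X)" "finite (Z - X)" using finite_subset[OF Z(2) fD(1)] by auto
      have "\<delta> Z = \<delta> (Z \<inter> X) + \<delta> (Z - X)"
        using dl_Un[OF f, of M] split(2)[of Z] split(1)[of Z, symmetric] cross0[OF Z(2)] by simp
      moreover have "\<delta> (Z \<inter> X) \<ge> 2" "\<delta> (Z - X) \<ge> 2"
        using f Z X'(2) y fD(2) by (auto intro!: \<delta>_ge)
      moreover have "\<delta> (Z \<inter> X) > 2 \<or> \<delta> (Z - X) > 2"
      proof (cases "Z \<inter> X = {x}")
        case True
        then have "Z - X \<noteq> {y}" using Z(1) split(1)[of Z] by auto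
        then have "\<delta> (Z - X) > 2" using f Z y fD(2) by (intro \<delta>_gt[of _ y]) auto
        then show ?thesis ..
      next
        case False
        then have "\<delta> (Z \<inter> X) > 2" using f Z X'(2) fD(2) by (intro \<delta>_gt[of _ x]) auto
        then show ?thesis ..
      qed
      moreover have "\<delta> {x, y} \<le> 4" using xy(1) unfolding dl_def by simp
      ultimately show "\<delta> {x, y} < \<delta> Z" by linarith
    qed
    then have "\<exists>p q. p \<notin> D \<and> q \<notin> D \<and> p \<noteq> q \<and> str (insert p (insert q D)) \<and> {p, q} \<in> edges M \<and>
        (\<forall>w\<in>D. {p, w} \<in> edges M \<longleftrightarrow> w = x) \<and> (\<forall>w\<in>D. {q, w} \<in> edges M \<longleftrightarrow> w = y)"
      using D(1) x y xy by (intro link) auto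
    then obtain p q where pq: "p \<notin> D" "q \<notin> D" "p \<noteq> q" "str (insert p (insert q D))" "{p, q} \<in> edges M"
      "\<forall>w\<in>D. {p, w} \<in> edges M \<longleftrightarrow> w = x" "\<forall>w\<in>D. {q, w} \<in> edges M \<longleftrightarrow> w = y" by blast
    \<comment> \<open>The pair \<open>p\<close>, \<open>q\<close> with two slots has value 1 and is
      attached by two edges, so the value drops by one.\<close>
    let ?D' = "{p, q} \<union> D" and ?U' = "{p, q} \<union> U"
    have ppq: "pos {p, q} {p, q}" "val {p, q} {p, q} = 1"
      using pos_leaf[of "{q}" p "{q}" q] pq(3,5) pos_singleton[of q] by auto
    have val': "val ?U' (Z1 \<union> Z0) = val {p, q} Z1 + val U Z0 - int (card (crossing M Z1 Z0))"
      if Z: "Z1 \<subseteq> {p, q}" "Z0 \<subseteq> D" for Z1 Z0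
    proof -
      have f: "finite Z1" "finite Z0" using finite_subset[OF Z(1)] finite_subset[OF Z(2) fD(1)] by auto
      have "Z1 \<inter> Z0 = {}" using Z pq(1,2) by auto
      moreover have "val ?U' Z1 = val {p, q} Z1" by (rule val_cong) (use Z pq(1,2) D(2) in auto)
      moreover have "val ?U' Z0 = val U Z0" by (rule val_cong) (use Z pq(1,2) in auto)
      ultimately show ?thesis using val_Un[OF f, of ?U'] by simp
    qed
    have cr: "crossing M Z1 Z0 \<subseteq> (if x \<in> Z0 then {{p, x}} else {}) \<union> (if y \<in> Z0 then {{q, y}} else {})"
      if Z: "Z1 \<subseteq> {p, q}" "Z0 \<subseteq> D" for Z1 Z0
    proof
      fix e assume e: "e \<in> crossing M Z1 Z0"
      then obtain u v where uv: "u \<in> Z1" "v \<in> Z0" "e = {u, v}" using crossing_pair by blast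
      have ed: "{u, v} \<in> edges M" using e uv(3) unfolding crossing_def by simp
      have "u = p \<and> v = x \<or> u = q \<and> v = y" using ed pq(6,7) uv(1,2) Z by auto
      then show "e \<in> (if x \<in> Z0 then {{p, x}} else {}) \<union> (if y \<in> Z0 then {{q, y}} else {})"
        using uv(2,3) by auto
    qed
    have crossle: "card (crossing M Z1 Z0) \<le> (if x \<in> Z0 then 1 else 0) + (if y \<in> Z0 then 1 else 0)"
      if Z: "Z1 \<subseteq> {p, q}" "Z0 \<subseteq> D" for Z1 Z0
    proof -
      have "card (crossing M Z1 Z0) \<le>
          card ((if x \<in> Z0 then {{p, x}} else {}) \<union> (if y \<in> Z0 then {{q, y}} else {}))"
        by (rule card_mono[OF _ cr[OF Z]]) auto
      also have "\<dots> \<le> card (if x \<in> Z0 then {{p, x}} else {}) + card (if y \<in> Z0 then {{q, y}} else {})"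
        by (rule card_Un_le)
      finally show ?thesis by (simp split: if_splits)
    qed
    have "pos ?U' ?D'"
      unfolding pos_def
    proof (intro allI impI)
      fix Z assume Z: "Z \<subseteq> ?D'" "Z \<noteq> {}"
      let ?Z1 = "Z \<inter> {p, q}" and ?Z0 = "Z \<inter> D"
      have eq: "Z = ?Z1 \<union> ?Z0" using Z(1) by blast
      have v: "val ?U' Z = val {p, q} ?Z1 + val U ?Z0 - int (card (crossing M ?Z1 ?Z0))"
        using val'[of ?Z1 ?Z0] eq by simp
      have c: "card (crossing M ?Z1 ?Z0) \<le> (if x \<in> ?Z0 then 1 else 0) + (if y \<in> ?Z0 then 1 else 0)"
        by (rule crossle) auto
      show "val ?U' Z \<ge> 1"
      proof (cases "?Z1 = {}")
        case True
        then have "?Z0 \<noteq> {}" "crossing M ?Z1 ?Z0 = {}" using eq Z(2) by (auto simp: crossing_def)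
        then show ?thesis using v True D(3) unfolding pos_def by simp
      next
        case False
        then have v1: "val {p, q} ?Z1 \<ge> 1" using ppq(1) unfolding pos_def by simp
        show ?thesis
        \<comment> \<open>Two attaching edges occur only if \<open>?Z0\<close> meets both
          \<open>X\<close> and its complement; it then splits into two parts without edges between
          them and has value at least 2.\<close>
        proof (cases "x \<in> ?Z0 \<and> y \<in> ?Z0")
          case True
          have "val U ?Z0 = val U (?Z0 \<inter> X) + val U (?Z0 - X)"
          proof -
            have f: "finite (?Z0 \<inter> X)" "finite (?Z0 - X)" using fD(1) by auto
            show ?thesis
              using val_Un[OF f, of U] split(2)[of ?Z0] split(1)[of ?Z0, symmetric] cross0[of ?Z0] by simp
          qed
          moreover have "val U (?Z0 \<inter> X) \<ge> 1" "val U (?Z0 - X) \<ge> 1"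
          proof -
            have "?Z0 \<inter> X \<subseteq> D" "?Z0 \<inter> X \<noteq> {}" "?Z0 - X \<subseteq> D" "?Z0 - X \<noteq> {}" using True X'(2) y by auto
            then show "val U (?Z0 \<inter> X) \<ge> 1" "val U (?Z0 - X) \<ge> 1" using D(3) unfolding pos_def by simp_all
          qed
          ultimately show ?thesis using v v1 c True by simp
        next
          case False
          then have c1: "card (crossing M ?Z1 ?Z0) \<le> (if ?Z0 = {} then 0 else 1)"
            using c by (auto split: if_splits)
          have "val U ?Z0 \<ge> (if ?Z0 = {} then 0 else 1)" using D(3) unfolding pos_def by auto
          then show ?thesis using v v1 c1 by (simp split: if_splits)
        qed
      qed
    qed
    moreover have "val ?U' ?D' < val U D"
    proof -
      have "{p, x} \<in> crossing M {p, q} D" "{q, y} \<in> crossing M {p, q} D"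
        using pq x y by (auto intro!: crossing_edge)
      moreover have "{p, x} \<noteq> {q, y}" using pq(1-3) x y by (auto simp: doubleton_eq_iff)
      ultimately have "card (crossing M {p, q} D) \<ge> 2"
        using card_mono[OF finite_crossing[of "{p, q}" D M], of "{{p, x}, {q, y}}"] fD(1) by simp
      then show ?thesis using val'[of "{p, q}" D] ppq(2) by simp
    qed
    moreover have "str ?D'" using pq(4) by (simp add: insert_commute)
    ultimately show ?thesis using D(2) by (intro exI[of _ ?D'] exI[of _ ?U']) auto
  qed
qed

text \<open>Without slots every non-empty set has value equal to its predimension, at least 2.
  Repeated use of \<open>improve\<close> lowers the total value to 1, where the extra slot of
  \<open>slot_d\<close> takes care of the last out-edge.\<close>

lemma slot_cover_CF:
  assumes D: "finite D" "D \<subseteq> V"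
  shows "\<exists>D' I. D \<subseteq> D' \<and> slot_d D' I"
proof -
  \<comment> \<open>A vertex is added so that the cover is non-empty even for empty
    \<open>D\<close>: the values then stay at least 1, and there is a place for the extra
    slot.\<close>
  obtain a where a: "a \<in> V" using path4 str_V by blast
  have "finite (insert a D)" "insert a D \<subseteq> V" using D a by auto
  from str_cover[OF this] obtain D1 where D1: "insert a D \<subseteq> D1" "str D1" by blast
  have reach: "\<exists>D' U'. D1 \<subseteq> D' \<and> str D' \<and> U' \<subseteq> D' \<and> pos U' D' \<and> val U' D' = 1"
    if "D1 \<subseteq> D'" "str D'" "U' \<subseteq> D'" "pos U' D'" "nat (val U' D') = n" for n D' U'
    using that
  proof (induction n arbitrary: D' U' rule: less_induct)
    case (less n)
    have ge: "val U' D' \<ge> 1" using less.prems(1,4) D1(1) unfolding pos_def by blast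
    show ?case
    proof (cases "val U' D' = 1")
      case True
      then show ?thesis using less.prems by blast
    next
      case False
      then have "val U' D' \<ge> 2" using ge by simp
      from improve[OF less.prems(2-4) this] obtain D2 U2 where
        2: "D' \<subseteq> D2" "str D2" "U2 \<subseteq> D2" "pos U2 D2" "val U2 D2 < val U' D'" by blast
      then have "nat (val U2 D2) < n" using less.prems(5) ge by linarith
      from less.IH[OF this _ 2(2-4) refl] show ?thesis using less.prems(1) 2(1) by blast
    qed
  qed
  have "pos {} D1"
    unfolding pos_def
  proof (intro allI impI)
    fix X assume X: "X \<subseteq> D1" "X \<noteq> {}"
    have "finite X" "X \<subseteq> V" using finite_subset[OF X(1) str_finite[OF D1(2)]] str_V[OF D1(2)] X(1) by auto
    then show "val {} X \<ge> 1" using \<delta>_ge[of X] X(2) by (simp add: val_def)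
  qed
  from reach[OF order_refl D1(2) empty_subsetI this refl] obtain D' U' where
    D': "D1 \<subseteq> D'" "str D'" "U' \<subseteq> D'" "pos U' D'" "val U' D' = 1" by blast
  have "a \<in> D'" using D'(1) D1(1) by blast
  then have "slot_d D' (insert (a, 1) ((\<lambda>u. (u, 0)) ` U'))" unfolding slot_d_def using D' by blast
  then show ?thesis using D'(1) D1(1) by blast
qed

sublocale slots: slot_graph "class_CF F" leq_d M A slot_d
proof
  fix T T' assume "str T" "indep T" "T' \<subseteq> T"
  then show "str T'" by (rule indep_subset_CF)
next
  show "\<exists>a. str {a}" using slot_cycle_CF by blast
next
  fix a R assume a: "str {a}" and R: "finite R" "R \<subseteq> V" "a \<in> R"
  then have "\<delta> R \<ge> 2" by (intro \<delta>_ge) auto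
  then show "card {e \<in> edges M. e \<subseteq> R} < 2 * card R" unfolding dl_def by linarith
next
  fix D I assume "slot_d D I"
  then obtain U x where D: "str D" "U \<subseteq> D" "x \<in> D" "I = insert (x, 1) ((\<lambda>u. (u, 0)) ` U)"
    unfolding slot_d_def by blast
  have f: "finite D" "D \<subseteq> V" using str_finite[OF D(1)] str_V[OF D(1)] .
  then show "finite D \<and> D \<subseteq> V \<and> finite I \<and> fst ` I \<subseteq> D"
    using D(2-4) finite_subset[OF D(2) f(1)] by auto
next
  fix D assume "finite D" "D \<subseteq> V"
  then show "\<exists>D' I. D \<subseteq> D' \<and> slot_d D' I" by (rule slot_cover_CF)
next
  fix x assume x: "str {x}"
  show "slot_d {x} {(x, 0), (x, 1)}"
    unfolding slot_d_def
    using x pos_singleton[of x] by (intro conjI exI[of _ "{x}"] exI[of _ x]) auto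
next
  show "\<exists>D I. slot_d D I \<and> D \<noteq> {} \<and> (\<forall>y\<in>D. str {y} \<and> card {i \<in> I. fst i = y} = 1)"
    by (rule slot_cycle_CF)
next
  fix D I and r :: nat assume sl: "slot_d D I"
  obtain k where k: "\<forall>S T X F. two_orientation M S \<and> card T = k \<and> str X \<and> str T \<and>
      str (X \<union> T) \<and> X \<inter> T = {} \<and> indep (X \<union> T) \<and> spread S r T \<and> finite F \<and> F \<subseteq> V \<longrightarrow>
      (\<exists>h c. slot_copy S r D I T X F h c)" using slot_d_copies[OF sl] by blast
  show "\<exists>k. \<forall>S T X F. two_orientation M S \<and> card T = k \<and> str X \<and>
      str (X \<union> T) \<and> X \<inter> T = {} \<and> indep (X \<union> T) \<and> spread S r T \<and> finite F \<and> F \<subseteq> V \<longrightarrow>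
      (\<exists>h c. slot_copy S r D I T X F h c)"
  proof (intro exI[of _ k] allI impI)
    fix S T X F assume a: "two_orientation M S \<and> card T = k \<and> str X \<and>
      str (X \<union> T) \<and> X \<inter> T = {} \<and> indep (X \<union> T) \<and> spread S r T \<and> finite F \<and> F \<subseteq> V"
    then have "str T" using indep_subset_CF[of "X \<union> T" T] by blast
    then show "\<exists>h c. slot_copy S r D I T X F h c" using k a by blast
  qed
qed

end

section \<open>Recurrence against separation, for both kinds of classes\<close>

lemma limit_graph_exists:
  assumes "amalgamation_class C leq" "fraisse_limit C leq M"
  shows "\<exists>A. limit_graph C leq M A"
  using assms unfolding fraisse_limit_def limit_graph_def limit_graph_axioms_def by auto

lemma minimal_flow_orbit_meagre:
  assumes min: "minimal_subflow M Y" and count: "countable (verts M)" and S: "S \<in> Y"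
    and unbounded: "\<And>S. two_orientation M S \<Longrightarrow>
      (\<And>a. a \<in> verts M \<Longrightarrow> \<exists>D. finite D \<and> D \<subseteq> verts M \<and> (\<forall>h\<in>automorphisms M. \<exists>d\<in>D.
        (\<exists>g\<in>automorphisms M. h d = g a) \<and> (\<forall>n. card (out_ball S n (h d)) = card (out_ball S n a)))) \<Longrightarrow> False"
  shows "meagre_in (subtopology (orientation_space M) Y) (orbit_of M S)"
proof (rule ccontr)
  assume nonmeagre: "\<not> meagre_in (subtopology (orientation_space M) Y) (orbit_of M S)"
  interpret minimal_flow M Y using min by (rule minimal_flow.intro)
  show False
    using unbounded[OF Y_orientation[OF S]] out_ball_sizes_syndetic[OF S nonmeagre count] by blast
qed

lemma orbits_meagre_C0:
  fixes M :: "'a::infinite graph"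
  assumes "fraisse_limit class_C0 leq_s M" "minimal_subflow M Y" "S \<in> Y"
  shows "meagre_in (subtopology (orientation_space M) Y) (orbit_of M S)"
proof -
  obtain A where "limit_graph class_C0 leq_s M A"
    using limit_graph_exists[OF amalgamation_class_C0 assms(1)] by blast
  then interpret limit_C0 M A by (rule limit_C0.intro)
  show ?thesis
    by (rule minimal_flow_orbit_meagre[OF assms(2) M_countable assms(3) slots.out_ball_sizes_not_syndetic])
qed

lemma orbits_meagre_CF:
  fixes M :: "'a::infinite graph"
  assumes "free_amalgamation_class (class_CF F :: 'a graph set) leq_d"
    and "\<And>(B :: 'a graph) a. B \<in> class_CF F \<Longrightarrow> a \<in> verts B \<Longrightarrow> leq_d (induced B {a}) B"
    and "\<exists>B\<in>(class_CF F :: 'a graph set). edges B \<noteq> {}"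
    and "fraisse_limit (class_CF F) leq_d M" "minimal_subflow M Y" "S \<in> Y"
  shows "meagre_in (subtopology (orientation_space M) Y) (orbit_of M S)"
proof -
  obtain A where "limit_graph (class_CF F) leq_d M A"
    using limit_graph_exists[OF amalgamation_class_CF[OF assms(1,2)] assms(4)] by blast
  then interpret limit_CF F M A
    by (rule limit_CF.intro) (rule limit_CF_axioms.intro[OF assms(2,3)])
  show ?thesis
    by (rule minimal_flow_orbit_meagre[OF assms(5) M_countable assms(6) slots.out_ball_sizes_not_syndetic])
qed

theorem theorem5p2:
  fixes C :: "'a::infinite graph set"
    and leq :: "'a graph \<Rightarrow> 'a graph \<Rightarrow> bool"
    and M :: "'a graph"
    and Y :: "('a \<times> 'a) set set"
  assumes class_cases:
    "(C = class_C0 \<and> leq = leq_s) \<or>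
     (\<exists>F. control_function F \<and> C = class_CF F \<and> leq = leq_d \<and>
          free_amalgamation_class C leq \<and>
          (\<forall>A\<in>C. \<forall>a\<in>verts A. leq_d (induced A {a}) A) \<and>
          (\<exists>A\<in>C. edges A \<noteq> {}))"
    and limit: "fraisse_limit C leq M"
    and minimal: "minimal_subflow M Y"
  shows "\<forall>S\<in>Y. meagre_in (subtopology (orientation_space M) Y) (orbit_of M S)"
  using class_cases
proof (elim disjE exE conjE)
  assume "C = class_C0" "leq = leq_s"
  then show ?thesis using limit orbits_meagre_C0[OF _ minimal] by simp
next
  fix F
  assume "C = class_CF F" "leq = leq_d" "free_amalgamation_class C leq"
    "\<forall>A\<in>C. \<forall>a\<in>verts A. leq_d (induced A {a}) A" "\<exists>A\<in>C. edges A \<noteq> {}"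
  then show ?thesis using limit orbits_meagre_CF[OF _ _ _ _ minimal, of F] by simp
qed

end
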